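(* Every strongly finitary monad $\mathbb{T}=(T,\mu,\eta)$ on $\mathsf{CPO}$ is (up to isomorphism of monads) the free-algebra monad of the variety $\mathcal{V}_{\mathbb{T}}$ of continuous algebras associated to $\mathbb{T}$.
   Context: $\mathsf{CPO}$ is the category of posets with joins of $\omega$-chains ("cpos", no least element required) and continuous maps (monotone maps preserving joins of $\omega$-chains). Hom-sets are cpos under the pointwise order. All endofunctors and monads are enriched, i.e. functors are locally continuous: monotone on hom-sets and preserving joins of $\omega$-chains in hom-sets. Natural transformations are ordinary ones. Strong finitarity: let $K:\mathsf{Set}_{\mathrm{fin}}\to\mathsf{CPO}$ send a finite set to the discrete cpo on it. An endofunctor $F$ of $\mathsf{CPO}$ is strongly finitary if $F=\mathrm{Lan}_K(F\cdot K)$ (enriched left Kan extension): for every enriched endofunctor $G$ and every natural transformation $\sigma:FK\to GK$ there is a unique natural transformation $\bar\sigma:F\to G$ with $\bar\sigma K=\sigma$. A monad is strongly finitary if its underlying endofunctor is. Continuous algebras: for a finitary signature $\Sigma$, a continuous algebra is a cpo $A$ with a continuous operation $\sigma_A:A^n\to A$ for each $\sigma\in\Sigma_n$; $\Sigma\text{-}\mathsf{CPO}$ is the category of these and continuous homomorphisms. Let $V=\{x_i\mid i\in\mathbb{N}\}$ be a fixed countable set of variables, and $T_\Sigma V$ the set of usual terms. The set $\mathscr{T}_\Sigma V$ of extended terms is the smallest set containing $T_\Sigma V$ and such that for every collection $t_k$ ($k\in\mathbb{N}$) of extended terms containing altogether only finitely many variables, the formal join $\bigvee_{k\in\mathbb{N}}t_k$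 is an extended term. For a continuous algebra $A$ and a map $f:V\to A$, the partial map $f^{@}:\mathscr{T}_\Sigma V\rightharpoonup A$ extends the usual interpretation of terms, and is defined in $\bigvee_k t_k$ iff each $f^{@}(t_k)$ is defined and $f^{@}(t_k)\sqsubseteq f^{@}(t_{k+1})$ for all $k$; then its value is $\bigsqcup_k f^{@}(t_k)$. An equation is a pair $t=t'$ of extended terms; $A$ satisfies it if for every $f:V\to A$ both $f^{@}(t)$ and $f^{@}(t')$ are defined and equal. A variety is a full subcategory of $\Sigma\text{-}\mathsf{CPO}$ presented by a set of equations. The forgetful functor $U_{\mathcal V}:\mathcal V\to\mathsf{CPO}$ of every variety has a left adjoint $F_{\mathcal{V}}$; the induced monad on $\mathsf{CPO}$, with underlying functor $U_{\mathcal V}F_{\mathcal V}$, is the free-algebra monad of $\mathcal V$. The variety $\mathcal{V}_{\mathbb{T}}$: let $V_n=\{x_i\mid i<n\}$ (discrete cpo). For a morphism $k:X\to TY$ put $k^*=\mu_Y\cdot Tk:TX\to TY$. The signature has $\Sigma_n=|TV_n|$ (the underlying set of $TV_n$) for $n\in\mathbb{N}$; each $\sigma\in\Sigma_n$ is also regarded as the term $\sigma(x_0,\dots,x_{n-1})$. The variety $\mathcal{V}_{\mathbb{T}}$ is presented by the following equations, where $n,m$ range over $\mathbb{N}$: (1) $\sigma=\bigvee_{k\in\mathbb{N}}\sigma_k$ for every $\omega$-chain $(\sigma_k)$ in $TV_n$ with $\sigma=\bigsqcup_k\sigma_k$; (2) $k^*(\sigma)=\sigma(k(x_i))_{i<n}$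 for all $\sigma\in\Sigma_n$ and all maps $k:V_n\to\Sigma_m=|TV_m|$; (3) $\eta_{V_n}(x_i)=x_i$ for $i=0,\dots,n-1$. *)

theory Defs
  imports "HOL-Library.FuncSet" "HOL-Library.Equipollence"
begin

section \<open>The category of cpos\<close>

text \<open>
  A poset is given by its order relation \<open>X\<close>, a reflexive partial order on \<open>Field X\<close>; thus
  \<open>(a, b) \<in> X\<close> is \<open>a \<sqsubseteq> b\<close>, the underlying set is \<open>Field X\<close>, and the discrete poset
  on a set \<open>A\<close> is \<open>Id_on A\<close>.
\<close>

definition omega_chain :: "'a rel \<Rightarrow> (nat \<Rightarrow> 'a) \<Rightarrow> bool" where
  "omega_chain X c \<longleftrightarrow> (\<forall>k. (c k, c (Suc k)) \<in> X)"

definition is_join :: "'a rel \<Rightarrow> (nat \<Rightarrow> 'a) \<Rightarrow> 'a \<Rightarrow> bool" where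
  "is_join X c s \<longleftrightarrow> s \<in> Field X \<and> (\<forall>k. (c k, s) \<in> X) \<and> (\<forall>u. (\<forall>k. (c k, u) \<in> X) \<longrightarrow> (s, u) \<in> X)"

definition join :: "'a rel \<Rightarrow> (nat \<Rightarrow> 'a) \<Rightarrow> 'a" where
  "join X c = (THE s. is_join X c s)"

definition is_cpo :: "'a rel \<Rightarrow> bool" where
  "is_cpo X \<longleftrightarrow> Partial_order X \<and> (\<forall>c. omega_chain X c \<longrightarrow> (\<exists>s. is_join X c s))"

definition omega_cont :: "'a rel \<Rightarrow> 'b rel \<Rightarrow> ('a \<Rightarrow> 'b) \<Rightarrow> bool" where
  "omega_cont X Y f \<longleftrightarrow>
     f \<in> Field X \<rightarrow> Field Y \<and>
     (\<forall>a b. (a, b) \<in> X \<longrightarrow> (f a, f b) \<in> Y) \<and>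
     (\<forall>c s. omega_chain X c \<and> is_join X c s \<longrightarrow> is_join Y (\<lambda>k. f (c k)) (f s))"

text \<open>
  Morphisms are extensional functions (\<open>undefined\<close> off the source), so that equality of morphisms
  with given source and target is HOL equality.
\<close>

definition cpo_hom :: "'a rel \<Rightarrow> 'b rel \<Rightarrow> ('a \<Rightarrow> 'b) set" where
  "cpo_hom X Y = {f. f \<in> extensional (Field X) \<and> omega_cont X Y f}"

abbreviation cpo_id :: "'a rel \<Rightarrow> 'a \<Rightarrow> 'a" where
  "cpo_id X \<equiv> (\<lambda>a\<in>Field X. a)"

text \<open>\<open>hom_cpo X Y\<close> is the pointwise order on the hom-set \<open>cpo_hom X Y\<close>.\<close>

definition hom_cpo :: "'a rel \<Rightarrow> 'b rel \<Rightarrow> ('a \<Rightarrow> 'b) rel" where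
  "hom_cpo X Y = {(f, g). f \<in> cpo_hom X Y \<and> g \<in> cpo_hom X Y \<and> (\<forall>a\<in>Field X. (f a, g a) \<in> Y)}"

text \<open>
  HOL has no type of all sets, so ``the category of all cpos'' is formed relative to a universe of
  small sets: a collection \<open>\<U>\<close> of subsets of a type \<open>'u\<close>, and \<open>CPO \<U>\<close> consists of the cpos whose
  underlying set is in \<open>\<U>\<close>. Only the closure properties needed to form free continuous algebras are
  required of \<open>\<U>\<close>. The small subsets of a Grothendieck universe have them (lemma
  \<open>universe_if_Grothendieck\<close>), and so have all subsets of a type of the cardinality of the
  continuum (lemma \<open>universe_UNIV\<close>).
\<close>

definition universe :: "'u set set \<Rightarrow> bool" where
  "universe \<U> \<longleftrightarrow>
     (\<forall>A\<in>\<U>. \<forall>B :: 'u set. B \<lesssim> A \<longrightarrow> B \<in> \<U>) \<and>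
     (\<exists>A\<in>\<U>. infinite A) \<and>
     (\<forall>A :: nat \<Rightarrow> 'u set. range A \<subseteq> \<U> \<longrightarrow> (\<Union>n. A n) \<in> \<U>) \<and>
     (\<forall>A\<in>\<U>. \<exists>B\<in>\<U>. ((UNIV :: nat set) \<rightarrow>\<^sub>E A) \<lesssim> B)"

definition CPO :: "'u set set \<Rightarrow> 'u rel set" where
  "CPO \<U> = {X. is_cpo X \<and> Field X \<in> \<U>}"

section \<open>Enriched endofunctors, natural transformations, monads\<close>

record 'u endo =
  obj :: "'u rel \<Rightarrow> 'u rel"
  mor :: "'u rel \<Rightarrow> 'u rel \<Rightarrow> ('u \<Rightarrow> 'u) \<Rightarrow> ('u \<Rightarrow> 'u)"

text \<open>The last conjunct, local continuity, includes that \<open>mor F X Y\<close> maps hom-sets to hom-sets.\<close>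

definition enriched_endo :: "'u set set \<Rightarrow> 'u endo \<Rightarrow> bool" where
  "enriched_endo \<U> F \<longleftrightarrow>
     (\<forall>X\<in>CPO \<U>. obj F X \<in> CPO \<U>) \<and>
     (\<forall>X\<in>CPO \<U>. mor F X X (cpo_id X) = cpo_id (obj F X)) \<and>
     (\<forall>X\<in>CPO \<U>. \<forall>Y\<in>CPO \<U>. \<forall>Z\<in>CPO \<U>. \<forall>f\<in>cpo_hom X Y. \<forall>g\<in>cpo_hom Y Z.
        mor F X Z (compose (Field X) g f) = compose (Field (obj F X)) (mor F Y Z g) (mor F X Y f)) \<and>
     (\<forall>X\<in>CPO \<U>. \<forall>Y\<in>CPO \<U>.
        omega_cont (hom_cpo X Y) (hom_cpo (obj F X) (obj F Y)) (mor F X Y))"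

definition id_endo :: "'u endo" where
  "id_endo = \<lparr>obj = (\<lambda>X. X), mor = (\<lambda>X Y f. f)\<rparr>"

definition comp_endo :: "'u endo \<Rightarrow> 'u endo \<Rightarrow> 'u endo" where
  "comp_endo G F =
     \<lparr>obj = (\<lambda>X. obj G (obj F X)), mor = (\<lambda>X Y f. mor G (obj F X) (obj F Y) (mor F X Y f))\<rparr>"

definition nat_trans :: "'u set set \<Rightarrow> 'u endo \<Rightarrow> 'u endo \<Rightarrow> ('u rel \<Rightarrow> 'u \<Rightarrow> 'u) \<Rightarrow> bool" where
  "nat_trans \<U> F G \<alpha> \<longleftrightarrow>
     \<alpha> \<in> extensional (CPO \<U>) \<and>
     (\<forall>X\<in>CPO \<U>. \<alpha> X \<in> cpo_hom (obj F X) (obj G X)) \<and>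
     (\<forall>X\<in>CPO \<U>. \<forall>Y\<in>CPO \<U>. \<forall>f\<in>cpo_hom X Y.
        compose (Field (obj F X)) (mor G X Y f) (\<alpha> X) = compose (Field (obj F X)) (\<alpha> Y) (mor F X Y f))"

text \<open>
  Natural transformations \<open>F K \<rightarrow> G K\<close>, where \<open>K\<close> sends a finite set \<open>A\<close> to the discrete cpo
  \<open>Id_on A\<close>; the morphisms \<open>A \<rightarrow> B\<close> between finite sets are all functions.
\<close>

definition nat_trans_K :: "'u endo \<Rightarrow> 'u endo \<Rightarrow> ('u set \<Rightarrow> 'u \<Rightarrow> 'u) \<Rightarrow> bool" where
  "nat_trans_K F G \<sigma> \<longleftrightarrow>
     (\<forall>A. finite A \<longrightarrow> \<sigma> A \<in> cpo_hom (obj F (Id_on A)) (obj G (Id_on A))) \<and>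
     (\<forall>A B. finite A \<and> finite B \<longrightarrow> (\<forall>f\<in>A \<rightarrow>\<^sub>E B.
        compose (Field (obj F (Id_on A))) (mor G (Id_on A) (Id_on B) f) (\<sigma> A)
        = compose (Field (obj F (Id_on A))) (\<sigma> B) (mor F (Id_on A) (Id_on B) f)))"

definition strongly_finitary :: "'u set set \<Rightarrow> 'u endo \<Rightarrow> bool" where
  "strongly_finitary \<U> F \<longleftrightarrow>
     (\<forall>G \<sigma>. enriched_endo \<U> G \<and> nat_trans_K F G \<sigma> \<longrightarrow>
        (\<exists>!\<tau>. nat_trans \<U> F G \<tau> \<and> (\<forall>A. finite A \<longrightarrow> \<tau> (Id_on A) = \<sigma> A)))"

record 'u monad =
  endo :: "'u endo"
  unit :: "'u rel \<Rightarrow> 'u \<Rightarrow> 'u"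
  mult :: "'u rel \<Rightarrow> 'u \<Rightarrow> 'u"

abbreviation Tobj :: "'u monad \<Rightarrow> 'u rel \<Rightarrow> 'u rel" where
  "Tobj T \<equiv> obj (endo T)"

abbreviation Tmor :: "'u monad \<Rightarrow> 'u rel \<Rightarrow> 'u rel \<Rightarrow> ('u \<Rightarrow> 'u) \<Rightarrow> ('u \<Rightarrow> 'u)" where
  "Tmor T \<equiv> mor (endo T)"

definition enriched_monad :: "'u set set \<Rightarrow> 'u monad \<Rightarrow> bool" where
  "enriched_monad \<U> T \<longleftrightarrow>
     enriched_endo \<U> (endo T) \<and>
     nat_trans \<U> id_endo (endo T) (unit T) \<and>
     nat_trans \<U> (comp_endo (endo T) (endo T)) (endo T) (mult T) \<and>
     (\<forall>X\<in>CPO \<U>.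
        compose (Field (Tobj T X)) (mult T X) (unit T (Tobj T X)) = cpo_id (Tobj T X) \<and>
        compose (Field (Tobj T X)) (mult T X) (Tmor T X (Tobj T X) (unit T X)) = cpo_id (Tobj T X) \<and>
        compose (Field (Tobj T (Tobj T (Tobj T X)))) (mult T X) (mult T (Tobj T X))
        = compose (Field (Tobj T (Tobj T (Tobj T X)))) (mult T X)
            (Tmor T (Tobj T (Tobj T X)) (Tobj T X) (mult T X)))"

definition strongly_finitary_monad :: "'u set set \<Rightarrow> 'u monad \<Rightarrow> bool" where
  "strongly_finitary_monad \<U> T \<longleftrightarrow> enriched_monad \<U> T \<and> strongly_finitary \<U> (endo T)"

definition cpo_iso :: "'a rel \<Rightarrow> 'b rel \<Rightarrow> ('a \<Rightarrow> 'b) \<Rightarrow> bool" where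
  "cpo_iso X Y f \<longleftrightarrow> f \<in> cpo_hom X Y \<and>
     (\<exists>g\<in>cpo_hom Y X. compose (Field X) g f = cpo_id X \<and> compose (Field Y) f g = cpo_id Y)"

definition monad_morphism :: "'u set set \<Rightarrow> 'u monad \<Rightarrow> 'u monad \<Rightarrow> ('u rel \<Rightarrow> 'u \<Rightarrow> 'u) \<Rightarrow> bool" where
  "monad_morphism \<U> S T \<alpha> \<longleftrightarrow>
     nat_trans \<U> (endo S) (endo T) \<alpha> \<and>
     (\<forall>X\<in>CPO \<U>.
        compose (Field X) (\<alpha> X) (unit S X) = unit T X \<and>
        compose (Field (Tobj S (Tobj S X))) (\<alpha> X) (mult S X)
        = compose (Field (Tobj S (Tobj S X))) (mult T X)
            (compose (Field (Tobj S (Tobj S X))) (\<alpha> (Tobj T X)) (Tmor S (Tobj S X) (Tobj T X) (\<alpha> X))))"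

definition isomorphic_monads :: "'u set set \<Rightarrow> 'u monad \<Rightarrow> 'u monad \<Rightarrow> bool" where
  "isomorphic_monads \<U> S T \<longleftrightarrow>
     (\<exists>\<alpha>. monad_morphism \<U> S T \<alpha> \<and> (\<forall>X\<in>CPO \<U>. cpo_iso (Tobj S X) (Tobj T X) (\<alpha> X)))"

section \<open>Continuous algebras\<close>

text \<open>
  A signature is \<open>\<Sigma> :: nat \<Rightarrow> 's set\<close>, with \<open>\<Sigma> n\<close> the set of \<open>n\<close>-ary symbols. The sets \<open>\<Sigma> n\<close> need
  not be disjoint: a symbol is applied to a list of arguments, and the length of the list tells
  which arity is meant. Accordingly \<open>A\<^sup>n\<close> is the cpo of lists of length \<open>n\<close>, ordered coordinatewise.
\<close>

definition cpo_power :: "'a rel \<Rightarrow> nat \<Rightarrow> 'a list rel" where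
  "cpo_power X n = {(as, bs). length as = n \<and> length bs = n \<and> (\<forall>i<n. (as ! i, bs ! i) \<in> X)}"

record ('s, 'u) alg =
  carr :: "'u rel"
  oper :: "'s \<Rightarrow> 'u list \<Rightarrow> 'u"

definition continuous_alg :: "'u set set \<Rightarrow> (nat \<Rightarrow> 's set) \<Rightarrow> ('s, 'u) alg \<Rightarrow> bool" where
  "continuous_alg \<U> \<Sigma> A \<longleftrightarrow>
     carr A \<in> CPO \<U> \<and> (\<forall>n. \<forall>\<sigma>\<in>\<Sigma> n. omega_cont (cpo_power (carr A) n) (carr A) (oper A \<sigma>))"

definition alg_hom :: "(nat \<Rightarrow> 's set) \<Rightarrow> ('s, 'u) alg \<Rightarrow> ('s, 'u) alg \<Rightarrow> ('u \<Rightarrow> 'u) set" where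
  "alg_hom \<Sigma> A B = {h \<in> cpo_hom (carr A) (carr B).
     \<forall>n. \<forall>\<sigma>\<in>\<Sigma> n. \<forall>as. length as = n \<and> set as \<subseteq> Field (carr A) \<longrightarrow>
       h (oper A \<sigma> as) = oper B \<sigma> (map h as)}"

text \<open>The variable \<open>x\<^sub>i\<close> is represented in terms by its index \<open>i\<close>, and a map \<open>V \<rightarrow> A\<close> by a sequence.\<close>

datatype 's trm = Var nat | App 's "'s trm list"

datatype 's xtrm = Trm "'s trm" | Join "nat \<Rightarrow> 's xtrm"

primrec trm_vars :: "'s trm \<Rightarrow> nat set" where
  "trm_vars (Var i) = {i}"
| "trm_vars (App \<sigma> ts) = \<Union> (set (map trm_vars ts))"

primrec xtrm_vars :: "'s xtrm \<Rightarrow> nat set" where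
  "xtrm_vars (Trm t) = trm_vars t"
| "xtrm_vars (Join t) = (\<Union>k. xtrm_vars (t k))"

inductive_set trms :: "(nat \<Rightarrow> 's set) \<Rightarrow> 's trm set" for \<Sigma> :: "nat \<Rightarrow> 's set" where
  Var: "Var i \<in> trms \<Sigma>"
| App: "\<sigma> \<in> \<Sigma> (length ts) \<Longrightarrow> (\<And>t. t \<in> set ts \<Longrightarrow> t \<in> trms \<Sigma>) \<Longrightarrow> App \<sigma> ts \<in> trms \<Sigma>"

inductive_set extended_trms :: "(nat \<Rightarrow> 's set) \<Rightarrow> 's xtrm set" for \<Sigma> :: "nat \<Rightarrow> 's set" where
  Trm: "t \<in> trms \<Sigma> \<Longrightarrow> Trm t \<in> extended_trms \<Sigma>"
| Join: "(\<And>k. t k \<in> extended_trms \<Sigma>) \<Longrightarrow> finite (\<Union>k. xtrm_vars (t k)) \<Longrightarrow>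
    Join t \<in> extended_trms \<Sigma>"

primrec trm_val :: "('s, 'u) alg \<Rightarrow> (nat \<Rightarrow> 'u) \<Rightarrow> 's trm \<Rightarrow> 'u" where
  "trm_val A f (Var i) = f i"
| "trm_val A f (App \<sigma> ts) = oper A \<sigma> (map (trm_val A f) ts)"

text \<open>The partial map \<open>f\<^sup>@\<close>; \<open>None\<close> means undefined.\<close>

primrec xtrm_val :: "('s, 'u) alg \<Rightarrow> (nat \<Rightarrow> 'u) \<Rightarrow> 's xtrm \<Rightarrow> 'u option" where
  "xtrm_val A f (Trm t) = Some (trm_val A f t)"
| "xtrm_val A f (Join t) =
     (if (\<forall>k. xtrm_val A f (t k) \<noteq> None) \<and>
         (\<forall>k. (the (xtrm_val A f (t k)), the (xtrm_val A f (t (Suc k)))) \<in> carr A)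
      then Some (join (carr A) (\<lambda>k. the (xtrm_val A f (t k))))
      else None)"

definition satisfies :: "('s, 'u) alg \<Rightarrow> 's xtrm \<times> 's xtrm \<Rightarrow> bool" where
  "satisfies A e \<longleftrightarrow> (\<forall>f. range f \<subseteq> Field (carr A) \<longrightarrow>
     (\<exists>a. xtrm_val A f (fst e) = Some a \<and> xtrm_val A f (snd e) = Some a))"

definition variety :: "'u set set \<Rightarrow> (nat \<Rightarrow> 's set) \<Rightarrow> ('s xtrm \<times> 's xtrm) set \<Rightarrow> ('s, 'u) alg set" where
  "variety \<U> \<Sigma> E = {A. continuous_alg \<U> \<Sigma> A \<and> (\<forall>e\<in>E. satisfies A e)}"

section \<open>The free-algebra monad\<close>

text \<open>
  \<open>\<V>\<close> is the object class of a full subcategory of the continuous \<open>\<Sigma>\<close>-algebras. A left adjoint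
  \<open>F\<close> of the forgetful functor \<open>U = carr\<close> is given by its object map \<open>Fo\<close> and morphism map \<open>Fm\<close>.
\<close>

definition UF :: "('u rel \<Rightarrow> ('s, 'u) alg) \<Rightarrow> ('u rel \<Rightarrow> 'u rel \<Rightarrow> ('u \<Rightarrow> 'u) \<Rightarrow> ('u \<Rightarrow> 'u)) \<Rightarrow> 'u endo" where
  "UF Fo Fm = \<lparr>obj = (\<lambda>X. carr (Fo X)), mor = Fm\<rparr>"

text \<open>
  An adjunction \<open>F \<stileturn> U\<close> presented by unit, counit and the triangle identities. Since \<open>U\<close> is the
  identity on morphisms, \<open>F\<close> is an enriched functor iff it takes values in \<open>\<V>\<close> and its
  homomorphisms and \<open>UF\<close> is an enriched endofunctor.
\<close>

definition free_adjunction ::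
  "'u set set \<Rightarrow> (nat \<Rightarrow> 's set) \<Rightarrow> ('s, 'u) alg set \<Rightarrow>
   ('u rel \<Rightarrow> ('s, 'u) alg) \<Rightarrow> ('u rel \<Rightarrow> 'u rel \<Rightarrow> ('u \<Rightarrow> 'u) \<Rightarrow> ('u \<Rightarrow> 'u)) \<Rightarrow>
   ('u rel \<Rightarrow> 'u \<Rightarrow> 'u) \<Rightarrow> (('s, 'u) alg \<Rightarrow> 'u \<Rightarrow> 'u) \<Rightarrow> bool" where
  "free_adjunction \<U> \<Sigma> \<V> Fo Fm \<eta> \<epsilon> \<longleftrightarrow>
     (\<forall>X\<in>CPO \<U>. Fo X \<in> \<V>) \<and>
     (\<forall>X\<in>CPO \<U>. \<forall>Y\<in>CPO \<U>. \<forall>f\<in>cpo_hom X Y. Fm X Y f \<in> alg_hom \<Sigma> (Fo X) (Fo Y)) \<and>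
     enriched_endo \<U> (UF Fo Fm) \<and>
     nat_trans \<U> id_endo (UF Fo Fm) \<eta> \<and>
     (\<forall>A\<in>\<V>. \<epsilon> A \<in> alg_hom \<Sigma> (Fo (carr A)) A) \<and>
     (\<forall>A\<in>\<V>. \<forall>B\<in>\<V>. \<forall>h\<in>alg_hom \<Sigma> A B.
        compose (Field (carr (Fo (carr A)))) h (\<epsilon> A)
        = compose (Field (carr (Fo (carr A)))) (\<epsilon> B) (Fm (carr A) (carr B) h)) \<and>
     (\<forall>X\<in>CPO \<U>. compose (Field (carr (Fo X))) (\<epsilon> (Fo X)) (Fm X (carr (Fo X)) (\<eta> X))
        = cpo_id (carr (Fo X))) \<and>
     (\<forall>A\<in>\<V>. compose (Field (carr A)) (\<epsilon> A) (\<eta> (carr A)) = cpo_id (carr A))"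

definition free_algebra_monad ::
  "'u set set \<Rightarrow> (nat \<Rightarrow> 's set) \<Rightarrow> ('s, 'u) alg set \<Rightarrow> 'u monad \<Rightarrow> bool" where
  "free_algebra_monad \<U> \<Sigma> \<V> M \<longleftrightarrow>
     (\<exists>Fo Fm \<eta> \<epsilon>. free_adjunction \<U> \<Sigma> \<V> Fo Fm \<eta> \<epsilon> \<and>
        M = \<lparr>endo = UF Fo Fm, unit = \<eta>, mult = (\<lambda>X\<in>CPO \<U>. \<epsilon> (Fo X))\<rparr>)"

section \<open>The variety associated to a monad\<close>

text \<open>
  Discrete cpos have to live in \<open>'u\<close>, so the variables also occur as the values \<open>x i\<close> of an
  injective sequence \<open>x :: nat \<Rightarrow> 'u\<close>.
\<close>

definition Vn :: "(nat \<Rightarrow> 'u) \<Rightarrow> nat \<Rightarrow> 'u rel" where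
  "Vn x n = Id_on (x ` {..<n})"

definition kleisli_ext :: "'u monad \<Rightarrow> 'u rel \<Rightarrow> 'u rel \<Rightarrow> ('u \<Rightarrow> 'u) \<Rightarrow> 'u \<Rightarrow> 'u" where
  "kleisli_ext T X Y k = compose (Field (Tobj T X)) (mult T Y) (Tmor T X (Tobj T Y) k)"

definition monad_sig :: "(nat \<Rightarrow> 'u) \<Rightarrow> 'u monad \<Rightarrow> nat \<Rightarrow> 'u set" where
  "monad_sig x T n = Field (Tobj T (Vn x n))"

text \<open>An \<open>n\<close>-ary symbol \<open>\<sigma>\<close> regarded as the term \<open>\<sigma>(x\<^sub>0, \<dots>, x\<^bsub>n-1\<^esub>)\<close>.\<close>

definition sym_trm :: "nat \<Rightarrow> 's \<Rightarrow> 's trm" where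
  "sym_trm n \<sigma> = App \<sigma> (map Var [0..<n])"

definition monad_eqs :: "(nat \<Rightarrow> 'u) \<Rightarrow> 'u monad \<Rightarrow> ('u xtrm \<times> 'u xtrm) set" where
  "monad_eqs x T =
     {(Trm (sym_trm n \<sigma>), Join (\<lambda>k. Trm (sym_trm n (s k)))) | n \<sigma> s.
        omega_chain (Tobj T (Vn x n)) s \<and> is_join (Tobj T (Vn x n)) s \<sigma>} \<union>
     {(Trm (sym_trm m (kleisli_ext T (Vn x n) (Vn x m) k \<sigma>)),
       Trm (App \<sigma> (map (\<lambda>i. sym_trm m (k (x i))) [0..<n]))) | n m k \<sigma>.
        \<sigma> \<in> monad_sig x T n \<and> k \<in> x ` {..<n} \<rightarrow>\<^sub>E monad_sig x T m} \<union>
     {(Trm (sym_trm n (unit T (Vn x n) (x i))), Trm (Var i)) | n i. i < n}"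

definition monad_variety :: "'u set set \<Rightarrow> (nat \<Rightarrow> 'u) \<Rightarrow> 'u monad \<Rightarrow> ('u, 'u) alg set" where
  "monad_variety \<U> x T = variety \<U> (monad_sig x T) (monad_eqs x T)"

section \<open>Sanity checks\<close>

lemma universe_UNIV: "universe (UNIV :: (nat \<Rightarrow> bool) set set)"
proof -
  have inf: "infinite (UNIV :: (nat \<Rightarrow> bool) set)"
  proof
    assume "finite (UNIV :: (nat \<Rightarrow> bool) set)"
    moreover have "inj (\<lambda>i j :: nat. i = j)"
      by (rule injI) metis
    ultimately have "finite (UNIV :: nat set)"
      using finite_imageD finite_subset subset_UNIV by metis
    then show False by simp
  qed
  have pow: "((UNIV :: nat set) \<rightarrow>\<^sub>E A) \<lesssim> (UNIV :: (nat \<Rightarrow> bool) set)" for A :: "(nat \<Rightarrow> bool) set"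
  proof -
    have "inj (\<lambda>f :: nat \<Rightarrow> nat \<Rightarrow> bool. \<lambda>p. f (fst (prod_decode p)) (snd (prod_decode p)))"
    proof (rule injI)
      fix f g :: "nat \<Rightarrow> nat \<Rightarrow> bool"
      assume eq: "(\<lambda>p. f (fst (prod_decode p)) (snd (prod_decode p)))
        = (\<lambda>p. g (fst (prod_decode p)) (snd (prod_decode p)))"
      show "f = g"
      proof (intro ext)
        fix i j
        show "f i j = g i j"
          using fun_cong[OF eq, of "prod_encode (i, j)"] by simp
      qed
    qed
    then show ?thesis
      unfolding lepoll_def by (meson inj_on_subset subset_UNIV)
  qed
  show ?thesis
    unfolding universe_def using inf pow by blast
qed

lemma universe_if_Grothendieck:
  fixes \<U> :: "'u set set"
  assumes sub: "\<And>A B :: 'u set. A \<in> \<U> \<Longrightarrow> B \<lesssim> A \<Longrightarrow> B \<in> \<U>"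
    and inf: "\<exists>A\<in>\<U>. infinite A"
    and pow: "\<And>A. A \<in> \<U> \<Longrightarrow> \<exists>B\<in>\<U>. Pow A \<lesssim> B"
    and union: "\<And>I A. I \<in> \<U> \<Longrightarrow> (\<And>i. i \<in> I \<Longrightarrow> A i \<in> \<U>) \<Longrightarrow> (\<Union>i\<in>I. A i) \<in> \<U>"
  shows "universe \<U>"
proof -
  obtain N where N: "N \<in> \<U>" "infinite N" using inf by blast
  obtain e :: "nat \<Rightarrow> 'u" where e: "inj e" "range e \<subseteq> N"
    using infinite_countable_subset[OF N(2)] by blast
  have rng: "range e \<in> \<U>"
    using sub[OF N(1)] subset_imp_lepoll[OF e(2)] by blast
  have cunion: "(\<Union>n. A n) \<in> \<U>" if "range A \<subseteq> \<U>" for A :: "nat \<Rightarrow> 'u set"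
  proof -
    have "(\<Union>i\<in>range e. A (inv e i)) \<in> \<U>"
      by (rule union[OF rng]) (use that in auto)
    moreover have "(\<Union>i\<in>range e. A (inv e i)) = (\<Union>n. A n)"
      using e(1) by simp
    ultimately show ?thesis by simp
  qed
  have un2: "A \<union> B \<in> \<U>" if "A \<in> \<U>" "B \<in> \<U>" for A B
  proof -
    have "(\<Union>n::nat. if n = 0 then A else B) \<in> \<U>"
      by (rule cunion) (use that in auto)
    moreover have "(\<Union>n::nat. if n = 0 then A else B) = A \<union> B"
      by (auto split: if_splits)
    ultimately show ?thesis by simp
  qed
  have cpow: "\<exists>B\<in>\<U>. ((UNIV :: nat set) \<rightarrow>\<^sub>E A) \<lesssim> B" if A: "A \<in> \<U>" for A
  proof -
    define C where "C = range e \<union> A"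
    have C: "C \<in> \<U>" unfolding C_def using un2[OF rng A] .
    obtain D where D: "D \<in> \<U>" "Pow C \<lesssim> D" using pow[OF C] by blast
    obtain d where d: "inj_on d (Pow C)" "d ` Pow C \<subseteq> D"
      using D(2) unfolding lepoll_def by blast
    obtain E where E: "E \<in> \<U>" "Pow D \<lesssim> E" using pow[OF D(1)] by blast
    obtain c where c: "inj_on c (Pow D)" "c ` Pow D \<subseteq> E"
      using E(2) unfolding lepoll_def by blast
    obtain B where B: "B \<in> \<U>" "Pow E \<lesssim> B" using pow[OF E(1)] by blast
    define pr where "pr = (\<lambda>n a. c {d {e n}, d {e n, a}})"
    have pr_in: "pr n a \<in> E" if "a \<in> A" for n a
    proof -
      have "{d {e n}, d {e n, a}} \<in> Pow D"
        using d(2) that unfolding C_def by (auto simp: image_subset_iff)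
      then show ?thesis using c(2) unfolding pr_def by blast
    qed
    have pr_inj: "n = m \<and> a = b" if ab: "a \<in> A" "b \<in> A" and eq: "pr n a = pr m b" for n m a b
    proof -
      have sub': "{e n} \<in> Pow C" "{e m} \<in> Pow C" "{e n, a} \<in> Pow C" "{e m, b} \<in> Pow C"
        using ab unfolding C_def by auto
      have "{d {e n}, d {e n, a}} \<in> Pow D" "{d {e m}, d {e m, b}} \<in> Pow D"
        using sub'[THEN imageI[of _ _ d], THEN subsetD[OF d(2)]] by simp_all
      then have "{d {e n}, d {e n, a}} = {d {e m}, d {e m, b}}"
        using inj_onD[OF c(1)] eq unfolding pr_def by metis
      then have "d ` {{e n}, {e n, a}} = d ` {{e m}, {e m, b}}" by simp
      moreover have "{{e n}, {e n, a}} \<subseteq> Pow C" "{{e m}, {e m, b}} \<subseteq> Pow C"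
        using sub' by simp_all
      ultimately have "{{e n}, {e n, a}} = {{e m}, {e m, b}}"
        using inj_on_image_eq_iff[OF d(1)] by metis
      then have "e n = e m \<and> a = b" by (auto simp: doubleton_eq_iff)
      then show ?thesis using e(1) by (auto dest: injD)
    qed
    have "inj_on (\<lambda>f. {pr n (f n) | n. True}) ((UNIV :: nat set) \<rightarrow>\<^sub>E A)"
    proof (rule inj_onI)
      fix f g
      assume fg: "f \<in> (UNIV :: nat set) \<rightarrow>\<^sub>E A" "g \<in> (UNIV :: nat set) \<rightarrow>\<^sub>E A"
        and eq: "{pr n (f n) | n. True} = {pr n (g n) | n. True}"
      show "f = g"
      proof
        fix n
        obtain m where "pr n (f n) = pr m (g m)" using eq by blast
        then show "f n = g n" using pr_inj[of "f n" "g m" n m] fg by auto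
      qed
    qed
    moreover have "(\<lambda>f. {pr n (f n) | n. True}) ` ((UNIV :: nat set) \<rightarrow>\<^sub>E A) \<subseteq> Pow E"
      using pr_in by auto
    ultimately have "((UNIV :: nat set) \<rightarrow>\<^sub>E A) \<lesssim> Pow E" unfolding lepoll_def by blast
    then show ?thesis using lepoll_trans[OF _ B(2)] B(1) by blast
  qed
  show ?thesis
    unfolding universe_def using sub inf cunion cpow by blast
qed

lemma Field_Id_on: "Field (Id_on A) = A"
  by (auto simp: Field_def)

lemma omega_cont_Id_on:
  assumes "Partial_order Y" "f \<in> A \<rightarrow> Field Y"
  shows "omega_cont (Id_on A) Y f"
proof -
  have r: "(y, y) \<in> Y" if "y \<in> Field Y" for y
    using that assms(1) by (auto simp: partial_order_on_def preorder_on_def refl_on_def)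
  have "is_join Y (\<lambda>k. f (c k)) (f s)" if "is_join (Id_on A) c s" for c s
  proof -
    have "c k = s" "s \<in> A" for k using that by (auto simp: is_join_def Field_Id_on)
    then show ?thesis using r assms(2) by (auto simp: is_join_def)
  qed
  then show ?thesis
    unfolding omega_cont_def using assms(2) r by (auto simp: Field_Id_on)
qed

lemma Id_on_in_CPO:
  assumes "universe \<U>" "finite A"
  shows "Id_on A \<in> CPO \<U>"
proof -
  obtain N where N: "N \<in> \<U>" "infinite N" using assms(1) unfolding universe_def by blast
  have "A \<lesssim> N" using assms(2) N(2) by (simp add: finite_lepoll_infinite)
  then have "A \<in> \<U>" using assms(1) N(1) unfolding universe_def by blast
  moreover have "is_cpo (Id_on A)"
  proof -
    have "\<exists>s. is_join (Id_on A) c s" if "omega_chain (Id_on A) c" for c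
    proof -
      have step: "c k = c (Suc k) \<and> c k \<in> A" for k
        using that unfolding omega_chain_def Id_on_iff by blast
      have const: "c k = c 0" for k
      proof (induction k)
        case (Suc k)
        then show ?case using step by metis
      qed simp
      have "c 0 \<in> A" using step by blast
      moreover have "c = (\<lambda>_. c 0)" using const by (rule ext)
      ultimately obtain a where "a \<in> A" "c = (\<lambda>_. a)" by blast
      then have "is_join (Id_on A) c a" by (auto simp: is_join_def Field_Id_on)
      then show ?thesis by blast
    qed
    moreover have "Partial_order (Id_on A)"
      unfolding partial_order_on_def preorder_on_def Field_Id_on
      by (auto intro: refl_onI transI antisymI)
    ultimately show ?thesis unfolding is_cpo_def by blast
  qed
  ultimately show ?thesis by (simp add: CPO_def Field_Id_on)
qed

text \<open>The equations defining the variety of a monad are pairs of extended terms.\<close>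

lemma monad_eqs_extended:
  fixes T :: "'u monad"
  assumes U: "universe \<U>" and T: "enriched_monad \<U> T"
  shows "monad_eqs x T \<subseteq> extended_trms (monad_sig x T) \<times> extended_trms (monad_sig x T)"
proof -
  let ?S = "monad_sig x T"
  have V: "Vn x n \<in> CPO \<U>" for n
    unfolding Vn_def by (rule Id_on_in_CPO[OF U]) simp
  have FV: "Field (Vn x n) = x ` {..<n}" for n
    by (simp add: Vn_def Field_Id_on)
  have TV: "Tobj T (Vn x n) \<in> CPO \<U>" for n
    using T V unfolding enriched_monad_def enriched_endo_def by blast
  have sym: "sym_trm n s \<in> trms ?S" if "s \<in> ?S n" for n s
    unfolding sym_trm_def by (rule trms.App) (use that in \<open>auto intro: trms.Var\<close>)
  have vars: "trm_vars (sym_trm n s) = {..<n}" for n and s :: 'u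
    by (auto simp: sym_trm_def)
  have 1: "Join (\<lambda>k. Trm (sym_trm n (s k))) \<in> extended_trms ?S"
    if "omega_chain (Tobj T (Vn x n)) s" for n s
  proof (rule extended_trms.Join)
    fix k
    have "(s k, s (Suc k)) \<in> Tobj T (Vn x n)" using that by (simp add: omega_chain_def)
    then have "s k \<in> ?S n" unfolding monad_sig_def by (rule FieldI1)
    then show "Trm (sym_trm n (s k)) \<in> extended_trms ?S" using sym by (blast intro: extended_trms.Trm)
  qed (simp add: vars)
  have 2: "kleisli_ext T (Vn x n) (Vn x m) k \<sigma> \<in> ?S m"
    if s: "\<sigma> \<in> ?S n" and k: "k \<in> x ` {..<n} \<rightarrow>\<^sub>E ?S m" for n m k \<sigma>
  proof -
    let ?X = "Vn x n" and ?Y = "Vn x m"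
    have po: "Partial_order (Tobj T ?Y)" using TV by (simp add: CPO_def is_cpo_def)
    have "k \<in> x ` {..<n} \<rightarrow> Field (Tobj T ?Y)" using k unfolding monad_sig_def by blast
    then have "omega_cont ?X (Tobj T ?Y) k"
      unfolding Vn_def using omega_cont_Id_on po[unfolded Vn_def] by blast
    then have kh: "k \<in> cpo_hom ?X (Tobj T ?Y)"
      using k FV by (auto simp: cpo_hom_def PiE_def)
    have lc: "omega_cont (hom_cpo ?X (Tobj T ?Y)) (hom_cpo (Tobj T ?X) (Tobj T (Tobj T ?Y)))
        (Tmor T ?X (Tobj T ?Y))"
      using T V TV unfolding enriched_monad_def enriched_endo_def by blast
    have "(k, k) \<in> hom_cpo ?X (Tobj T ?Y)"
    proof -
      have "(k a, k a) \<in> Tobj T ?Y" if "a \<in> Field ?X" for a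
      proof -
        have "k a \<in> Field (Tobj T ?Y)" using kh that by (auto simp: cpo_hom_def omega_cont_def)
        then show ?thesis using po by (auto simp: partial_order_on_def preorder_on_def refl_on_def)
      qed
      then show ?thesis using kh by (simp add: hom_cpo_def)
    qed
    then have "(Tmor T ?X (Tobj T ?Y) k, Tmor T ?X (Tobj T ?Y) k)
        \<in> hom_cpo (Tobj T ?X) (Tobj T (Tobj T ?Y))"
      using lc unfolding omega_cont_def by blast
    then have "Tmor T ?X (Tobj T ?Y) k \<in> cpo_hom (Tobj T ?X) (Tobj T (Tobj T ?Y))"
      by (simp add: hom_cpo_def)
    then have a: "Tmor T ?X (Tobj T ?Y) k \<sigma> \<in> Field (Tobj T (Tobj T ?Y))"
      using s by (auto simp: cpo_hom_def omega_cont_def monad_sig_def)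
    have "mult T ?Y \<in> cpo_hom (Tobj T (Tobj T ?Y)) (Tobj T ?Y)"
      using T V by (simp add: enriched_monad_def nat_trans_def comp_endo_def)
    then have "mult T ?Y (Tmor T ?X (Tobj T ?Y) k \<sigma>) \<in> Field (Tobj T ?Y)"
      using a by (auto simp: cpo_hom_def omega_cont_def)
    then show ?thesis using s by (simp add: kleisli_ext_def compose_def monad_sig_def)
  qed
  have 3: "App \<sigma> (map (\<lambda>i. sym_trm m (k (x i))) [0..<n]) \<in> trms ?S"
    if "\<sigma> \<in> ?S n" "k \<in> x ` {..<n} \<rightarrow>\<^sub>E ?S m" for n m k \<sigma>
    by (rule trms.App) (use that in \<open>auto intro!: sym\<close>)
  have 4: "unit T (Vn x n) (x i) \<in> ?S n" if "i < n" for n i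
  proof -
    have "unit T (Vn x n) \<in> cpo_hom (Vn x n) (Tobj T (Vn x n))"
      using T V by (simp add: enriched_monad_def nat_trans_def id_endo_def)
    then show ?thesis using that FV by (auto simp: cpo_hom_def omega_cont_def monad_sig_def)
  qed
  have A: "{(Trm (sym_trm n \<sigma>), Join (\<lambda>k. Trm (sym_trm n (s k)))) | n \<sigma> s.
        omega_chain (Tobj T (Vn x n)) s \<and> is_join (Tobj T (Vn x n)) s \<sigma>}
      \<subseteq> extended_trms ?S \<times> extended_trms ?S"
  proof (intro subsetI, elim CollectE exE conjE)
    fix p n \<sigma> s
    assume p: "p = (Trm (sym_trm n \<sigma>), Join (\<lambda>k. Trm (sym_trm n (s k))))"
      and c: "omega_chain (Tobj T (Vn x n)) s" and j: "is_join (Tobj T (Vn x n)) s \<sigma>"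
    have "\<sigma> \<in> ?S n" using j by (simp add: is_join_def monad_sig_def)
    then show "p \<in> extended_trms ?S \<times> extended_trms ?S"
      unfolding p by (intro SigmaI extended_trms.Trm sym 1[OF c])
  qed
  have B: "{(Trm (sym_trm m (kleisli_ext T (Vn x n) (Vn x m) k \<sigma>)),
        Trm (App \<sigma> (map (\<lambda>i. sym_trm m (k (x i))) [0..<n]))) | n m k \<sigma>.
        \<sigma> \<in> ?S n \<and> k \<in> x ` {..<n} \<rightarrow>\<^sub>E ?S m}
      \<subseteq> extended_trms ?S \<times> extended_trms ?S"
  proof (intro subsetI, elim CollectE exE conjE)
    fix p n m k \<sigma>
    assume p: "p = (Trm (sym_trm m (kleisli_ext T (Vn x n) (Vn x m) k \<sigma>)),
        Trm (App \<sigma> (map (\<lambda>i. sym_trm m (k (x i))) [0..<n])))"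
      and s: "\<sigma> \<in> ?S n" and k: "k \<in> x ` {..<n} \<rightarrow>\<^sub>E ?S m"
    show "p \<in> extended_trms ?S \<times> extended_trms ?S"
      unfolding p by (intro SigmaI extended_trms.Trm sym 2[OF s k] 3[OF s k])
  qed
  have C: "{(Trm (sym_trm n (unit T (Vn x n) (x i))), Trm (Var i)) | n i. i < n}
      \<subseteq> extended_trms ?S \<times> extended_trms ?S"
  proof (intro subsetI, elim CollectE exE conjE)
    fix p :: "'u xtrm \<times> 'u xtrm" and n i
    assume p: "p = (Trm (sym_trm n (unit T (Vn x n) (x i))), Trm (Var i))" and i: "i < n"
    show "p \<in> extended_trms ?S \<times> extended_trms ?S"
      unfolding p by (intro SigmaI extended_trms.Trm sym 4[OF i] trms.Var)
  qed
  show ?thesis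
    unfolding monad_eqs_def by (intro Un_least A B C)
qed

end

theory Submission
  imports Defs
begin

text \<open>
  The idea is to show that \<open>TX\<close>, with the operations \<open>\<sigma>(t\<^sub>0, \<dots>, t\<^bsub>n-1\<^esub>) = k\<^sup>*(\<sigma>)\<close> for
  \<open>k(x\<^sub>i) = t\<^sub>i\<close>, is itself a free algebra of \<open>\<V>\<^sub>T\<close> on \<open>X\<close>. Given an algebra \<open>B\<close> with underlying
  cpo \<open>C\<close>, an element of \<open>TV\<^sub>n\<close> together with a map \<open>V\<^sub>n \<rightarrow> X\<close> gives a continuous functional
  \<open>[X, C] \<rightarrow> C\<close>. The least collection \<open>E X\<close> of functionals that contains these and is closed under
  joins of chains is a locally continuous functor of \<open>X\<close> with values of admissible size, and on
  finite discrete cpos there is a natural map from \<open>T\<close> to it. Strong finitarity extends it to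
  \<open>TX \<rightarrow> E X\<close>; evaluation at \<open>f : X \<rightarrow> C\<close> is the required extension \<open>TX \<rightarrow> C\<close> of \<open>f\<close>. That it is
  a homomorphism, and unique, follows because, by strong finitarity again, \<open>TX\<close> has no proper subset
  that is closed under joins of chains and contains the images of all \<open>TV\<^sub>n\<close>.
\<close>

section \<open>Suprema of chains\<close>

text \<open>The obstacle is size. A map \<open>TX \<rightarrow> C\<close> for one fixed
  \<open>f\<close> is not natural in \<open>X\<close>, and strong finitarity yields only natural
  transformations; letting \<open>f\<close> vary leads to the double dual, covariant in
  \<open>X\<close> by precomposition. But the full double dual need not lie in \<open>\<U>\<close>,
  and \<open>strongly_finitary\<close> tests only against endofunctors of \<open>CPO \<U>\<close>.
  The part generated by terms is small: each join uses countably many earlier elements, so an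
  element is named by a countable labelled tree, and \<open>universe\<close> bounds countable
  powers. It still consists of functionals, not of elements of \<open>'u\<close>; hence functors are
  treated with values in any type and then carried into \<open>'u\<close>. Each family of equations
  has its task. (1) makes a term functional continuous in its symbol. (2) and (3) together make it
  independent of how an element of \<open>T\<close> on a finite discrete cpo is presented. (2) makes
  the extension a homomorphism, and (3) makes it extend \<open>f\<close>. No free algebra is assumed
  to exist: \<open>TX\<close> is shown to be one, and every other adjunction is compared with
  it.\<close>

definition chain_sup :: "'a rel \<Rightarrow> (nat \<Rightarrow> 'a) \<Rightarrow> 'a \<Rightarrow> bool" where
  "chain_sup X c s \<longleftrightarrow> omega_chain X c \<and> is_join X c s"

lemma is_cpo_Partial_order: "is_cpo X \<Longrightarrow> Partial_order X"
  by (simp add: is_cpo_def)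

lemma Partial_order_refl: "Partial_order X \<Longrightarrow> a \<in> Field X \<Longrightarrow> (a, a) \<in> X"
  by (auto simp: partial_order_on_def preorder_on_def refl_on_def)

lemma Partial_order_trans: "Partial_order X \<Longrightarrow> (a, b) \<in> X \<Longrightarrow> (b, c) \<in> X \<Longrightarrow> (a, c) \<in> X"
  by (auto simp: partial_order_on_def preorder_on_def dest: transD)

lemma Partial_order_antisym: "Partial_order X \<Longrightarrow> (a, b) \<in> X \<Longrightarrow> (b, a) \<in> X \<Longrightarrow> a = b"
  by (auto simp: partial_order_on_def dest: antisymD)

lemma Partial_orderI:
  assumes "\<And>a b. (a, b) \<in> X \<Longrightarrow> (a, a) \<in> X \<and> (b, b) \<in> X"
    and "\<And>a b c. (a, b) \<in> X \<Longrightarrow> (b, c) \<in> X \<Longrightarrow> (a, c) \<in> X"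
    and "\<And>a b. (a, b) \<in> X \<Longrightarrow> (b, a) \<in> X \<Longrightarrow> a = b"
  shows "Partial_order X"
  unfolding partial_order_on_def preorder_on_def
proof (intro conjI)
  show "refl_on (Field X) X"
    by (rule refl_onI) (use assms(1) in \<open>auto simp: Field_def\<close>)
  show "trans X" by (rule transI) (use assms(2) in blast)
  show "antisym X" by (rule antisymI) (use assms(3) in blast)
qed (auto simp: Field_def)

lemma is_join_unique:
  assumes "Partial_order X" "is_join X c s" "is_join X c t"
  shows "s = t"
  using assms(2,3) Partial_order_antisym[OF assms(1)] unfolding is_join_def by blast

lemma join_eqI: "Partial_order X \<Longrightarrow> is_join X c s \<Longrightarrow> join X c = s"
  unfolding join_def using is_join_unique by (metis the_equality)

lemma chain_sup_unique: "Partial_order X \<Longrightarrow> chain_sup X c s \<Longrightarrow> chain_sup X c t \<Longrightarrow> s = t"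
  unfolding chain_sup_def using is_join_unique by metis

lemma chain_sup_join: "is_cpo X \<Longrightarrow> omega_chain X c \<Longrightarrow> chain_sup X c (join X c)"
  unfolding chain_sup_def is_cpo_def using join_eqI by metis

lemma chain_sup_Field:
  assumes "chain_sup X c s"
  shows "c k \<in> Field X" "s \<in> Field X"
  using assms unfolding chain_sup_def omega_chain_def is_join_def by (auto intro: FieldI1)

lemma chain_sup_upper: "chain_sup X c s \<Longrightarrow> (c k, s) \<in> X"
  unfolding chain_sup_def is_join_def by blast

lemma chain_sup_step: "chain_sup X c s \<Longrightarrow> (c k, c (Suc k)) \<in> X"
  unfolding chain_sup_def omega_chain_def by blast

lemma chain_sup_least: "chain_sup X c s \<Longrightarrow> (\<And>k. (c k, u) \<in> X) \<Longrightarrow> (s, u) \<in> X"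
  unfolding chain_sup_def is_join_def by blast

lemma chain_supI:
  assumes "\<And>k. (c k, c (Suc k)) \<in> X" "\<And>k. (c k, s) \<in> X"
    and "\<And>u. (\<And>k. (c k, u) \<in> X) \<Longrightarrow> (s, u) \<in> X"
  shows "chain_sup X c s"
  unfolding chain_sup_def omega_chain_def is_join_def using assms by (auto intro: FieldI2)

lemma chain_sup_const: "Partial_order X \<Longrightarrow> a \<in> Field X \<Longrightarrow> chain_sup X (\<lambda>_. a) a"
  by (rule chain_supI) (auto simp: Partial_order_refl)

text \<open>The chain a, b, b, ... presents an inequality as a join. Preservation of
  \<open>chain_sup\<close> therefore includes monotonicity, and \<open>omega_contI\<close> has no
  separate condition for it.\<close>

lemma chain_sup_le:
  assumes "Partial_order X" "(a, b) \<in> X"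
  shows "chain_sup X (\<lambda>k. if k = 0 then a else b) b"
proof -
  have "(b, b) \<in> X" using assms by (meson FieldI2 Partial_order_refl)
  then show ?thesis
    using assms(2) by (intro chain_supI) (auto split: if_splits dest: spec[of _ 1], metis
        One_nat_def zero_neq_one)
qed

lemma chain_sup_mono:
  assumes "Partial_order X" "chain_sup X c s" "chain_sup X d t" "\<And>k. (c k, d k) \<in> X"
  shows "(s, t) \<in> X"
  using chain_sup_least[OF assms(2)] chain_sup_upper[OF assms(3)] assms(4)
    Partial_order_trans[OF assms(1)] by blast

lemma chain_sup_omega_chain: "chain_sup X c s \<Longrightarrow> omega_chain X c"
  by (simp add: chain_sup_def)

section \<open>Continuous maps\<close>

lemma omega_contI:
  assumes X: "Partial_order X" and f: "\<And>c s. chain_sup X c s \<Longrightarrow> chain_sup Y (\<lambda>k. f (c k)) (f s)"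
  shows "omega_cont X Y f"
proof -
  have mono: "(f a, f b) \<in> Y" if "(a, b) \<in> X" for a b
    using chain_sup_upper[OF f[OF chain_sup_le[OF X that]], of 0] by simp
  moreover have "f a \<in> Field Y" if "a \<in> Field X" for a
    using mono[OF Partial_order_refl[OF X that]] by (rule FieldI1)
  ultimately show ?thesis
    using f unfolding omega_cont_def chain_sup_def by blast
qed

lemma omega_cont_chain_sup:
  "omega_cont X Y f \<Longrightarrow> chain_sup X c s \<Longrightarrow> chain_sup Y (\<lambda>k. f (c k)) (f s)"
  unfolding omega_cont_def chain_sup_def omega_chain_def by blast

lemma omega_cont_Field: "omega_cont X Y f \<Longrightarrow> a \<in> Field X \<Longrightarrow> f a \<in> Field Y"
  unfolding omega_cont_def by blast

lemma cpo_homI: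
  assumes "Partial_order X" "f \<in> extensional (Field X)"
    and "\<And>c s. chain_sup X c s \<Longrightarrow> chain_sup Y (\<lambda>k. f (c k)) (f s)"
  shows "f \<in> cpo_hom X Y"
  using omega_contI[OF assms(1,3)] assms(2) by (simp add: cpo_hom_def)

lemma cpo_hom_chain_sup: "f \<in> cpo_hom X Y \<Longrightarrow> chain_sup X c s \<Longrightarrow> chain_sup Y (\<lambda>k. f (c k)) (f s)"
  by (rule omega_cont_chain_sup[of X Y f]) (auto simp: cpo_hom_def)

lemma cpo_hom_Field: "f \<in> cpo_hom X Y \<Longrightarrow> a \<in> Field X \<Longrightarrow> f a \<in> Field Y"
  unfolding cpo_hom_def omega_cont_def by blast

lemma cpo_hom_ext: "f \<in> cpo_hom X Y \<Longrightarrow> f \<in> extensional (Field X)"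
  unfolding cpo_hom_def by blast

lemma cpo_hom_eqI:
  assumes "f \<in> cpo_hom X Y" "g \<in> cpo_hom X Z" "\<And>a. a \<in> Field X \<Longrightarrow> f a = g a"
  shows "f = g"
  using extensionalityI[of f "Field X" g] assms cpo_hom_ext by blast

lemma restrict_cpo_hom:
  assumes "Partial_order X" "\<And>c s. chain_sup X c s \<Longrightarrow> chain_sup Y (\<lambda>k. f (c k)) (f s)"
  shows "restrict f (Field X) \<in> cpo_hom X Y"
proof (rule cpo_homI[OF assms(1)])
  fix c s assume "chain_sup X c s"
  with assms(2)[OF this] chain_sup_Field[OF this]
  show "chain_sup Y (\<lambda>k. restrict f (Field X) (c k)) (restrict f (Field X) s)" by simp
qed simp

lemma compose_cpo_hom:
  assumes "f \<in> cpo_hom X Y" "g \<in> cpo_hom Y Z" "Partial_order X"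
  shows "compose (Field X) g f \<in> cpo_hom X Z"
  unfolding compose_def
  by (rule restrict_cpo_hom[OF assms(3)]) (use assms in \<open>intro cpo_hom_chain_sup[OF assms(2)]
      cpo_hom_chain_sup[OF assms(1)]\<close>)

lemma cpo_id_hom: "Partial_order X \<Longrightarrow> cpo_id X \<in> cpo_hom X X"
  by (rule restrict_cpo_hom) auto

lemma cpo_hom_Id_on:
  assumes "Partial_order Y" "f \<in> A \<rightarrow>\<^sub>E Field Y"
  shows "f \<in> cpo_hom (Id_on A) Y"
  unfolding cpo_hom_def using assms omega_cont_Id_on[of Y f A] by (auto simp: Field_Id_on PiE_def)

lemma Partial_order_Id_on: "Partial_order (Id_on A)"
  by (rule Partial_orderI) auto

lemma cpo_hom_Id_on_Id_on: "f \<in> A \<rightarrow>\<^sub>E B \<Longrightarrow> f \<in> cpo_hom (Id_on A) (Id_on B)"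
  by (rule cpo_hom_Id_on[OF Partial_order_Id_on]) (simp add: Field_Id_on)

lemma hom_cpo_iff:
  "(f, g) \<in> hom_cpo X Y \<longleftrightarrow> f \<in> cpo_hom X Y \<and> g \<in> cpo_hom X Y \<and> (\<forall>a\<in>Field X. (f a, g a) \<in> Y)"
  by (simp add: hom_cpo_def)

lemma hom_cpo_refl: "Partial_order Y \<Longrightarrow> f \<in> cpo_hom X Y \<Longrightarrow> (f, f) \<in> hom_cpo X Y"
  by (auto simp: hom_cpo_iff intro: Partial_order_refl cpo_hom_Field)

lemma Field_hom_cpo: "Partial_order Y \<Longrightarrow> Field (hom_cpo X Y) = cpo_hom X Y"
  using hom_cpo_refl by (fastforce simp: Field_def hom_cpo_iff)

lemma Partial_order_hom_cpo:
  assumes "Partial_order Y"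
  shows "Partial_order (hom_cpo X Y)"
proof (rule Partial_orderI)
  fix f g h
  show "(f, f) \<in> hom_cpo X Y \<and> (g, g) \<in> hom_cpo X Y" if "(f, g) \<in> hom_cpo X Y"
    using that hom_cpo_refl[OF assms] by (auto simp: hom_cpo_iff)
  show "(f, h) \<in> hom_cpo X Y" if "(f, g) \<in> hom_cpo X Y" "(g, h) \<in> hom_cpo X Y"
    using that Partial_order_trans[OF assms] by (fastforce simp: hom_cpo_iff)
  show "f = g" if "(f, g) \<in> hom_cpo X Y" "(g, f) \<in> hom_cpo X Y"
    using that Partial_order_antisym[OF assms]
    by (intro cpo_hom_eqI[of f X Y g Y]) (auto simp: hom_cpo_iff)
qed

lemma chain_sup_hom_cpoI:
  assumes "\<And>k. c k \<in> cpo_hom X Y" "s \<in> cpo_hom X Y"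
    and "\<And>a. a \<in> Field X \<Longrightarrow> chain_sup Y (\<lambda>k. c k a) (s a)"
  shows "chain_sup (hom_cpo X Y) c s"
proof (rule chain_supI)
  show "(c k, c (Suc k)) \<in> hom_cpo X Y" for k
    using assms chain_sup_step by (fastforce simp: hom_cpo_iff)
  show "(c k, s) \<in> hom_cpo X Y" for k
    using assms chain_sup_upper by (fastforce simp: hom_cpo_iff)
  show "(s, u) \<in> hom_cpo X Y" if "\<And>k. (c k, u) \<in> hom_cpo X Y" for u
    using assms that chain_sup_least by (fastforce simp: hom_cpo_iff)
qed

lemma omega_chain_hom_cpo_sup:
  assumes X: "Partial_order X" and Y: "is_cpo Y" and c: "omega_chain (hom_cpo X Y) c"
  defines "s \<equiv> \<lambda>a\<in>Field X. join Y (\<lambda>k. c k a)"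
  shows "chain_sup (hom_cpo X Y) c s" "a \<in> Field X \<Longrightarrow> chain_sup Y (\<lambda>k. c k a) (s a)"
proof -
  have PY: "Partial_order Y" using Y by (rule is_cpo_Partial_order)
  have ck: "c k \<in> cpo_hom X Y" for k
    using c by (auto simp: omega_chain_def hom_cpo_iff)
  have pt: "chain_sup Y (\<lambda>k. c k a) (join Y (\<lambda>k. c k a))" if "a \<in> Field X" for a
    by (rule chain_sup_join[OF Y]) (use c that in \<open>auto simp: omega_chain_def hom_cpo_iff\<close>)
  then show *: "chain_sup Y (\<lambda>k. c k a) (s a)" if "a \<in> Field X" for a
    using that by (simp add: s_def)
  have "s \<in> cpo_hom X Y" unfolding s_def
  proof (rule restrict_cpo_hom[OF X], rule chain_supI)
    fix d t assume d: "chain_sup X d t"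
    note dF = chain_sup_Field[OF d]
    note ckd = cpo_hom_chain_sup[OF ck d]
    show "(join Y (\<lambda>k. c k (d j)), join Y (\<lambda>k. c k (d (Suc j)))) \<in> Y" for j
      by (rule chain_sup_mono[OF PY pt pt]) (use dF chain_sup_step[OF ckd] in auto)
    show "(join Y (\<lambda>k. c k (d j)), join Y (\<lambda>k. c k t)) \<in> Y" for j
      by (rule chain_sup_mono[OF PY pt pt]) (use dF chain_sup_upper[OF ckd] in auto)
    \<comment> \<open>Interchange of joins: \<open>u\<close> bounds the whole array
      \<open>c k (d j)\<close>, so the join over \<open>j\<close>, by continuity of
      \<open>c k\<close>, and then the join over \<open>k\<close> stay below
      \<open>u\<close>.\<close>
    fix u assume u: "\<And>j. (join Y (\<lambda>k. c k (d j)), u) \<in> Y"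
    have "(c k (d j), u) \<in> Y" for k j
      using chain_sup_upper[OF pt[OF dF(1)]] u Partial_order_trans[OF PY] by blast
    then have "(c k t, u) \<in> Y" for k by (rule chain_sup_least[OF ckd])
    then show "(join Y (\<lambda>k. c k t), u) \<in> Y" by (rule chain_sup_least[OF pt[OF dF(2)]])
  qed
  then show "chain_sup (hom_cpo X Y) c s"
    by (intro chain_sup_hom_cpoI ck *)
qed

text \<open>Completeness of \<open>Y\<close> provides a pointwise supremum, and suprema are unique.
  \<open>chain_sup_cpo_powerD\<close> and \<open>chain_sup_RestrD\<close> follow the same
  pattern.\<close>

lemma chain_sup_hom_cpoD:
  assumes "Partial_order X" "is_cpo Y" "chain_sup (hom_cpo X Y) c s"
  shows "c k \<in> cpo_hom X Y" "s \<in> cpo_hom X Y" "a \<in> Field X \<Longrightarrow> chain_sup Y (\<lambda>k. c k a) (s a)"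
proof -
  note PY = is_cpo_Partial_order[OF assms(2)]
  show "c k \<in> cpo_hom X Y" "s \<in> cpo_hom X Y"
    using chain_sup_Field[OF assms(3)] by (auto simp: Field_hom_cpo[OF PY])
  note * = omega_chain_hom_cpo_sup[OF assms(1,2) chain_sup_omega_chain[OF assms(3)]]
  have "(\<lambda>a\<in>Field X. join Y (\<lambda>k. c k a)) = s"
    by (rule chain_sup_unique[OF Partial_order_hom_cpo[OF PY] *(1) assms(3)])
  with *(2) show "a \<in> Field X \<Longrightarrow> chain_sup Y (\<lambda>k. c k a) (s a)" by simp
qed

lemma is_cpo_hom_cpo: "Partial_order X \<Longrightarrow> is_cpo Y \<Longrightarrow> is_cpo (hom_cpo X Y)"
  unfolding is_cpo_def[of "hom_cpo X Y"]
  using omega_chain_hom_cpo_sup(1) Partial_order_hom_cpo is_cpo_Partial_order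
  unfolding chain_sup_def by metis

section \<open>Powers, subposets and transport of structure\<close>

lemma Field_cpo_power: 
  assumes "Partial_order X"
  shows "Field (cpo_power X n) = {as. length as = n \<and> set as \<subseteq> Field X}" (is "?L = ?R")
proof
  show "?L \<subseteq> ?R"
    by (auto simp: Field_def cpo_power_def in_set_conv_nth) blast+
  show "?R \<subseteq> ?L"
  proof
    fix as assume "as \<in> ?R"
    then have "(as, as) \<in> cpo_power X n"
      using Partial_order_refl[OF assms] nth_mem[of _ as] unfolding cpo_power_def by blast
    then show "as \<in> ?L" by (rule FieldI1)
  qed
qed

lemma Partial_order_cpo_power:
  assumes "Partial_order X"
  shows "Partial_order (cpo_power X n)"
proof (rule Partial_orderI)
  fix f g h
  show "(f, f) \<in> cpo_power X n \<and> (g, g) \<in> cpo_power X n" if "(f, g) \<in> cpo_power X n"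
    using that Partial_order_refl[OF assms] by (auto simp: cpo_power_def FieldI1 FieldI2)
  show "(f, h) \<in> cpo_power X n" if "(f, g) \<in> cpo_power X n" "(g, h) \<in> cpo_power X n"
    using that Partial_order_trans[OF assms] unfolding cpo_power_def by blast
  show "f = g" if "(f, g) \<in> cpo_power X n" "(g, f) \<in> cpo_power X n"
    using that Partial_order_antisym[OF assms]
    by (auto simp: cpo_power_def intro: nth_equalityI)
qed

lemma chain_sup_cpo_powerI:
  assumes "\<And>k. length (c k) = n" "length s = n"
    and "\<And>i. i < n \<Longrightarrow> chain_sup X (\<lambda>k. c k ! i) (s ! i)"
  shows "chain_sup (cpo_power X n) c s"
proof (rule chain_supI)
  show "(c k, c (Suc k)) \<in> cpo_power X n" "(c k, s) \<in> cpo_power X n" for k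
    using assms chain_sup_step[OF assms(3)] chain_sup_upper[OF assms(3)] by (auto simp:
        cpo_power_def)
  show "(s, u) \<in> cpo_power X n" if "\<And>k. (c k, u) \<in> cpo_power X n" for u
    using assms that chain_sup_least[OF assms(3)] by (simp add: cpo_power_def)
qed

lemma chain_sup_cpo_powerD:
  assumes X: "is_cpo X" and s: "chain_sup (cpo_power X n) c s"
  shows "length (c k) = n" "length s = n" "i < n \<Longrightarrow> chain_sup X (\<lambda>k. c k ! i) (s ! i)"
proof -
  note PX = is_cpo_Partial_order[OF X]
  show l: "length (c k) = n" "length s = n" for k
    using chain_sup_Field[OF s] by (auto simp: Field_cpo_power[OF PX])
  have pt: "chain_sup X (\<lambda>k. c k ! i) (join X (\<lambda>k. c k ! i))" if "i < n" for i
    by (rule chain_sup_join[OF X])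
      (use chain_sup_step[OF s] that in \<open>auto simp: omega_chain_def cpo_power_def\<close>)
  have "chain_sup (cpo_power X n) c (map (\<lambda>i. join X (\<lambda>k. c k ! i)) [0..<n])"
    by (rule chain_sup_cpo_powerI) (use l pt in auto)
  then have "s = map (\<lambda>i. join X (\<lambda>k. c k ! i)) [0..<n]"
    using chain_sup_unique[OF Partial_order_cpo_power[OF PX] s] by blast
  then show "i < n \<Longrightarrow> chain_sup X (\<lambda>k. c k ! i) (s ! i)" using pt by simp
qed

definition join_closed :: "'a rel \<Rightarrow> 'a set \<Rightarrow> bool" where
  "join_closed X S \<longleftrightarrow> (\<forall>c s. chain_sup X c s \<and> range c \<subseteq> S \<longrightarrow> s \<in> S)"

lemma Field_Restr: 
  assumes "Partial_order X" "S \<subseteq> Field X"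
  shows "Field (Restr X S) = S"
  using Partial_order_refl[OF assms(1)] assms(2) by (fastforce simp: Field_def)

lemma Partial_order_subposet: "Partial_order X \<Longrightarrow> Partial_order (Restr X S)"
  by (rule Partial_orderI)
    (auto intro: Partial_order_refl FieldI1 FieldI2 Partial_order_trans Partial_order_antisym)

lemma chain_sup_RestrI:
  assumes "chain_sup X c s" "range c \<subseteq> S" "s \<in> S"
  shows "chain_sup (Restr X S) c s"
  by (rule chain_supI)
    (use assms chain_sup_step[OF assms(1)] chain_sup_upper[OF assms(1)] chain_sup_least[OF assms(1)]
      in auto)

lemma chain_sup_RestrD:
  assumes X: "is_cpo X" and S: "S \<subseteq> Field X" "join_closed X S" and s: "chain_sup (Restr X S) c s"
  shows "chain_sup X c s" "range c \<subseteq> S" "s \<in> S"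
proof -
  note PX = is_cpo_Partial_order[OF X]
  show c: "range c \<subseteq> S" and "s \<in> S" 
    using chain_sup_Field[OF s] by (auto simp: Field_Restr[OF PX S(1)])
  have j: "chain_sup X c (join X c)"
    by (rule chain_sup_join[OF X]) (use chain_sup_step[OF s] in \<open>auto simp: omega_chain_def\<close>)
  then have "chain_sup (Restr X S) c (join X c)"
    by (intro chain_sup_RestrI) (use j c S(2) in \<open>auto simp: join_closed_def\<close>)
  then have "join X c = s" by (rule chain_sup_unique[OF Partial_order_subposet[OF PX] _ s])
  with j show "chain_sup X c s" by simp
qed

lemma is_cpo_Restr:
  assumes X: "is_cpo X" and S: "S \<subseteq> Field X" "join_closed X S"
  shows "is_cpo (Restr X S)"
  unfolding is_cpo_def
proof (intro conjI allI impI)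
  show "Partial_order (Restr X S)" by (rule Partial_order_subposet[OF is_cpo_Partial_order[OF X]])
  fix c assume c: "omega_chain (Restr X S) c"
  then have j: "chain_sup X c (join X c)" "range c \<subseteq> S"
    by (auto intro!: chain_sup_join[OF X] simp: omega_chain_def)
  then have "chain_sup (Restr X S) c (join X c)"
    by (intro chain_sup_RestrI) (use S(2) in \<open>auto simp: join_closed_def\<close>)
  then show "\<exists>s. is_join (Restr X S) c s" unfolding chain_sup_def by blast
qed

text \<open>Along a map that is injective on \<open>Field X\<close> this is an isomorphic copy. It
  serves to move posets over other types, such as posets of functionals, into
  \<open>'u\<close>.\<close>

definition transport :: "('a \<Rightarrow> 'b) \<Rightarrow> 'a rel \<Rightarrow> 'b rel" where
  "transport e X = map_prod e e ` X"

lemma Field_transport: "Field (transport e X) = e ` Field X"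
  unfolding transport_def Field_def by (force simp: image_iff)

lemma transport_iff:
  assumes "inj_on e (Field X)" "a \<in> Field X" "b \<in> Field X"
  shows "(e a, e b) \<in> transport e X \<longleftrightarrow> (a, b) \<in> X"
proof
  assume "(e a, e b) \<in> transport e X"
  then obtain p q where pq: "(p, q) \<in> X" "e a = e p" "e b = e q" unfolding transport_def by auto
  then have "a = p" "b = q" using assms by (auto simp: inj_on_eq_iff FieldI1 FieldI2)
  then show "(a, b) \<in> X" using pq by simp
qed (force simp: transport_def)

lemma transport_chain_sup:
  assumes e: "inj_on e (Field X)" and s: "chain_sup X c s"
  shows "chain_sup (transport e X) (\<lambda>k. e (c k)) (e s)"
proof (rule chain_supI)
  note F = chain_sup_Field[OF s]
  show "(e (c k), e (c (Suc k))) \<in> transport e X" "(e (c k), e s) \<in> transport e X" for k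
    using chain_sup_step[OF s] chain_sup_upper[OF s] F by (simp_all add: transport_iff[OF e])
  show "(e s, u) \<in> transport e X" if u: "\<And>k. (e (c k), u) \<in> transport e X" for u
  proof -
    have "u \<in> e ` Field X" using FieldI2[OF u] by (simp add: Field_transport)
    then obtain v where v: "v \<in> Field X" "u = e v" by blast
    have "(s, v) \<in> X"
      by (rule chain_sup_least[OF s]) (use u F v in \<open>simp add: transport_iff[OF e]\<close>)
    then show ?thesis using F v by (simp add: transport_iff[OF e])
  qed
qed

lemma transport_chain_supD:
  assumes e: "inj_on e (Field X)" and s: "chain_sup (transport e X) c s"
  shows "chain_sup X (\<lambda>k. inv_into (Field X) e (c k)) (inv_into (Field X) e s)"
proof -
  let ?d = "inv_into (Field X) e"
  have F: "c k \<in> e ` Field X" "s \<in> e ` Field X" for k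
    using chain_sup_Field[OF s] by (simp_all add: Field_transport)
  have d: "?d u \<in> Field X" "e (?d u) = u" if "u \<in> e ` Field X" for u
    using that by (simp_all add: inv_into_into f_inv_into_f)
  have iff: "(?d u, ?d v) \<in> X \<longleftrightarrow> (u, v) \<in> transport e X" if "u \<in> e ` Field X" "v \<in> e ` Field X"
      for u v
    using transport_iff[OF e, of "?d u" "?d v"] d that by simp
  show ?thesis
  proof (rule chain_supI)
    show "(?d (c k), ?d (c (Suc k))) \<in> X" "(?d (c k), ?d s) \<in> X" for k
      using chain_sup_step[OF s] chain_sup_upper[OF s] F by (simp_all add: iff)
    show "(?d s, u) \<in> X" if u: "\<And>k. (?d (c k), u) \<in> X" for u
    proof -
      have uF: "u \<in> Field X" by (rule FieldI2[OF u])
      then have "?d (e u) = u" using e by (simp add: inv_into_f_f)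
      then have "(c k, e u) \<in> transport e X" for k
        using u iff[of "c k" "e u"] F uF by auto
      then have "(s, e u) \<in> transport e X" by (rule chain_sup_least[OF s])
      then show ?thesis using \<open>?d (e u) = u\<close> iff[of s "e u"] F uF by auto
    qed
  qed
qed

lemma is_cpo_transport:
  assumes e: "inj_on e (Field X)" and X: "is_cpo X"
  shows "is_cpo (transport e X)"
  unfolding is_cpo_def
proof (intro conjI allI impI)
  note PX = is_cpo_Partial_order[OF X]
  have el: "\<exists>a b. u = e a \<and> v = e b \<and> a \<in> Field X \<and> b \<in> Field X \<and> (a, b) \<in> X"
    if "(u, v) \<in> transport e X" for u v
    using that unfolding transport_def by (auto intro: FieldI1 FieldI2)
  show "Partial_order (transport e X)"
  proof (rule Partial_orderI)
    fix u v w
    show "(u, u) \<in> transport e X \<and> (v, v) \<in> transport e X" if "(u, v) \<in> transport e X"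
      using el[OF that] Partial_order_refl[OF PX] by (auto simp: transport_iff[OF e])
    show "(u, w) \<in> transport e X" if "(u, v) \<in> transport e X" "(v, w) \<in> transport e X"
      using el[OF that(1)] el[OF that(2)] Partial_order_trans[OF PX] that
      by (metis transport_iff[OF e])
    show "u = v" if "(u, v) \<in> transport e X" "(v, u) \<in> transport e X"
      using el[OF that(1)] that Partial_order_antisym[OF PX]
      by (metis transport_iff[OF e])
  qed
  fix c assume c: "omega_chain (transport e X) c"
  have F: "c k \<in> e ` Field X" for k
    using c FieldI1 unfolding omega_chain_def Field_transport[symmetric] by fast
  let ?d = "inv_into (Field X) e"
  have d: "?d (c k) \<in> Field X" "e (?d (c k)) = c k" for k
    using F[of k] by (simp_all add: inv_into_into f_inv_into_f)
  have "omega_chain X (\<lambda>k. ?d (c k))"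
    unfolding omega_chain_def
    using c d transport_iff[OF e, of "?d (c _)" "?d (c (Suc _))"] unfolding omega_chain_def by metis
  from transport_chain_sup[OF e chain_sup_join[OF X this]]
  show "\<exists>s. is_join (transport e X) c s" by (auto simp: d chain_sup_def)
qed

section \<open>Small sets\<close>

text \<open>Membership in \<open>\<U>\<close> makes sense only for sets over \<open>'u\<close>; this
  is the substitute for lists, labelled trees and functionals.\<close>

definition small :: "'u set set \<Rightarrow> 'a set \<Rightarrow> bool" where
  "small \<U> S \<longleftrightarrow> (\<exists>B\<in>\<U>. S \<lesssim> B)"

lemma small_in_universe: "B \<in> \<U> \<Longrightarrow> small \<U> B"
  unfolding small_def using lepoll_refl by blast

lemma small_lepoll: "small \<U> B \<Longrightarrow> A \<lesssim> B \<Longrightarrow> small \<U> A"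
  unfolding small_def using lepoll_trans by blast

lemma small_subset: "small \<U> B \<Longrightarrow> A \<subseteq> B \<Longrightarrow> small \<U> A"
  using small_lepoll subset_imp_lepoll by blast

lemma small_image: "small \<U> A \<Longrightarrow> small \<U> (f ` A)"
  using small_lepoll image_lepoll by blast

lemma small_finite:
  assumes "universe \<U>" "finite A"
  shows "small \<U> A"
  using assms finite_lepoll_infinite unfolding universe_def small_def by blast

lemma small_sequences:
  assumes U: "universe \<U>" and S: "small \<U> S"
  shows "small \<U> {f :: nat \<Rightarrow> 'a. range f \<subseteq> S}"
proof -
  obtain B where B: "B \<in> \<U>" "S \<lesssim> B" using S unfolding small_def by blast
  then obtain e where e: "inj_on e S" "e ` S \<subseteq> B" unfolding lepoll_def by blast
  have "inj_on (\<lambda>f. e \<circ> f) {f :: nat \<Rightarrow> 'a. range f \<subseteq> S}"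
  proof (rule inj_onI)
    fix f g :: "nat \<Rightarrow> 'a"
    assume "f \<in> {f. range f \<subseteq> S}" "g \<in> {f. range f \<subseteq> S}" "e \<circ> f = e \<circ> g"
    then show "f = g" using e(1) by (auto simp: fun_eq_iff inj_on_eq_iff image_subset_iff)
  qed
  moreover have "(\<lambda>f. e \<circ> f) ` {f :: nat \<Rightarrow> 'a. range f \<subseteq> S} \<subseteq> UNIV \<rightarrow>\<^sub>E B"
    using e(2) by (auto simp: image_subset_iff)
  ultimately have "{f :: nat \<Rightarrow> 'a. range f \<subseteq> S} \<lesssim> (UNIV :: nat set) \<rightarrow>\<^sub>E B"
    unfolding lepoll_def by blast
  moreover obtain C where "C \<in> \<U>" "((UNIV :: nat set) \<rightarrow>\<^sub>E B) \<lesssim> C"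
    using U B(1) unfolding universe_def by blast
  ultimately show ?thesis unfolding small_def using lepoll_trans by blast
qed

text \<open>The common route to smallness below: elements are coded injectively by sequences with
  entries in a small set, and \<open>\<U>\<close> bounds countable powers.\<close>

lemma small_if_inj_sequences:
  fixes d :: "'a \<Rightarrow> nat \<Rightarrow> 'b"
  assumes "universe \<U>" "small \<U> B" "inj_on d S" "\<And>a. a \<in> S \<Longrightarrow> range (d a) \<subseteq> B"
  shows "small \<U> S"
proof (rule small_lepoll[OF small_sequences[OF assms(1,2)]])
  have "d ` S \<subseteq> {f. range f \<subseteq> B}" using assms(4) by auto
  with assms(3) show "S \<lesssim> {f :: nat \<Rightarrow> 'b. range f \<subseteq> B}" unfolding lepoll_def by blast
qed

lemma small_common_bound:
  assumes U: "universe \<U>" and "small \<U> S" "small \<U> S'"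
  obtains B e e' p q where "B \<in> \<U>" "inj_on e S" "e ` S \<subseteq> B" "inj_on e' S'" "e' ` S' \<subseteq> B"
    "p \<in> B" "q \<in> B" "p \<noteq> q"
proof -
  obtain B1 e where B1: "B1 \<in> \<U>" "inj_on e S" "e ` S \<subseteq> B1"
    using assms(2) unfolding small_def lepoll_def by blast
  obtain B2 e' where B2: "B2 \<in> \<U>" "inj_on e' S'" "e' ` S' \<subseteq> B2"
    using assms(3) unfolding small_def lepoll_def by blast
  obtain N where N: "N \<in> \<U>" "infinite N" using U unfolding universe_def by blast
  \<comment> \<open>\<open>universe\<close> speaks of unions of sequences, so a finite union is
    written as one. The infinite \<open>N\<close> fills the tail and supplies two distinct points
    that can serve as tags.\<close>
  define A where "A = (\<lambda>i :: nat. if i = 0 then B1 else if i = 1 then B2 else N)"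
  have "range A \<subseteq> \<U>" using B1 B2 N by (auto simp: A_def)
  then have "(\<Union>i. A i) \<in> \<U>" using U unfolding universe_def by blast
  moreover have "B1 \<subseteq> (\<Union>i. A i)" "B2 \<subseteq> (\<Union>i. A i)" "N \<subseteq> (\<Union>i. A i)"
    using UN_upper[of 0 UNIV A] UN_upper[of 1 UNIV A] UN_upper[of 2 UNIV A] by (simp_all add: A_def)
  moreover obtain p where "p \<in> N" using N(2) by fastforce
  moreover obtain q where "q \<in> N" "p \<noteq> q"
    using infinite_imp_nonempty[OF infinite_remove[OF N(2), of p]] by blast
  ultimately show ?thesis
    using that[of "\<Union>i. A i" e e' p q] B1(2,3) B2(2,3) by (meson subset_trans subsetD)
qed

lemma small_Un:
  assumes U: "universe \<U>" and "small \<U> S" "small \<U> S'"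
  shows "small \<U> (S \<union> S')"
proof -
  obtain B e e' p q where B: "B \<in> \<U>" "inj_on e S" "e ` S \<subseteq> B" "inj_on e' S'" "e' ` S' \<subseteq> B"
    "p \<in> B" "q \<in> B" "p \<noteq> q"
    by (rule small_common_bound[OF assms])
  \<comment> \<open>Entry 0 is a tag, \<open>p\<close> on \<open>S\<close> and \<open>q\<close> off
    it; it tells which of the two injections the remaining entries use.\<close>
  define d where "d a = (\<lambda>i :: nat. if a \<in> S then (if i = 0 then p else e a)
    else (if i = 0 then q else e' a))" for a
  show ?thesis
  proof (rule small_if_inj_sequences[OF U small_in_universe[OF B(1)], of d])
    show "inj_on d (S \<union> S')"
    proof (rule inj_onI)
      fix a b assume ab: "a \<in> S \<union> S'" "b \<in> S \<union> S'" and eq: "d a = d b"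
      have 0: "d a 0 = d b 0" and 1: "d a 1 = d b 1" using eq by simp_all
      have "a \<in> S \<longleftrightarrow> b \<in> S" using 0 B(8) by (auto simp: d_def split: if_splits)
      then show "a = b" using 1 ab B(2,4) by (auto simp: d_def inj_on_eq_iff split: if_splits)
    qed
    show "range (d a) \<subseteq> B" if "a \<in> S \<union> S'" for a
      using that B by (auto simp: d_def)
  qed
qed

lemma small_Times:
  assumes U: "universe \<U>" and "small \<U> S" "small \<U> S'"
  shows "small \<U> (S \<times> S')"
proof -
  obtain B e e' p q where B: "B \<in> \<U>" "inj_on e S" "e ` S \<subseteq> B" "inj_on e' S'" "e' ` S' \<subseteq> B"
    "p \<in> B" "q \<in> B" "p \<noteq> q"
    by (rule small_common_bound[OF assms])
  define d where "d a = (\<lambda>i :: nat. if i = 0 then e (fst a) else e' (snd a))" for a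
  show ?thesis
  proof (rule small_if_inj_sequences[OF U small_in_universe[OF B(1)], of d])
    show "inj_on d (S \<times> S')"
    proof (rule inj_onI)
      fix a b assume ab: "a \<in> S \<times> S'" "b \<in> S \<times> S'" and eq: "d a = d b"
      have "e (fst a) = e (fst b)" "e' (snd a) = e' (snd b)"
        using fun_cong[OF eq, of 0] fun_cong[OF eq, of 1] by (simp_all add: d_def)
      then show "a = b" using ab B(2,4) by (auto simp: inj_on_eq_iff)
    qed
    show "range (d a) \<subseteq> B" if "a \<in> S \<times> S'" for a
      using that B by (auto simp: d_def)
  qed
qed

lemma small_option:
  assumes "universe \<U>" "small \<U> S"
  shows "small \<U> (insert None (Some ` S))"
  using small_Un[OF assms(1) small_finite[OF assms(1), of "{None}"] small_image[OF assms(2)]] by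
      simp

lemma small_lists:
  assumes U: "universe \<U>" and S: "small \<U> S"
  shows "small \<U> (lists (S :: 'a set))"
proof -
  \<comment> \<open>Padding by \<open>None\<close> makes the length of the list recoverable from the
    sequence.\<close>
  define d where "d xs = (\<lambda>i. if i < length xs then Some (xs ! i) else None)" for xs :: "'a list"
  have "inj d"
  proof (rule injI)
    fix xs ys assume eq: "d xs = d ys"
    have "i < length xs \<longleftrightarrow> i < length ys" for i
      using fun_cong[OF eq, of i] by (auto simp: d_def split: if_splits)
    then have "length xs = length ys" by (meson linorder_neqE_nat nat_less_le)
    then show "xs = ys"
    proof (rule nth_equalityI)
      show "xs ! i = ys ! i" if "i < length xs" for i
        using fun_cong[OF eq, of i] that \<open>length xs = length ys\<close> by (simp add: d_def)
    qed
  qed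
  then have "inj_on d (lists S)" by (rule inj_on_subset) simp
  then show ?thesis
    by (rule small_if_inj_sequences[OF U small_option[OF U S]]) (auto simp: d_def)
qed

section \<open>Closure under joins of chains, and its size\<close>

inductive_set join_hull :: "'a rel \<Rightarrow> 'a set \<Rightarrow> 'a set" for X B where
  base: "b \<in> B \<Longrightarrow> b \<in> join_hull X B"
| sup: "chain_sup X c s \<Longrightarrow> (\<And>k. c k \<in> join_hull X B) \<Longrightarrow> s \<in> join_hull X B"

lemma join_closed_join_hull: "join_closed X (join_hull X B)"
  unfolding join_closed_def by (auto intro: join_hull.sup)

lemma join_hull_subset: "B \<subseteq> Field X \<Longrightarrow> join_hull X B \<subseteq> Field X"
proof
  fix a assume "B \<subseteq> Field X" "a \<in> join_hull X B"
  then show "a \<in> Field X"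
    by (induction rule: join_hull.induct[OF \<open>a \<in> join_hull X B\<close>]) (auto dest: chain_sup_Field)
qed

lemma cpo_hom_join_hull:
  assumes "f \<in> cpo_hom X Y" "f ` B \<subseteq> C"
  shows "f ` join_hull X B \<subseteq> join_hull Y C"
proof clarify
  fix a assume "a \<in> join_hull X B"
  then show "f a \<in> join_hull Y C"
  proof (induction rule: join_hull.induct)
    case (base b)
    then show ?case using assms(2) by (auto intro: join_hull.base)
  next
    case (sup c s)
    then show ?case by (intro join_hull.sup[OF cpo_hom_chain_sup[OF assms(1) sup(1)]])
  qed
qed

text \<open>
  Elements of the join hull are named by well-founded countably branching trees with leaves in the
  generating set; such a tree is recorded as the partial labelling of its addresses.
\<close>

inductive hull_code :: "'a rel \<Rightarrow> 'a set \<Rightarrow> (nat list \<Rightarrow> 'a option) \<Rightarrow> 'a \<Rightarrow> bool" for X B where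
  leaf: "b \<in> B \<Longrightarrow> hull_code X B (\<lambda>p. case p of [] \<Rightarrow> Some b | k # q \<Rightarrow> None) b"
| node: "chain_sup X c s \<Longrightarrow> (\<And>k. hull_code X B (u k) (c k)) \<Longrightarrow>
    hull_code X B (\<lambda>p. case p of [] \<Rightarrow> None | k # q \<Rightarrow> u k q) s"

text \<open>Suprema are unique, so the labelled tree leaves no choice. An element may have many
  codes; choosing one for each is then injective, which is all that counting needs.\<close>

lemma hull_code_unique:
  assumes X: "Partial_order X" and "hull_code X B u a" "hull_code X B u b"
  shows "a = b"
  using assms(2,3)
proof (induction arbitrary: b rule: hull_code.induct)
  case (leaf a)
  \<comment> \<open>The label at the root \<open>[]\<close> is \<open>Some _\<close> for a leaf and
    \<open>None\<close> for a node, so codes of different shape differ there.\<close>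
  from leaf(2) show ?case
  proof cases
    case leaf
    then show ?thesis by (auto dest: fun_cong[of _ _ "[]"])
  next
    case (node c u)
    then show ?thesis by (auto dest: fun_cong[of _ _ "[]"])
  qed
next
  case (node c s u)
  from node(4) show ?case
  proof cases
    case leaf
    then show ?thesis by (auto dest: fun_cong[of _ _ "[]"])
  next
    case (node c' u')
    have "u k = u' k" for k
      using fun_cong[OF node(1), of "k # _"] by auto
    then have "c k = c' k" for k using node.IH node(3) by auto
    then have "c = c'" by (rule ext)
    then show ?thesis using chain_sup_unique[OF X] node node.hyps by blast
  qed
qed

lemma hull_code_range: "hull_code X B u a \<Longrightarrow> range u \<subseteq> insert None (Some ` B)"
  by (induction rule: hull_code.induct) (fastforce split: list.splits)+

lemma join_hull_has_code: "a \<in> join_hull X B \<Longrightarrow> \<exists>u. hull_code X B u a"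
proof (induction rule: join_hull.induct)
  case (base b)
  show ?case by (rule exI, rule hull_code.leaf[OF base])
next
  case (sup c s)
  then obtain u where "\<And>k. hull_code X B (u k) (c k)" by metis
  then show ?case by (intro exI, rule hull_code.node[OF sup(1)])
qed

lemma small_join_hull:
  assumes U: "universe \<U>" and X: "Partial_order X" and B: "small \<U> B"
  shows "small \<U> (join_hull X B)"
proof -
  obtain u where u: "\<And>a. a \<in> join_hull X B \<Longrightarrow> hull_code X B (u a) a"
    using join_hull_has_code by metis
  \<comment> \<open>Addresses are finite lists of naturals, hence countable; reading them through
    \<open>from_nat\<close> turns a code into a sequence.\<close>
  define d where "d a = u a \<circ> from_nat" for a
  have code: "hull_code X B (d a \<circ> to_nat) a" if "a \<in> join_hull X B" for a
    using u[OF that] by (simp add: d_def comp_def)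
  have "inj_on d (join_hull X B)"
  proof (rule inj_onI)
    fix a b assume "a \<in> join_hull X B" "b \<in> join_hull X B" "d a = d b"
    then show "a = b" using code[of a] code[of b] by (intro hull_code_unique[OF X, of B]) auto
  qed
  moreover have "range (d a) \<subseteq> insert None (Some ` B)" if "a \<in> join_hull X B" for a
  proof -
    have "range (d a) \<subseteq> range (u a)" by (auto simp: d_def)
    then show ?thesis using hull_code_range[OF u[OF that]] by (rule subset_trans)
  qed
  ultimately show ?thesis
    by (rule small_if_inj_sequences[OF U small_option[OF U B]])
qed

section \<open>Locally continuous functors into cpos of arbitrary size\<close>

lemma CPO_Partial_order: "X \<in> CPO \<U> \<Longrightarrow> Partial_order X"
  by (simp add: CPO_def is_cpo_def)

lemma CPO_is_cpo: "X \<in> CPO \<U> \<Longrightarrow> is_cpo X"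
  by (simp add: CPO_def)

text \<open>The laws of an enriched endofunctor, elementwise, but with values that may live in
  another type and outside \<open>\<U>\<close>, as the double dual requires.
  \<open>enriched_endo_iff\<close> recovers the original notion.\<close>

locale cpo_functor =
  fixes \<U> :: "'u set set" and P :: "'u rel \<Rightarrow> 'a rel"
    and p :: "'u rel \<Rightarrow> 'u rel \<Rightarrow> ('u \<Rightarrow> 'u) \<Rightarrow> ('a \<Rightarrow> 'a)"
  assumes is_cpo: "X \<in> CPO \<U> \<Longrightarrow> is_cpo (P X)"
    and hom: "X \<in> CPO \<U> \<Longrightarrow> Y \<in> CPO \<U> \<Longrightarrow> f \<in> cpo_hom X Y \<Longrightarrow> p X Y f \<in> cpo_hom (P X) (P Y)"
    and id: "X \<in> CPO \<U> \<Longrightarrow> a \<in> Field (P X) \<Longrightarrow> p X X (cpo_id X) a = a"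
    and comp: "X \<in> CPO \<U> \<Longrightarrow> Y \<in> CPO \<U> \<Longrightarrow> Z \<in> CPO \<U> \<Longrightarrow> f \<in> cpo_hom X Y \<Longrightarrow>
      g \<in> cpo_hom Y Z \<Longrightarrow> a \<in> Field (P X) \<Longrightarrow> p X Z (compose (Field X) g f) a = p Y Z g (p X Y f a)"
    and cont: "X \<in> CPO \<U> \<Longrightarrow> Y \<in> CPO \<U> \<Longrightarrow> chain_sup (hom_cpo X Y) c f \<Longrightarrow> a \<in> Field (P X) \<Longrightarrow>
      chain_sup (P Y) (\<lambda>k. p X Y (c k) a) (p X Y f a)"

lemma enriched_endo_iff:
  "enriched_endo \<U> F \<longleftrightarrow>
     cpo_functor \<U> (obj F) (mor F) \<and> (\<forall>X\<in>CPO \<U>. Field (obj F X) \<in> \<U>)" (is "?L \<longleftrightarrow> ?R")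
proof
  assume L: ?L
  have O: "obj F X \<in> CPO \<U>" if "X \<in> CPO \<U>" for X
    using L that unfolding enriched_endo_def by blast
  have lc: "omega_cont (hom_cpo X Y) (hom_cpo (obj F X) (obj F Y)) (mor F X Y)"
    if "X \<in> CPO \<U>" "Y \<in> CPO \<U>" for X Y
    using L that unfolding enriched_endo_def by blast
  have H: "mor F X Y f \<in> cpo_hom (obj F X) (obj F Y)"
    if XY: "X \<in> CPO \<U>" "Y \<in> CPO \<U>" and f: "f \<in> cpo_hom X Y" for X Y f
    using omega_cont_Field[OF lc[OF XY]] f
    by (simp add: Field_hom_cpo CPO_Partial_order[OF XY(2)] CPO_Partial_order[OF O[OF XY(2)]])
  have "cpo_functor \<U> (obj F) (mor F)"
  proof
    fix X Y Z f g c a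
    assume X: "X \<in> CPO \<U>"
    show "is_cpo (obj F X)" using O[OF X] by (rule CPO_is_cpo)
    show "mor F X X (cpo_id X) a = a" if "a \<in> Field (obj F X)"
      using L X that unfolding enriched_endo_def by simp
    assume Y: "Y \<in> CPO \<U>"
    show "f \<in> cpo_hom X Y \<Longrightarrow> mor F X Y f \<in> cpo_hom (obj F X) (obj F Y)" by (rule H[OF X Y])
    show "mor F X Z (compose (Field X) g f) a = mor F Y Z g (mor F X Y f a)"
      if "Z \<in> CPO \<U>" "f \<in> cpo_hom X Y" "g \<in> cpo_hom Y Z" "a \<in> Field (obj F X)"
      using L X Y that unfolding enriched_endo_def by (simp add: compose_def)
    show "chain_sup (obj F Y) (\<lambda>k. mor F X Y (c k) a) (mor F X Y f a)"
      if "chain_sup (hom_cpo X Y) c f" "a \<in> Field (obj F X)"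
      using chain_sup_hom_cpoD(3)[OF CPO_Partial_order[OF O[OF X]] CPO_is_cpo[OF O[OF Y]]
        omega_cont_chain_sup[OF lc[OF X Y] that(1)] that(2)] .
  qed
  then show ?R using O by (simp add: CPO_def)
next
  assume R: ?R
  then interpret F: cpo_functor \<U> "obj F" "mor F" by blast
  have PO: "Partial_order (obj F X)" if "X \<in> CPO \<U>" for X
    using F.is_cpo[OF that] by (rule is_cpo_Partial_order)
  show ?L
    unfolding enriched_endo_def
  proof (intro conjI ballI)
    fix X assume X: "X \<in> CPO \<U>"
    note PX = CPO_Partial_order[OF X]
    show "obj F X \<in> CPO \<U>" using R X F.is_cpo by (simp add: CPO_def)
    show "mor F X X (cpo_id X) = cpo_id (obj F X)"
      by (rule cpo_hom_eqI[OF F.hom[OF X X cpo_id_hom[OF PX]] cpo_id_hom[OF PO[OF X]]])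
        (simp add: F.id[OF X])
    fix Y assume Y: "Y \<in> CPO \<U>"
    show "omega_cont (hom_cpo X Y) (hom_cpo (obj F X) (obj F Y)) (mor F X Y)"
    proof (rule omega_contI[OF Partial_order_hom_cpo[OF CPO_Partial_order[OF Y]]])
      fix c f assume c: "chain_sup (hom_cpo X Y) c f"
      note D = chain_sup_hom_cpoD[OF PX CPO_is_cpo[OF Y] c]
      show "chain_sup (hom_cpo (obj F X) (obj F Y)) (\<lambda>k. mor F X Y (c k)) (mor F X Y f)"
        by (rule chain_sup_hom_cpoI) (auto intro: F.hom[OF X Y] D(1,2) F.cont[OF X Y c])
    qed
    fix Z f g assume Z: "Z \<in> CPO \<U>" and f: "f \<in> cpo_hom X Y" and g: "g \<in> cpo_hom Y Z"
    show "mor F X Z (compose (Field X) g f)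
      = compose (Field (obj F X)) (mor F Y Z g) (mor F X Y f)"
      by (rule cpo_hom_eqI[OF F.hom[OF X Z compose_cpo_hom[OF f g PX]]
          compose_cpo_hom[OF F.hom[OF X Y f] F.hom[OF Y Z g] PO[OF X]]])
        (simp add: F.comp[OF X Y Z f g] compose_eq)
  qed
qed

text \<open>Join-closed parts inherit suprema of chains, so the laws restrict to a subfunctor. The
  two applications are the join hulls in \<open>Tobj T X\<close> and in the double dual.\<close>

lemma cpo_functor_Restr:
  assumes "cpo_functor \<U> P p"
    and S: "\<And>X. X \<in> CPO \<U> \<Longrightarrow> S X \<subseteq> Field (P X)" "\<And>X. X \<in> CPO \<U> \<Longrightarrow> join_closed (P X) (S X)"
    and pS: "\<And>X Y f. X \<in> CPO \<U> \<Longrightarrow> Y \<in> CPO \<U> \<Longrightarrow> f \<in> cpo_hom X Y \<Longrightarrow> p X Y f ` S X \<subseteq> S Y"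
  shows "cpo_functor \<U> (\<lambda>X. Restr (P X) (S X)) (\<lambda>X Y f. restrict (p X Y f) (S X))"
proof -
  interpret P: cpo_functor \<U> P p by (rule assms(1))
  have PO: "Partial_order (P X)" if "X \<in> CPO \<U>" for X
    using P.is_cpo[OF that] by (rule is_cpo_Partial_order)
  have Fld: "Field (Restr (P X) (S X)) = S X" if "X \<in> CPO \<U>" for X
    using Field_Restr[OF PO S(1)] that by blast
  show ?thesis
  proof
    fix X Y Z f g c a
    assume X: "X \<in> CPO \<U>"
    show "is_cpo (Restr (P X) (S X))" by (rule is_cpo_Restr[OF P.is_cpo[OF X] S(1)[OF X] S(2)[OF
        X]])
    show "restrict (p X X (cpo_id X)) (S X) a = a" if "a \<in> Field (Restr (P X) (S X))"
      using that P.id[OF X] S(1)[OF X] by (auto simp: Fld[OF X])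
    assume Y: "Y \<in> CPO \<U>"
    show "restrict (p X Y f) (S X) \<in> cpo_hom (Restr (P X) (S X)) (Restr (P Y) (S Y))"
      if f: "f \<in> cpo_hom X Y"
    proof -
      have "restrict (p X Y f) (Field (Restr (P X) (S X))) \<in> cpo_hom (Restr (P X) (S X)) (Restr
          (P Y) (S Y))"
      proof (rule restrict_cpo_hom[OF Partial_order_subposet[OF PO[OF X]]])
        fix c s assume "chain_sup (Restr (P X) (S X)) c s"
        note c = chain_sup_RestrD[OF P.is_cpo[OF X] S(1)[OF X] S(2)[OF X] this]
        show "chain_sup (Restr (P Y) (S Y)) (\<lambda>k. p X Y f (c k)) (p X Y f s)"
          by (rule chain_sup_RestrI[OF cpo_hom_chain_sup[OF P.hom[OF X Y f] c(1)]])
            (use c(2,3) pS[OF X Y f] in auto)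
      qed
      then show ?thesis by (simp add: Fld[OF X])
    qed
    show "restrict (p X Z (compose (Field X) g f)) (S X) a
        = restrict (p Y Z g) (S Y) (restrict (p X Y f) (S X) a)"
      if "Z \<in> CPO \<U>" "f \<in> cpo_hom X Y" "g \<in> cpo_hom Y Z" "a \<in> Field (Restr (P X) (S X))"
      using that P.comp[OF X Y that(1,2,3), of a] S(1)[OF X] pS[OF X Y that(2)]
      by (auto simp: Fld[OF X])
    show "chain_sup (Restr (P Y) (S Y)) (\<lambda>k. restrict (p X Y (c k)) (S X) a) (restrict (p X Y f)
        (S X) a)"
      if c: "chain_sup (hom_cpo X Y) c f" and a: "a \<in> Field (Restr (P X) (S X))"
    proof -
      have aS: "a \<in> S X" using a by (simp add: Fld[OF X])
      note D = chain_sup_hom_cpoD[OF CPO_Partial_order[OF X] CPO_is_cpo[OF Y] c]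
      have "chain_sup (Restr (P Y) (S Y)) (\<lambda>k. p X Y (c k) a) (p X Y f a)"
        by (rule chain_sup_RestrI[OF P.cont[OF X Y c]])
          (use aS S(1)[OF X] pS[OF X Y D(1)] pS[OF X Y D(2)] in auto)
      then show ?thesis using aS by simp
    qed
  qed
qed

lemma cpo_functor_transport:
  assumes "cpo_functor \<U> P p"
    and e: "\<And>X. X \<in> CPO \<U> \<Longrightarrow> inj_on (e X) (Field (P X))"
  shows "cpo_functor \<U> (\<lambda>X. transport (e X) (P X))
    (\<lambda>X Y f. \<lambda>u\<in>e X ` Field (P X). e Y (p X Y f (inv_into (Field (P X)) (e X) u)))"
    (is "cpo_functor \<U> ?P ?p")
proof -
  interpret P: cpo_functor \<U> P p by (rule assms(1))
  let ?d = "\<lambda>X. inv_into (Field (P X)) (e X)"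
  have PO: "Partial_order (?P X)" if "X \<in> CPO \<U>" for X
    using is_cpo_transport[OF e P.is_cpo] that is_cpo_Partial_order by blast
  have val: "?p X Y f (e X a) = e Y (p X Y f a)" if "X \<in> CPO \<U>" "a \<in> Field (P X)" for X Y f a
    using that e by simp
  show ?thesis
  proof
    fix X Y Z f g c u
    assume X: "X \<in> CPO \<U>"
    show "is_cpo (?P X)" by (rule is_cpo_transport[OF e[OF X] P.is_cpo[OF X]])
    show "?p X X (cpo_id X) u = u" if "u \<in> Field (?P X)"
      using that P.id[OF X] val[OF X] by (auto simp: Field_transport simp del: restrict_apply
          restrict_apply')
    assume Y: "Y \<in> CPO \<U>"
    show "?p X Y f \<in> cpo_hom (?P X) (?P Y)" if f: "f \<in> cpo_hom X Y"
      unfolding Field_transport[symmetric]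
    proof (rule restrict_cpo_hom[OF PO[OF X]])
      fix c s assume "chain_sup (?P X) c s"
      from transport_chain_sup[OF e[OF Y] cpo_hom_chain_sup[OF P.hom[OF X Y f]
          transport_chain_supD[OF e[OF X] this]]]
      show "chain_sup (?P Y) (\<lambda>k. e Y (p X Y f (?d X (c k)))) (e Y (p X Y f (?d X s)))" .
    qed
    show "?p X Z (compose (Field X) g f) u = ?p Y Z g (?p X Y f u)"
      if Z: "Z \<in> CPO \<U>" and f: "f \<in> cpo_hom X Y" and g: "g \<in> cpo_hom Y Z" and u: "u \<in> Field (?P X)"
    proof -
      obtain a where a: "a \<in> Field (P X)" "u = e X a" using u by (auto simp: Field_transport)
      show ?thesis unfolding a(2) val[OF X a(1)]
        by (subst val[OF Y cpo_hom_Field[OF P.hom[OF X Y f] a(1)]])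
          (simp only: P.comp[OF X Y Z f g a(1)])
    qed
    show "chain_sup (?P Y) (\<lambda>k. ?p X Y (c k) u) (?p X Y f u)"
      if c: "chain_sup (hom_cpo X Y) c f" and u: "u \<in> Field (?P X)"
    proof -
      obtain a where a: "a \<in> Field (P X)" "u = e X a" using u by (auto simp: Field_transport)
      show ?thesis unfolding a(2) val[OF X a(1)]
        by (rule transport_chain_sup[OF e[OF Y] P.cont[OF X Y c a(1)]])
    qed
  qed
qed

text \<open>The existence half of the universal property of the Kan extension, for targets that are
  functors in the wider sense of \<open>cpo_functor\<close>.\<close>

definition extends_along_K ::
  "'u set set \<Rightarrow> 'u endo \<Rightarrow> ('u rel \<Rightarrow> 'a rel) \<Rightarrow> ('u rel \<Rightarrow> 'u rel \<Rightarrow> ('u \<Rightarrow> 'u) \<Rightarrow> ('a \<Rightarrow> 'a)) \<Rightarrow>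
   ('u set \<Rightarrow> 'u \<Rightarrow> 'a) \<Rightarrow> ('u rel \<Rightarrow> 'u \<Rightarrow> 'a) \<Rightarrow> bool" where
  "extends_along_K \<U> F P p \<sigma> \<tau> \<longleftrightarrow>
    (\<forall>X\<in>CPO \<U>. \<tau> X \<in> cpo_hom (obj F X) (P X)) \<and>
    (\<forall>X\<in>CPO \<U>. \<forall>Y\<in>CPO \<U>. \<forall>f\<in>cpo_hom X Y. \<forall>t\<in>Field (obj F X).
      p X Y f (\<tau> X t) = \<tau> Y (mor F X Y f t)) \<and>
    (\<forall>A. finite A \<longrightarrow> \<tau> (Id_on A) = \<sigma> A)"

lemma extends_along_KD:
  assumes "extends_along_K \<U> F P p \<sigma> \<tau>"
  shows "X \<in> CPO \<U> \<Longrightarrow> \<tau> X \<in> cpo_hom (obj F X) (P X)"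
    and "X \<in> CPO \<U> \<Longrightarrow> Y \<in> CPO \<U> \<Longrightarrow> f \<in> cpo_hom X Y \<Longrightarrow> t \<in> Field (obj F X) \<Longrightarrow>
      p X Y f (\<tau> X t) = \<tau> Y (mor F X Y f t)"
    and "finite A \<Longrightarrow> \<tau> (Id_on A) = \<sigma> A"
  using assms unfolding extends_along_K_def by blast+

text \<open>
  A functor into cpos of an arbitrary type whose values are small is isomorphic to an endofunctor,
  so it can be the target in the universal property of a left Kan extension.
\<close>

lemma strongly_finitary_extension:
  fixes F :: "'u endo" and P :: "'u rel \<Rightarrow> 'a rel" and \<sigma> :: "'u set \<Rightarrow> 'u \<Rightarrow> 'a"
  assumes U: "universe \<U>" and sf: "strongly_finitary \<U> F" and F: "enriched_endo \<U> F"
    and P: "cpo_functor \<U> P p" and small: "\<And>X. X \<in> CPO \<U> \<Longrightarrow> small \<U> (Field (P X))"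
    and \<sigma>: "\<And>A. finite A \<Longrightarrow> \<sigma> A \<in> cpo_hom (obj F (Id_on A)) (P (Id_on A))"
    and nat: "\<And>A B f t. finite A \<Longrightarrow> finite B \<Longrightarrow> f \<in> A \<rightarrow>\<^sub>E B \<Longrightarrow> t \<in> Field (obj F (Id_on A)) \<Longrightarrow>
      p (Id_on A) (Id_on B) f (\<sigma> A t) = \<sigma> B (mor F (Id_on A) (Id_on B) f t)"
  shows "\<exists>\<tau>. extends_along_K \<U> F P p \<sigma> \<tau>"
proof -
  interpret P: cpo_functor \<U> P p by (rule P)
  interpret F: cpo_functor \<U> "obj F" "mor F" using F by (simp add: enriched_endo_iff)
  have PF: "Partial_order (obj F X)" if "X \<in> CPO \<U>" for X
    using F.is_cpo[OF that] by (rule is_cpo_Partial_order)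
  have fin: "Id_on A \<in> CPO \<U>" if "finite A" for A :: "'u set" using Id_on_in_CPO[OF U that] .
  have "\<exists>e. X \<in> CPO \<U> \<longrightarrow> inj_on e (Field (P X)) \<and> e ` Field (P X) \<in> \<U>" for X
  proof (cases "X \<in> CPO \<U>")
    case True
    then obtain e B where e: "inj_on e (Field (P X))" "e ` Field (P X) \<subseteq> B" "B \<in> \<U>"
      using small unfolding small_def lepoll_def by blast
    then have "e ` Field (P X) \<in> \<U>"
      using U subset_imp_lepoll[OF e(2)] unfolding universe_def by blast
    with e show ?thesis by blast
  qed simp
  then obtain e where e: "\<And>X. X \<in> CPO \<U> \<Longrightarrow> inj_on (e X) (Field (P X))"
    and eU: "\<And>X. X \<in> CPO \<U> \<Longrightarrow> e X ` Field (P X) \<in> \<U>"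
    by metis
  \<comment> \<open>\<open>G\<close> is \<open>P\<close> carried along the embeddings
    \<open>e X\<close>. These are natural by construction, so the extension problem for
    \<open>P\<close> becomes one for an endofunctor.\<close>
  define G where "G = \<lparr>obj = (\<lambda>X. transport (e X) (P X)),
    mor = (\<lambda>X Y f. \<lambda>u\<in>e X ` Field (P X). e Y (p X Y f (inv_into (Field (P X)) (e X) u)))\<rparr>"
  have Gobj: "obj G X = transport (e X) (P X)" for X by (simp add: G_def)
  have Gmor: "mor G X Y f (e X a) = e Y (p X Y f a)" if "X \<in> CPO \<U>" "a \<in> Field (P X)" for X Y f a
    using that e by (simp add: G_def)
  have G: "enriched_endo \<U> G"
    unfolding enriched_endo_iff using cpo_functor_transport[OF P e] eU by (simp add: G_def
        Field_transport)
  interpret G: cpo_functor \<U> "obj G" "mor G" using G by (simp add: enriched_endo_iff)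
  define \<sigma>' where "\<sigma>' A = (\<lambda>t\<in>Field (obj F (Id_on A)). e (Id_on A) (\<sigma> A t))" for A
  have \<sigma>'_hom: "\<sigma>' A \<in> cpo_hom (obj F (Id_on A)) (obj G (Id_on A))" if A: "finite A" for A
    unfolding \<sigma>'_def Gobj
    by (intro restrict_cpo_hom[OF PF[OF fin[OF A]]] transport_chain_sup[OF e[OF fin[OF A]]]
        cpo_hom_chain_sup[OF \<sigma>[OF A]])
  have "nat_trans_K F G \<sigma>'"
    unfolding nat_trans_K_def
  proof (intro conjI allI impI ballI)
    fix A B :: "'u set" and f assume AB: "finite A \<and> finite B" and f: "f \<in> A \<rightarrow>\<^sub>E B"
    show "compose (Field (obj F (Id_on A))) (mor G (Id_on A) (Id_on B) f) (\<sigma>' A)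
      = compose (Field (obj F (Id_on A))) (\<sigma>' B) (mor F (Id_on A) (Id_on B) f)"
      unfolding compose_def
    proof (rule restrict_ext)
      fix t assume t: "t \<in> Field (obj F (Id_on A))"
      have "mor F (Id_on A) (Id_on B) f t \<in> Field (obj F (Id_on B))"
        using cpo_hom_Field[OF F.hom[OF fin fin cpo_hom_Id_on_Id_on] t] AB f by blast
      moreover have "\<sigma> A t \<in> Field (P (Id_on A))" using cpo_hom_Field[OF \<sigma> t] AB by blast
      ultimately show "mor G (Id_on A) (Id_on B) f (\<sigma>' A t) = \<sigma>' B (mor F (Id_on A) (Id_on B) f t)"
        using t AB nat f fin Gmor by (simp add: \<sigma>'_def)
    qed
  qed (rule \<sigma>'_hom)
  then obtain \<tau>' where \<tau>': "nat_trans \<U> F G \<tau>'" and ext: "\<And>A. finite A \<Longrightarrow> \<tau>' (Id_on A) = \<sigma>' A"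
    using sf G unfolding strongly_finitary_def by blast
  have \<tau>'_hom: "\<tau>' X \<in> cpo_hom (obj F X) (transport (e X) (P X))" if "X \<in> CPO \<U>" for X
    using \<tau>' that unfolding nat_trans_def Gobj by blast
  define \<tau> where "\<tau> X = (\<lambda>t\<in>Field (obj F X). inv_into (Field (P X)) (e X) (\<tau>' X t))" for X
  have \<tau>_hom: "\<tau> X \<in> cpo_hom (obj F X) (P X)" if X: "X \<in> CPO \<U>" for X
    unfolding \<tau>_def
    by (intro restrict_cpo_hom[OF PF[OF X]] transport_chain_supD[OF e[OF X]]
        cpo_hom_chain_sup[OF \<tau>'_hom[OF X]])
  have e\<tau>: "e X (\<tau> X t) = \<tau>' X t" if "X \<in> CPO \<U>" "t \<in> Field (obj F X)" for X t
    using cpo_hom_Field[OF \<tau>'_hom that(2)] that by (simp add: \<tau>_def Field_transport f_inv_into_f)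
  show ?thesis
    unfolding extends_along_K_def
  proof (intro exI[of _ \<tau>] conjI allI impI ballI \<tau>_hom)
    fix X Y f t
    assume X: "X \<in> CPO \<U>" and Y: "Y \<in> CPO \<U>" and f: "f \<in> cpo_hom X Y" and t: "t \<in> Field (obj F X)"
    note tX = cpo_hom_Field[OF \<tau>_hom[OF X] t] and ft = cpo_hom_Field[OF F.hom[OF X Y f] t]
    have "compose (Field (obj F X)) (mor G X Y f) (\<tau>' X) = compose (Field (obj F X)) (\<tau>' Y) (mor
        F X Y f)"
      using \<tau>' X Y f unfolding nat_trans_def by blast
    then have "mor G X Y f (\<tau>' X t) = \<tau>' Y (mor F X Y f t)"
      using t by (metis compose_eq)
    then have "e Y (p X Y f (\<tau> X t)) = e Y (\<tau> Y (mor F X Y f t))"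
      using Gmor[OF X tX] e\<tau>[OF X t] e\<tau>[OF Y ft] by simp
    then show "p X Y f (\<tau> X t) = \<tau> Y (mor F X Y f t)"
      using e[OF Y] cpo_hom_Field[OF P.hom[OF X Y f] tX] cpo_hom_Field[OF \<tau>_hom[OF Y] ft]
      by (simp add: inj_on_eq_iff)
  next
    fix A :: "'u set" assume A: "finite A"
    show "\<tau> (Id_on A) = \<sigma> A"
    proof (rule cpo_hom_eqI[OF \<tau>_hom[OF fin[OF A]] \<sigma>[OF A]])
      fix t assume t: "t \<in> Field (obj F (Id_on A))"
      show "\<tau> (Id_on A) t = \<sigma> A t"
        using t e[OF fin[OF A]] cpo_hom_Field[OF \<sigma>[OF A] t] ext[OF A]
        by (simp add: \<tau>_def \<sigma>'_def)
    qed
  qed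
qed

text \<open>The uniqueness half of strong finitarity: \<open>\<tau>\<close> and the identity extend
  the same transformation on finite discrete cpos.\<close>

lemma strongly_finitary_unique:
  fixes F :: "'u endo"
  assumes U: "universe \<U>" and sf: "strongly_finitary \<U> F" and F: "enriched_endo \<U> F"
    and \<tau>: "nat_trans \<U> F F \<tau>" "\<And>A. finite A \<Longrightarrow> \<tau> (Id_on A) = cpo_id (obj F (Id_on A))"
    and X: "X \<in> CPO \<U>" and t: "t \<in> Field (obj F X)"
  shows "\<tau> X t = t"
proof -
  interpret F: cpo_functor \<U> "obj F" "mor F" using F by (simp add: enriched_endo_iff)
  have PF: "Partial_order (obj F X)" if "X \<in> CPO \<U>" for X
    using F.is_cpo[OF that] by (rule is_cpo_Partial_order)
  have fin: "Id_on A \<in> CPO \<U>" if "finite A" for A :: "'u set" using Id_on_in_CPO[OF U that] .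
  define \<iota> where "\<iota> = (\<lambda>X\<in>CPO \<U>. cpo_id (obj F X))"
  have \<iota>: "nat_trans \<U> F F \<iota>"
    unfolding nat_trans_def \<iota>_def
    using cpo_id_hom[OF PF] cpo_hom_Field[OF F.hom] by (auto simp: compose_def intro!: restrict_ext)
  have "nat_trans_K F F (\<lambda>A. \<tau> (Id_on A))"
    unfolding nat_trans_K_def
  proof (intro conjI allI impI ballI)
    fix A B :: "'u set" and f assume AB: "finite A \<and> finite B" and f: "f \<in> A \<rightarrow>\<^sub>E B"
    have "f \<in> cpo_hom (Id_on A) (Id_on B)"
      using f by (rule cpo_hom_Id_on_Id_on)
    then show "compose (Field (obj F (Id_on A))) (mor F (Id_on A) (Id_on B) f) (\<tau> (Id_on A))
      = compose (Field (obj F (Id_on A))) (\<tau> (Id_on B)) (mor F (Id_on A) (Id_on B) f)"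
      using \<tau>(1) fin AB unfolding nat_trans_def by blast
  qed (use \<tau>(1) fin nat_trans_def in blast)
  then have "\<exists>!\<tau>'. nat_trans \<U> F F \<tau>' \<and> (\<forall>A. finite A \<longrightarrow> \<tau>' (Id_on A) = \<tau> (Id_on A))"
    using sf F unfolding strongly_finitary_def by blast
  then have "\<tau> = \<iota>"
    using \<tau> \<iota> fin by (auto simp: \<iota>_def)
  then show ?thesis using X t by (simp add: \<iota>_def)
qed

lemma cpo_hom_into_Restr:
  assumes X: "Partial_order X" and Y: "is_cpo Y" "S \<subseteq> Field Y" "join_closed Y S" and f: "f \<in>
      cpo_hom X (Restr Y S)"
  shows "f \<in> cpo_hom X Y" "a \<in> Field X \<Longrightarrow> f a \<in> S"
proof -
  show "f \<in> cpo_hom X Y"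
    by (rule cpo_homI[OF X cpo_hom_ext[OF f]])
      (rule chain_sup_RestrD(1)[OF Y cpo_hom_chain_sup[OF f]])
  show "a \<in> Field X \<Longrightarrow> f a \<in> S"
    using cpo_hom_Field[OF f] Field_Restr[OF is_cpo_Partial_order[OF Y(1)] Y(2)] by blast
qed

text \<open>Lets an identity between continuous maps pass from generators to their whole join
  hull.\<close>

lemma join_closed_equalizer:
  assumes Y: "Partial_order Y"
    and f: "\<And>c s. chain_sup X c s \<Longrightarrow> chain_sup Y (\<lambda>k. f (c k)) (f s)"
    and g: "\<And>c s. chain_sup X c s \<Longrightarrow> chain_sup Y (\<lambda>k. g (c k)) (g s)"
  shows "join_closed X {a. f a = g a}"
  unfolding join_closed_def
proof (intro allI impI CollectI, elim conjE)
  fix c s assume c: "chain_sup X c s" and "range c \<subseteq> {a. f a = g a}"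
  then have "(\<lambda>k. f (c k)) = (\<lambda>k. g (c k))" by auto
  then show "f s = g s" using chain_sup_unique[OF Y f[OF c]] g[OF c] by simp
qed

lemma alg_homI:
  assumes "h \<in> cpo_hom (carr A) (carr B)"
    and "\<And>n \<sigma> as. \<sigma> \<in> \<Sigma> n \<Longrightarrow> length as = n \<Longrightarrow> set as \<subseteq> Field (carr A) \<Longrightarrow>
      h (oper A \<sigma> as) = oper B \<sigma> (map h as)"
  shows "h \<in> alg_hom \<Sigma> A B"
  using assms unfolding alg_hom_def by blast

section \<open>The algebras of a strongly finitary monad\<close>

locale sf_monad =
  fixes \<U> :: "'u set set" and x :: "nat \<Rightarrow> 'u" and T :: "'u monad"
  assumes univ: "universe \<U>" and inj_x: "inj x" and sfm: "strongly_finitary_monad \<U> T"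
begin

section \<open>Monad laws and Kleisli calculus, elementwise\<close>

abbreviation V :: "nat \<Rightarrow> 'u rel" where "V \<equiv> Vn x"
abbreviation kl where "kl \<equiv> kleisli_ext T"

lemma endo_T: "enriched_endo \<U> (endo T)"
  using sfm unfolding strongly_finitary_monad_def enriched_monad_def by blast

lemma sf_T: "strongly_finitary \<U> (endo T)"
  using sfm unfolding strongly_finitary_monad_def by blast

sublocale T: cpo_functor \<U> "Tobj T" "Tmor T"
  using endo_T by (simp add: enriched_endo_iff)

lemma T_CPO: "X \<in> CPO \<U> \<Longrightarrow> Tobj T X \<in> CPO \<U>"
  using endo_T unfolding enriched_endo_def by blast

lemma T_PO: "X \<in> CPO \<U> \<Longrightarrow> Partial_order (Tobj T X)"
  using T_CPO CPO_Partial_order by blast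

lemma T_Field: "X \<in> CPO \<U> \<Longrightarrow> Y \<in> CPO \<U> \<Longrightarrow> f \<in> cpo_hom X Y \<Longrightarrow> t \<in> Field (Tobj T X) \<Longrightarrow>
    Tmor T X Y f t \<in> Field (Tobj T Y)"
  using cpo_hom_Field[OF T.hom] .

lemma unit_hom: "X \<in> CPO \<U> \<Longrightarrow> unit T X \<in> cpo_hom X (Tobj T X)"
  using sfm by (simp add: strongly_finitary_monad_def enriched_monad_def nat_trans_def id_endo_def)

lemma mult_hom: "X \<in> CPO \<U> \<Longrightarrow> mult T X \<in> cpo_hom (Tobj T (Tobj T X)) (Tobj T X)"
  using sfm by (simp add: strongly_finitary_monad_def enriched_monad_def nat_trans_def
      comp_endo_def)

lemma unit_nat:
  assumes "X \<in> CPO \<U>" "Y \<in> CPO \<U>" "f \<in> cpo_hom X Y" "a \<in> Field X"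
  shows "Tmor T X Y f (unit T X a) = unit T Y (f a)"
proof -
  have "compose (Field X) (Tmor T X Y f) (unit T X) = compose (Field X) (unit T Y) f"
    using sfm assms
    by (simp add: strongly_finitary_monad_def enriched_monad_def nat_trans_def id_endo_def)
  from fun_cong[OF this, of a] show ?thesis using assms(4) by (simp add: compose_def)
qed

lemma mult_nat:
  assumes "X \<in> CPO \<U>" "Y \<in> CPO \<U>" "f \<in> cpo_hom X Y" "t \<in> Field (Tobj T (Tobj T X))"
  shows "Tmor T X Y f (mult T X t) = mult T Y (Tmor T (Tobj T X) (Tobj T Y) (Tmor T X Y f) t)"
proof -
  have "compose (Field (Tobj T (Tobj T X))) (Tmor T X Y f) (mult T X)
    = compose (Field (Tobj T (Tobj T X))) (mult T Y) (Tmor T (Tobj T X) (Tobj T Y) (Tmor T X Y f))"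
    using sfm assms
    by (simp add: strongly_finitary_monad_def enriched_monad_def nat_trans_def comp_endo_def)
  from fun_cong[OF this, of t] show ?thesis using assms(4) by (simp add: compose_def)
qed

lemma monad_laws:
  assumes "X \<in> CPO \<U>"
  shows "t \<in> Field (Tobj T X) \<Longrightarrow> mult T X (unit T (Tobj T X) t) = t"
    and "t \<in> Field (Tobj T X) \<Longrightarrow> mult T X (Tmor T X (Tobj T X) (unit T X) t) = t"
    and "u \<in> Field (Tobj T (Tobj T (Tobj T X))) \<Longrightarrow>
      mult T X (mult T (Tobj T X) u) = mult T X (Tmor T (Tobj T (Tobj T X)) (Tobj T X) (mult T
          X) u)"
proof -
  have *: "compose (Field (Tobj T X)) (mult T X) (unit T (Tobj T X)) = cpo_id (Tobj T X)"
    "compose (Field (Tobj T X)) (mult T X) (Tmor T X (Tobj T X) (unit T X)) = cpo_id (Tobj T X)"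
    "compose (Field (Tobj T (Tobj T (Tobj T X)))) (mult T X) (mult T (Tobj T X))
      = compose (Field (Tobj T (Tobj T (Tobj T X)))) (mult T X)
          (Tmor T (Tobj T (Tobj T X)) (Tobj T X) (mult T X))"
    using sfm assms by (simp_all add: strongly_finitary_monad_def enriched_monad_def)
  show "t \<in> Field (Tobj T X) \<Longrightarrow> mult T X (unit T (Tobj T X) t) = t"
    using fun_cong[OF *(1), of t] by (simp add: compose_def)
  show "t \<in> Field (Tobj T X) \<Longrightarrow> mult T X (Tmor T X (Tobj T X) (unit T X) t) = t"
    using fun_cong[OF *(2), of t] by (simp add: compose_def)
  show "u \<in> Field (Tobj T (Tobj T (Tobj T X))) \<Longrightarrow>
      mult T X (mult T (Tobj T X) u) = mult T X (Tmor T (Tobj T (Tobj T X)) (Tobj T X) (mult T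
          X) u)"
    using fun_cong[OF *(3), of u] by (simp add: compose_def)
qed

lemma kl_eq: "t \<in> Field (Tobj T X) \<Longrightarrow> kl X Y k t = mult T Y (Tmor T X (Tobj T Y) k t)"
  by (simp add: kleisli_ext_def compose_eq)

lemma kl_hom:
  assumes "X \<in> CPO \<U>" "Y \<in> CPO \<U>" "k \<in> cpo_hom X (Tobj T Y)"
  shows "kl X Y k \<in> cpo_hom (Tobj T X) (Tobj T Y)"
  unfolding kleisli_ext_def
  by (rule compose_cpo_hom[OF T.hom[OF assms(1) T_CPO[OF assms(2)] assms(3)] mult_hom[OF
      assms(2)] T_PO[OF assms(1)]])

lemma kl_Field:
  assumes "X \<in> CPO \<U>" "Y \<in> CPO \<U>" "k \<in> cpo_hom X (Tobj T Y)" "t \<in> Field (Tobj T X)"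
  shows "kl X Y k t \<in> Field (Tobj T Y)"
  using cpo_hom_Field[OF kl_hom[OF assms(1-3)] assms(4)] .

lemma kl_unit:
  assumes "X \<in> CPO \<U>" "Y \<in> CPO \<U>" "k \<in> cpo_hom X (Tobj T Y)" "a \<in> Field X"
  shows "kl X Y k (unit T X a) = k a"
proof -
  have "unit T X a \<in> Field (Tobj T X)" using cpo_hom_Field[OF unit_hom] assms by blast
  then show ?thesis
    using unit_nat[OF assms(1) T_CPO[OF assms(2)] assms(3,4)]
      monad_laws(1)[OF assms(2) cpo_hom_Field[OF assms(3,4)]] by (simp add: kl_eq)
qed

text \<open>With some \<open>V n\<close> for \<open>X\<close> and a tuple of arguments for
  \<open>k\<close>, this says that \<open>Tmor T Y Z g\<close> commutes with the free-algebra
  operation named by \<open>t\<close>. \<open>mult_kl\<close> does the same for the multiplication,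
  and \<open>kl_kl\<close> is behind equation (2).\<close>

lemma T_kl:
  assumes X: "X \<in> CPO \<U>" and Y: "Y \<in> CPO \<U>" and Z: "Z \<in> CPO \<U>"
    and k: "k \<in> cpo_hom X (Tobj T Y)" and g: "g \<in> cpo_hom Y Z" and t: "t \<in> Field (Tobj T X)"
  shows "Tmor T Y Z g (kl X Y k t) = kl X Z (compose (Field X) (Tmor T Y Z g) k) t"
  using T.comp[OF X T_CPO[OF Y] T_CPO[OF Z] k T.hom[OF Y Z g] t]
    mult_nat[OF Y Z g T_Field[OF X T_CPO[OF Y] k t]] t
  by (simp add: kl_eq)

lemma T_eq_kl:
  assumes X: "X \<in> CPO \<U>" and Y: "Y \<in> CPO \<U>" and f: "f \<in> cpo_hom X Y" and t: "t \<in> Field (Tobj T X)"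
  shows "Tmor T X Y f t = kl X Y (compose (Field X) (unit T Y) f) t"
  using T.comp[OF X Y T_CPO[OF Y] f unit_hom[OF Y] t] monad_laws(2)[OF Y T_Field[OF X Y f t]] t
  by (simp add: kl_eq)

lemma mult_kl:
  assumes X: "X \<in> CPO \<U>" and Y: "Y \<in> CPO \<U>"
    and k: "k \<in> cpo_hom X (Tobj T (Tobj T Y))" and t: "t \<in> Field (Tobj T X)"
  shows "mult T Y (kl X (Tobj T Y) k t) = kl X Y (compose (Field X) (mult T Y) k) t"
proof -
  note TY = T_CPO[OF Y] and TTY = T_CPO[OF T_CPO[OF Y]]
  show ?thesis
    using monad_laws(3)[OF Y T_Field[OF X TTY k t]] T.comp[OF X TTY TY k mult_hom[OF Y] t] t
    by (simp add: kl_eq)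
qed

lemma kl_kl:
  assumes X: "X \<in> CPO \<U>" and Y: "Y \<in> CPO \<U>" and Z: "Z \<in> CPO \<U>"
    and k: "k \<in> cpo_hom X (Tobj T Y)" and l: "l \<in> cpo_hom Y (Tobj T Z)" and t: "t \<in> Field (Tobj
        T X)"
  shows "kl Y Z l (kl X Y k t) = kl X Z (compose (Field X) (kl Y Z l) k) t"
proof -
  note TZ = T_CPO[OF Z]
  have Tk: "compose (Field X) (Tmor T Y (Tobj T Z) l) k \<in> cpo_hom X (Tobj T (Tobj T Z))"
    by (rule compose_cpo_hom[OF k T.hom[OF Y TZ l] CPO_Partial_order[OF X]])
  have "kl Y Z l (kl X Y k t) = mult T Z (kl X (Tobj T Z) (compose (Field X) (Tmor T Y (Tobj T
      Z) l) k) t)"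
    using kl_Field[OF X Y k t] T_kl[OF X Y TZ k l t] by (simp add: kl_eq[of "kl X Y k t"])
  also have "\<dots> = kl X Z (compose (Field X) (mult T Z) (compose (Field X) (Tmor T Y (Tobj T Z) l)
      k)) t"
    by (rule mult_kl[OF X Z Tk t])
  also have "compose (Field X) (mult T Z) (compose (Field X) (Tmor T Y (Tobj T Z) l) k)
      = compose (Field X) (kl Y Z l) k"
    using cpo_hom_Field[OF k] by (auto simp: compose_def kl_eq intro!: restrict_ext)
  finally show ?thesis .
qed

text \<open>Local continuity of \<open>T\<close> enters here; it will make the operations of the
  free algebra continuous in their arguments.\<close>

lemma kl_cont:
  assumes X: "X \<in> CPO \<U>" and Y: "Y \<in> CPO \<U>" and k: "chain_sup (hom_cpo X (Tobj T Y)) c k"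
    and t: "t \<in> Field (Tobj T X)"
  shows "chain_sup (Tobj T Y) (\<lambda>i. kl X Y (c i) t) (kl X Y k t)"
  using cpo_hom_chain_sup[OF mult_hom[OF Y] T.cont[OF X T_CPO[OF Y] k t]] t by (simp add: kl_eq)

section \<open>The discrete cpos \<open>V n\<close>, tuples and enumerations\<close>

lemma Field_V: "Field (V n) = x ` {..<n}"
  by (simp add: Vn_def Field_Id_on)

lemma V_CPO: "V n \<in> CPO \<U>"
  unfolding Vn_def by (rule Id_on_in_CPO[OF univ]) simp

text \<open>Translates between the list arguments of \<open>oper\<close> and morphisms out of
  \<open>V n\<close>. It is restricted because morphisms are extensional functions.\<close>

definition tup :: "'a list \<Rightarrow> 'u \<Rightarrow> 'a" where
  "tup as = (\<lambda>v\<in>x ` {..<length as}. as ! inv x v)"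

lemma tup_x [simp]: "i < length as \<Longrightarrow> tup as (x i) = as ! i"
  by (simp add: tup_def inj_x inv_f_f)

lemma tup_hom:
  assumes "Partial_order Y" "set as \<subseteq> Field Y" "length as = n"
  shows "tup as \<in> cpo_hom (V n) Y"
  unfolding Vn_def
proof (rule cpo_hom_Id_on[OF assms(1)])
  show "tup as \<in> x ` {..<n} \<rightarrow>\<^sub>E Field Y"
    using assms(2,3) by (auto simp: tup_def inj_x inv_f_f)
qed

lemma compose_tup: "compose (x ` {..<length as}) f (tup as) = tup (map f as)"
  by (rule extensionalityI[of _ "x ` {..<length as}"]) (auto simp: compose_eq tup_def inj_x inv_f_f)

lemma tup_eta: "k \<in> extensional (x ` {..<n}) \<Longrightarrow> tup (map (\<lambda>i. k (x i)) [0..<n]) = k"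
  by (rule extensionalityI[of _ "x ` {..<n}"]) (auto simp: tup_def inj_x inv_f_f)

text \<open>Strong finitarity speaks of all finite subsets of \<open>'u\<close>, the signature only
  of the sets \<open>V n\<close>. The explicit bijection carries statements from one to the
  other.\<close>

lemma finite_enumeration:
  assumes "finite A"
  obtains n e d where "e \<in> x ` {..<n} \<rightarrow>\<^sub>E A" "d \<in> A \<rightarrow>\<^sub>E x ` {..<n}"
    "\<And>a. a \<in> A \<Longrightarrow> e (d a) = a" "\<And>v. v \<in> x ` {..<n} \<Longrightarrow> d (e v) = v"
proof -
  obtain as where as: "set as = A" "distinct as" using finite_distinct_list[OF assms] by blast
  define n where "n = length as"
  define d where "d = (\<lambda>a\<in>A. x (inv_into {..<n} ((!) as) a))"
  have inj: "inj_on ((!) as) {..<n}" using as(2) by (simp add: inj_on_nth n_def)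
  have A: "A = (!) as ` {..<n}" unfolding as(1)[symmetric] n_def by (auto simp: in_set_conv_nth)
  show ?thesis
  proof (rule that[of "tup as" n d])
    show "tup as \<in> x ` {..<n} \<rightarrow>\<^sub>E A"
      using as(1) by (auto simp: tup_def inj_x inv_f_f n_def)
    have i: "inv_into {..<n} ((!) as) a \<in> {..<n}" "as ! inv_into {..<n} ((!) as) a = a" if "a \<in>
        A" for a
      using that unfolding A by (rule inv_into_into, rule f_inv_into_f)
    then show "d \<in> A \<rightarrow>\<^sub>E x ` {..<n}" by (auto simp: d_def)
    show "tup as (d a) = a" if "a \<in> A" for a
      using i[OF that] that by (simp add: d_def n_def)
    show "d (tup as v) = v" if v: "v \<in> x ` {..<n}" for v
    proof -
      obtain i where i: "i < n" "v = x i" using v by blast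
      moreover have "inv_into {..<n} ((!) as) (as ! i) = i" using inv_into_f_f[OF inj] i(1) by simp
      ultimately show ?thesis by (simp add: d_def A n_def)
    qed
  qed
qed

lemma T_enumeration:
  assumes A: "finite A" and e: "e \<in> x ` {..<n} \<rightarrow>\<^sub>E A" "d \<in> A \<rightarrow>\<^sub>E x ` {..<n}"
    "\<And>a. a \<in> A \<Longrightarrow> e (d a) = a" and t: "t \<in> Field (Tobj T (Id_on A))"
  shows "Tmor T (V n) (Id_on A) e (Tmor T (Id_on A) (V n) d t) = t"
proof -
  have h: "e \<in> cpo_hom (V n) (Id_on A)" "d \<in> cpo_hom (Id_on A) (V n)"
    using e by (simp_all add: Vn_def cpo_hom_Id_on_Id_on)
  have "compose (Field (Id_on A)) e d = cpo_id (Id_on A)"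
    using e(3) by (auto simp: Field_Id_on compose_def)
  then show ?thesis
    using T.comp[OF Id_on_in_CPO[OF univ A] V_CPO Id_on_in_CPO[OF univ A] h(2,1) t]
      T.id[OF Id_on_in_CPO[OF univ A] t] by simp
qed

section \<open>Generation of \<open>TX\<close> by finitary elements\<close>

definition gens :: "'u rel \<Rightarrow> 'u set" where
  "gens X = {Tmor T (V n) X g s | n g s. g \<in> cpo_hom (V n) X \<and> s \<in> Field (Tobj T (V n))}"

lemma gens_subset: "X \<in> CPO \<U> \<Longrightarrow> gens X \<subseteq> Field (Tobj T X)"
  unfolding gens_def using T_Field[OF V_CPO] by blast

lemma T_gens:
  assumes "X \<in> CPO \<U>" "Y \<in> CPO \<U>" "f \<in> cpo_hom X Y"
  shows "Tmor T X Y f ` gens X \<subseteq> gens Y"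
proof clarify
  fix t assume "t \<in> gens X"
  then obtain n g s where g: "t = Tmor T (V n) X g s" "g \<in> cpo_hom (V n) X" "s \<in> Field (Tobj T
      (V n))"
    unfolding gens_def by blast
  then have "Tmor T X Y f t = Tmor T (V n) Y (compose (Field (V n)) f g) s"
    using T.comp[OF V_CPO assms(1,2) g(2) assms(3) g(3)] by simp
  then show "Tmor T X Y f t \<in> gens Y"
    unfolding gens_def using compose_cpo_hom[OF g(2) assms(3) CPO_Partial_order[OF V_CPO]] g(3)
        by blast
qed

text \<open>
  The join hulls of the images of the \<open>TV\<^sub>n\<close> form a subfunctor of \<open>T\<close> that contains \<open>TK\<close>. Hence
  the identity of \<open>TK\<close> extends to a transformation from \<open>T\<close> into it, which by uniqueness is the
  identity of \<open>T\<close>.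
\<close>

lemma join_hull_gens:
  assumes X: "X \<in> CPO \<U>"
  shows "join_hull (Tobj T X) (gens X) = Field (Tobj T X)"
proof
  let ?S = "\<lambda>X. join_hull (Tobj T X) (gens X)"
  have S: "?S X \<subseteq> Field (Tobj T X)" if "X \<in> CPO \<U>" for X
    using join_hull_subset[OF gens_subset[OF that]] .
  show "?S X \<subseteq> Field (Tobj T X)" using S[OF X] .
  have fin: "Id_on A \<in> CPO \<U>" if "finite A" for A :: "'u set" using Id_on_in_CPO[OF univ that] .
  have R: "cpo_functor \<U> (\<lambda>X. Restr (Tobj T X) (?S X)) (\<lambda>X Y f. restrict (Tmor T X Y f) (?S X))"
    by (rule cpo_functor_Restr[OF T.cpo_functor_axioms S join_closed_join_hull])
      (assumption, rule cpo_hom_join_hull[OF T.hom T_gens])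
  have sm: "small \<U> (Field (Restr (Tobj T X) (?S X)))" if "X \<in> CPO \<U>" for X
  proof (rule small_subset[OF small_in_universe])
    show "Field (Tobj T X) \<in> \<U>" using T_CPO[OF that] by (simp add: CPO_def)
    show "Field (Restr (Tobj T X) (?S X)) \<subseteq> Field (Tobj T X)" by (rule mono_Field) blast
  qed
  \<comment> \<open>On a finite discrete cpo no joins are needed: an enumeration by some
    \<open>V n\<close> already presents every element as a generator.\<close>
  have full: "t \<in> ?S (Id_on A)" if "finite A" and t: "t \<in> Field (Tobj T (Id_on A))" for A t
  proof -
    obtain n e d where e: "e \<in> x ` {..<n} \<rightarrow>\<^sub>E A" "d \<in> A \<rightarrow>\<^sub>E x ` {..<n}" "\<And>a. a \<in> A \<Longrightarrow> e (d a) = a"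
      using finite_enumeration[OF \<open>finite A\<close>] by metis
    have h: "e \<in> cpo_hom (V n) (Id_on A)" "d \<in> cpo_hom (Id_on A) (V n)"
      using e by (simp_all add: Vn_def cpo_hom_Id_on_Id_on)
    have "Tmor T (V n) (Id_on A) e (Tmor T (Id_on A) (V n) d t) \<in> gens (Id_on A)"
      unfolding gens_def using h T_Field[OF fin V_CPO h(2) t] \<open>finite A\<close> by blast
    then show ?thesis
      using T_enumeration[OF \<open>finite A\<close> e t] by (auto intro: join_hull.base)
  qed
  have id_hom: "cpo_id (Tobj T (Id_on A)) \<in> cpo_hom (Tobj T (Id_on A)) (Restr (Tobj T (Id_on A))
      (?S (Id_on A)))"
    if A: "finite A" for A
  proof (rule restrict_cpo_hom[OF T_PO[OF fin[OF A]]])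
    fix c s assume c: "chain_sup (Tobj T (Id_on A)) c s"
    show "chain_sup (Restr (Tobj T (Id_on A)) (?S (Id_on A))) c s"
      by (rule chain_sup_RestrI[OF c]) (use full[OF A] chain_sup_Field[OF c] in auto)
  qed
  have id_nat: "restrict (Tmor T (Id_on A) (Id_on B) f) (?S (Id_on A)) (cpo_id (Tobj T (Id_on A)) t)
      = cpo_id (Tobj T (Id_on B)) (Tmor T (Id_on A) (Id_on B) f t)"
    if A: "finite A" and B: "finite B" and f: "f \<in> A \<rightarrow>\<^sub>E B" and t: "t \<in> Field (Tobj T (Id_on A))"
    for A B f t
    using full[OF A t] t T_Field[OF fin[OF A] fin[OF B] cpo_hom_Id_on_Id_on[OF f] t] by simp
  have "\<exists>\<tau>. extends_along_K \<U> (endo T) (\<lambda>X. Restr (Tobj T X) (?S X))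
      (\<lambda>X Y f. restrict (Tmor T X Y f) (?S X)) (\<lambda>A. cpo_id (Tobj T (Id_on A))) \<tau>"
    by (rule strongly_finitary_extension[OF univ sf_T endo_T R]) (rule sm id_hom id_nat;
        assumption)+
  then obtain \<tau> where "extends_along_K \<U> (endo T) (\<lambda>X. Restr (Tobj T X) (?S X))
      (\<lambda>X Y f. restrict (Tmor T X Y f) (?S X)) (\<lambda>A. cpo_id (Tobj T (Id_on A))) \<tau>"
    by blast
  note \<tau> = extends_along_KD(1)[OF this] and nat = extends_along_KD(2)[OF this]
    and ext = extends_along_KD(3)[OF this]
  have \<tau>': "\<tau> X \<in> cpo_hom (Tobj T X) (Tobj T X)" "t \<in> Field (Tobj T X) \<Longrightarrow> \<tau> X t \<in> ?S X"
    if "X \<in> CPO \<U>" for X t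
    using cpo_hom_into_Restr[OF T_PO T.is_cpo S join_closed_join_hull \<tau>] that by blast+
  have nt: "nat_trans \<U> (endo T) (endo T) (restrict \<tau> (CPO \<U>))"
    unfolding nat_trans_def
  proof (intro conjI ballI)
    fix X Y f assume X: "X \<in> CPO \<U>" and Y: "Y \<in> CPO \<U>" and f: "f \<in> cpo_hom X Y"
    show "compose (Field (Tobj T X)) (Tmor T X Y f) (restrict \<tau> (CPO \<U>) X)
      = compose (Field (Tobj T X)) (restrict \<tau> (CPO \<U>) Y) (Tmor T X Y f)"
      unfolding compose_def using X Y nat[OF X Y f] \<tau>'[OF X] by (auto intro!: restrict_ext)
  qed (use \<tau>' in auto)
  have "\<tau> X t = t" if t: "t \<in> Field (Tobj T X)" for t
    using strongly_finitary_unique[OF univ sf_T endo_T nt _ X t] X fin ext by simp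
  then show "Field (Tobj T X) \<subseteq> ?S X" using \<tau>'(2)[OF X] by force
qed

lemma gens_induct:
  assumes X: "X \<in> CPO \<U>" and "join_closed (Tobj T X) {t. Q t}"
    and "\<And>t. t \<in> gens X \<Longrightarrow> Q t" and "t \<in> Field (Tobj T X)"
  shows "Q t"
proof -
  have "t \<in> join_hull (Tobj T X) (gens X)" using assms(4) join_hull_gens[OF X] by simp
  then show ?thesis
  proof (induction rule: join_hull.induct)
    case (sup c s)
    then show ?case using assms(2) unfolding join_closed_def by blast
  qed (rule assms(3))
qed

text \<open>Different arguments may arise by different towers of joins, so they are freed one at a
  time. The induction keeps a prefix \<open>us\<close> of arbitrary elements and a suffix
  \<open>vs\<close> of generators; its step moves the boundary across one argument \<open>t\<close>,
  with the join induction in \<open>t\<close> alone.\<close>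

lemma gens_list_induct:
  assumes X: "X \<in> CPO \<U>"
    and closed: "\<And>us vs. us \<in> lists (Field (Tobj T X)) \<Longrightarrow> vs \<in> lists (Field (Tobj T X)) \<Longrightarrow>
      Suc (length us + length vs) = n \<Longrightarrow> join_closed (Tobj T X) {t. Q (us @ t # vs)}"
    and base: "\<And>ts. ts \<in> lists (gens X) \<Longrightarrow> length ts = n \<Longrightarrow> Q ts"
    and ts: "ts \<in> lists (Field (Tobj T X))" "length ts = n"
  shows "Q ts"
proof -
  have "Q (us @ vs)" if "us \<in> lists (Field (Tobj T X))" "vs \<in> lists (gens X)" "length us +
      length vs = n" for us vs
    using that
  proof (induction us arbitrary: vs rule: rev_induct)
    case Nil
    then show ?case using base by simp
  next
    case (snoc t us)
    have vs: "vs \<in> lists (Field (Tobj T X))" using snoc.prems(2) gens_subset[OF X] by auto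
    have us: "us \<in> lists (Field (Tobj T X))" "t \<in> Field (Tobj T X)" using snoc.prems(1) by auto
    have "Q (us @ t # vs)"
    proof (rule gens_induct[OF X closed _ us(2)])
      show "Q (us @ t # vs)" if "t \<in> gens X" for t
        using snoc.IH[of "t # vs"] us that snoc.prems by simp
    qed (use us vs snoc.prems in auto)
    then show ?case by simp
  qed
  from this[of ts "[]"] show ?thesis using ts by simp
qed

text \<open>The finitely many representing maps have a finite joint image \<open>A\<close>, and an
  enumeration of \<open>A\<close> by some \<open>V m\<close> factors all of them. It is continuous
  into \<open>X\<close> because \<open>V m\<close> is discrete, whatever order \<open>X\<close>
  induces on \<open>A\<close>.\<close>

lemma gens_common_arity:
  assumes X: "X \<in> CPO \<U>" and ts: "ts \<in> lists (gens X)"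
  obtains m g cs where "g \<in> cpo_hom (V m) X" "set cs \<subseteq> monad_sig x T m" "ts = map (Tmor T (V m)
      X g) cs"
proof -
  \<comment> \<open>\<open>P A t\<close> bounds the image of a representing map of \<open>t\<close>
    by \<open>A\<close>. It is monotone in \<open>A\<close>, which lets the set grow along the
    list.\<close>
  define P where "P A t \<longleftrightarrow> (\<exists>n s h. s \<in> monad_sig x T n \<and> h \<in> x ` {..<n} \<rightarrow>\<^sub>E Field X \<and>
      h ` x ` {..<n} \<subseteq> A \<and> t = Tmor T (V n) X h s)" for A t
  have P_mono: "P A t \<Longrightarrow> A \<subseteq> A' \<Longrightarrow> P A' t" for A A' t
    unfolding P_def by (elim exE conjE) (intro exI conjI, assumption+, erule (1) subset_trans)
  have "\<exists>A. finite A \<and> A \<subseteq> Field X \<and> (\<forall>t\<in>set ts. P A t)"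
    using ts
  proof (induction ts)
    case (Cons t ts)
    then obtain A where A: "finite A" "A \<subseteq> Field X" "\<forall>t\<in>set ts. P A t" by auto
    from Cons have "t \<in> gens X" by simp
    then obtain n h s where t: "t = Tmor T (V n) X h s" "h \<in> cpo_hom (V n) X" "s \<in> monad_sig x T n"
      unfolding gens_def monad_sig_def by blast
    have h: "h \<in> x ` {..<n} \<rightarrow>\<^sub>E Field X"
      using cpo_hom_Field[OF t(2)] cpo_hom_ext[OF t(2)] by (auto simp: Field_V PiE_def)
    have "P (A \<union> h ` x ` {..<n}) t" unfolding P_def using t(1,3) h by blast
    moreover have "P (A \<union> h ` x ` {..<n}) t'" if "t' \<in> set ts" for t'
      by (rule P_mono[of A]) (use A(3) that in auto)
    moreover have "A \<union> h ` x ` {..<n} \<subseteq> Field X" using A(2) h by auto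
    ultimately show ?case using A(1) by (intro exI[of _ "A \<union> h ` x ` {..<n}"]) auto
  qed auto
  then obtain A where A: "finite A" "A \<subseteq> Field X" and tsA: "\<forall>t\<in>set ts. P A t" by blast
  obtain m e d where e: "e \<in> x ` {..<m} \<rightarrow>\<^sub>E A" "d \<in> A \<rightarrow>\<^sub>E x ` {..<m}" "\<And>a. a \<in> A \<Longrightarrow> e (d a) = a"
    using finite_enumeration[OF A(1)] by metis
  have eh: "e \<in> cpo_hom (V m) X"
    unfolding Vn_def by (rule cpo_hom_Id_on[OF CPO_Partial_order[OF X]]) (use e(1) A(2) in auto)
  have "\<exists>c\<in>monad_sig x T m. t = Tmor T (V m) X e c" if t: "t \<in> set ts" for t
  proof -
    obtain n s h where h: "s \<in> monad_sig x T n" "h \<in> x ` {..<n} \<rightarrow>\<^sub>E Field X" "h ` x ` {..<n} \<subseteq> A"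
      "t = Tmor T (V n) X h s" using bspec[OF tsA t] unfolding P_def by blast
    have s: "s \<in> Field (Tobj T (V n))" using h(1) by (simp add: monad_sig_def)
    have dh: "compose (Field (V n)) d h \<in> cpo_hom (V n) (V m)"
      unfolding Vn_def[of x n] Vn_def[of x m]
      by (rule cpo_hom_Id_on_Id_on) (use PiE_mem[OF e(2)] h(3) in \<open>auto simp: Field_Id_on
          compose_def image_subset_iff\<close>)
    \<comment> \<open>\<open>h\<close> takes its values in \<open>A\<close>, where \<open>e\<close>
      after \<open>d\<close> is the identity; so \<open>h\<close> factors through
      \<open>V m\<close>.\<close>
    have "compose (Field (V n)) e (compose (Field (V n)) d h) = h"
      by (rule extensionalityI[of _ "Field (V n)"])
        (use h(2,3) e(3) in \<open>auto simp: Field_V compose_eq PiE_def image_subset_iff\<close>)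
    then have "t = Tmor T (V m) X e (Tmor T (V n) (V m) (compose (Field (V n)) d h) s)"
      using T.comp[OF V_CPO V_CPO X dh eh s] h(4) by simp
    moreover have "Tmor T (V n) (V m) (compose (Field (V n)) d h) s \<in> monad_sig x T m"
      unfolding monad_sig_def by (rule T_Field[OF V_CPO V_CPO dh s])
    ultimately show ?thesis by blast
  qed
  then obtain c where c: "\<And>t. t \<in> set ts \<Longrightarrow> c t \<in> monad_sig x T m \<and> t = Tmor T (V m) X e (c t)"
    by metis
  show ?thesis
  proof (rule that[OF eh])
    show "set (map c ts) \<subseteq> monad_sig x T m" using c by auto
    show "ts = map (Tmor T (V m) X e) (map c ts)" using c by (auto intro!: map_idI[symmetric])
  qed
qed

section \<open>\<open>TX\<close> as an algebra of the variety\<close>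

definition free_alg :: "'u rel \<Rightarrow> ('u, 'u) alg" where
  "free_alg X = \<lparr>carr = Tobj T X, oper = (\<lambda>\<sigma> ts. kl (V (length ts)) X (tup ts) \<sigma>)\<rparr>"

lemma carr_free_alg [simp]: "carr (free_alg X) = Tobj T X"
  by (simp add: free_alg_def)

lemma oper_free_alg: "length ts = n \<Longrightarrow> oper (free_alg X) \<sigma> ts = kl (V n) X (tup ts) \<sigma>"
  by (simp add: free_alg_def)

lemma trm_val_sym_trm: "trm_val A f (sym_trm n \<sigma>) = oper A \<sigma> (map f [0..<n])"
  by (simp add: sym_trm_def comp_def)

text \<open>The three kinds of equations are three properties of Kleisli extensions: they preserve
  joins (\<open>kl_hom\<close>), they compose (\<open>kl_kl\<close>), and along the unit they give
  back the original map (\<open>kl_unit\<close>). Continuity of the operations is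
  \<open>kl_cont\<close>.\<close>

lemma free_alg_in_variety:
  assumes X: "X \<in> CPO \<U>"
  shows "free_alg X \<in> monad_variety \<U> x T"
proof -
  let ?F = "free_alg X"
  note PTX = T_PO[OF X] and cTX = T.is_cpo[OF X]
  have "continuous_alg \<U> (monad_sig x T) ?F"
    unfolding continuous_alg_def
  proof (intro conjI allI ballI)
    show "carr ?F \<in> CPO \<U>" using T_CPO[OF X] by simp
    fix n \<sigma> assume \<sigma>: "\<sigma> \<in> monad_sig x T n"
    show "omega_cont (cpo_power (carr ?F) n) (carr ?F) (oper ?F \<sigma>)"
      unfolding carr_free_alg
    proof (rule omega_contI[OF Partial_order_cpo_power[OF PTX]])
      fix c s assume cs: "chain_sup (cpo_power (Tobj T X) n) c s"
      note D = chain_sup_cpo_powerD[OF cTX cs]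
      have F: "set (c k) \<subseteq> Field (Tobj T X)" "set s \<subseteq> Field (Tobj T X)" for k
        using chain_sup_Field[OF cs] by (simp_all add: Field_cpo_power[OF PTX])
      \<comment> \<open>A chain of argument lists amounts to a chain of maps out of
        \<open>V n\<close>, to which local continuity of \<open>T\<close> applies.\<close>
      have "chain_sup (hom_cpo (V n) (Tobj T X)) (\<lambda>k. tup (c k)) (tup s)"
        by (rule chain_sup_hom_cpoI) (use D F in \<open>auto simp: Field_V intro!: tup_hom[OF PTX]\<close>)
      from kl_cont[OF V_CPO X this, of \<sigma>] \<sigma>
      show "chain_sup (Tobj T X) (\<lambda>k. oper ?F \<sigma> (c k)) (oper ?F \<sigma> s)"
        using D by (simp add: monad_sig_def oper_free_alg)
    qed
  qed
  moreover have "satisfies ?F E" if E: "E \<in> monad_eqs x T" for E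
    unfolding satisfies_def
  proof (intro allI impI)
    fix f :: "nat \<Rightarrow> 'u" assume "range f \<subseteq> Field (carr ?F)"
    then have f: "set (map f [0..<n]) \<subseteq> Field (Tobj T X)" for n by auto
    let ?t = "\<lambda>n. tup (map f [0..<n])"
    have th: "?t n \<in> cpo_hom (V n) (Tobj T X)" for n by (rule tup_hom[OF PTX f]) simp
    have val: "trm_val ?F f (sym_trm n \<sigma>) = kl (V n) X (?t n) \<sigma>" for n \<sigma>
      by (simp add: trm_val_sym_trm oper_free_alg)
    show "\<exists>a. xtrm_val ?F f (fst E) = Some a \<and> xtrm_val ?F f (snd E) = Some a"
      using E unfolding monad_eqs_def Un_iff mem_Collect_eq
    proof (elim disjE exE conjE)
      fix n \<sigma> s
      assume E: "E = (Trm (sym_trm n \<sigma>), Join (\<lambda>k. Trm (sym_trm n (s k))))"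
        and s: "omega_chain (Tobj T (V n)) s" "is_join (Tobj T (V n)) s \<sigma>"
      have "chain_sup (Tobj T (V n)) s \<sigma>" using s by (simp add: chain_sup_def)
      then have c: "chain_sup (Tobj T X) (\<lambda>k. kl (V n) X (?t n) (s k)) (kl (V n) X (?t n) \<sigma>)"
        by (rule cpo_hom_chain_sup[OF kl_hom[OF V_CPO X th]])
      then have "join (Tobj T X) (\<lambda>k. kl (V n) X (?t n) (s k)) = kl (V n) X (?t n) \<sigma>"
        using join_eqI[OF PTX] unfolding chain_sup_def by blast
      then show ?thesis using chain_sup_step[OF c] by (simp add: E val)
    next
      fix n m k \<sigma>
      assume E: "E = (Trm (sym_trm m (kl (V n) (V m) k \<sigma>)),
          Trm (App \<sigma> (map (\<lambda>i. sym_trm m (k (x i))) [0..<n])))"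
        and \<sigma>: "\<sigma> \<in> monad_sig x T n" and k: "k \<in> x ` {..<n} \<rightarrow>\<^sub>E monad_sig x T m"
      have kh: "k \<in> cpo_hom (V n) (Tobj T (V m))"
        using cpo_hom_Id_on[OF T_PO[OF V_CPO]] k by (simp add: Vn_def[of x n] monad_sig_def)
      have "compose (Field (V n)) (kl (V m) X (?t m)) k = compose (x ` {..<length (map (\<lambda>i. k (x
          i)) [0..<n])})
          (kl (V m) X (?t m)) (tup (map (\<lambda>i. k (x i)) [0..<n]))"
        using tup_eta[of k n] cpo_hom_ext[OF kh] by (simp add: Field_V)
      also have "\<dots> = tup (map (kl (V m) X (?t m)) (map (\<lambda>i. k (x i)) [0..<n]))"
        by (rule compose_tup)
      finally have "kl (V m) X (?t m) (kl (V n) (V m) k \<sigma>)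
          = kl (V n) X (tup (map (kl (V m) X (?t m)) (map (\<lambda>i. k (x i)) [0..<n]))) \<sigma>"
        using kl_kl[OF V_CPO V_CPO X kh th] \<sigma> by (simp add: monad_sig_def)
      then show ?thesis by (simp add: E val oper_free_alg comp_def)
    next
      fix n i assume "E = (Trm (sym_trm n (unit T (V n) (x i))), Trm (Var i))" "i < n"
      then show ?thesis using kl_unit[OF V_CPO X th] by (simp add: val Field_V)
    qed
  qed
  ultimately show ?thesis unfolding monad_variety_def variety_def by blast
qed

lemma T_alg_hom:
  assumes X: "X \<in> CPO \<U>" and Y: "Y \<in> CPO \<U>" and f: "f \<in> cpo_hom X Y"
  shows "Tmor T X Y f \<in> alg_hom (monad_sig x T) (free_alg X) (free_alg Y)"
proof (rule alg_homI)
  show "Tmor T X Y f \<in> cpo_hom (carr (free_alg X)) (carr (free_alg Y))" using T.hom[OF X Y f] by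
      simp
  fix n \<sigma> ts assume \<sigma>: "\<sigma> \<in> monad_sig x T n" and ts: "length ts = n" "set ts \<subseteq> Field (carr
      (free_alg X))"
  have th: "tup ts \<in> cpo_hom (V n) (Tobj T X)" using tup_hom[OF T_PO[OF X]] ts by simp
  show "Tmor T X Y f (oper (free_alg X) \<sigma> ts) = oper (free_alg Y) \<sigma> (map (Tmor T X Y f) ts)"
    using T_kl[OF V_CPO X Y th f] \<sigma> ts compose_tup[of ts "Tmor T X Y f"]
    by (simp add: oper_free_alg monad_sig_def Field_V)
qed

lemma mult_alg_hom:
  assumes X: "X \<in> CPO \<U>"
  shows "mult T X \<in> alg_hom (monad_sig x T) (free_alg (Tobj T X)) (free_alg X)"
proof (rule alg_homI)
  show "mult T X \<in> cpo_hom (carr (free_alg (Tobj T X))) (carr (free_alg X))" using mult_hom[OF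
      X] by simp
  fix n \<sigma> ts assume \<sigma>: "\<sigma> \<in> monad_sig x T n" and ts: "length ts = n" "set ts \<subseteq> Field (carr
      (free_alg (Tobj T X)))"
  have th: "tup ts \<in> cpo_hom (V n) (Tobj T (Tobj T X))" using tup_hom[OF T_PO[OF T_CPO[OF X]]]
      ts by simp
  show "mult T X (oper (free_alg (Tobj T X)) \<sigma> ts) = oper (free_alg X) \<sigma> (map (mult T X) ts)"
    using mult_kl[OF V_CPO X th] \<sigma> ts compose_tup[of ts "mult T X"]
    by (simp add: oper_free_alg monad_sig_def Field_V)
qed

end

section \<open>Extending maps into an algebra\<close>

locale sf_monad_algebra = sf_monad \<U> x T for \<U> :: "'u set set" and x T +
  fixes B :: "('u, 'u) alg"
  assumes B_variety: "B \<in> monad_variety \<U> x T"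
begin

section \<open>The defining equations read in an algebra\<close>

abbreviation C :: "'u rel" where "C \<equiv> carr B"

lemma C_CPO: "C \<in> CPO \<U>"
  using B_variety unfolding monad_variety_def variety_def continuous_alg_def by blast

lemma C_cpo: "is_cpo C" and C_PO: "Partial_order C"
  using C_CPO CPO_is_cpo CPO_Partial_order by blast+

lemma oper_cont: "\<sigma> \<in> monad_sig x T n \<Longrightarrow> omega_cont (cpo_power C n) C (oper B \<sigma>)"
  using B_variety unfolding monad_variety_def variety_def continuous_alg_def by blast

lemma oper_Field:
  assumes "\<sigma> \<in> monad_sig x T n" "length as = n" "set as \<subseteq> Field C"
  shows "oper B \<sigma> as \<in> Field C"
  using omega_cont_Field[OF oper_cont[OF assms(1)]] assms(2,3) by (simp add: Field_cpo_power[OF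
      C_PO])

lemma oper_chain_sup:
  assumes "\<sigma> \<in> monad_sig x T n" "\<And>k. length (c k) = n" "length as = n"
    and "\<And>i. i < n \<Longrightarrow> chain_sup C (\<lambda>k. c k ! i) (as ! i)"
  shows "chain_sup C (\<lambda>k. oper B \<sigma> (c k)) (oper B \<sigma> as)"
  using omega_cont_chain_sup[OF oper_cont[OF assms(1)] chain_sup_cpo_powerI[OF assms(2-4)]] .

text \<open>Satisfaction quantifies over values for all variables, so a list of \<open>n\<close>
  values has to be padded by some element of the carrier. Each use must first exhibit such an
  element.\<close>

lemma assignment_exists:
  assumes "Field C \<noteq> {}" "length as = n" "set as \<subseteq> Field C"
  obtains f where "range f \<subseteq> Field C" "map f [0..<n] = as"
proof -
  obtain b where b: "b \<in> Field C" using assms(1) by blast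
  show ?thesis
  proof (rule that[of "\<lambda>i. if i < n then as ! i else b"])
    show "range (\<lambda>i. if i < n then as ! i else b) \<subseteq> Field C"
      using b assms(2,3) by (auto simp: subset_iff)
    show "map (\<lambda>i. if i < n then as ! i else b) [0..<n] = as"
      using assms(2) by (auto intro: nth_equalityI)
  qed
qed

lemma B_satisfies: "e \<in> monad_eqs x T \<Longrightarrow> range f \<subseteq> Field C \<Longrightarrow>
    \<exists>a. xtrm_val B f (fst e) = Some a \<and> xtrm_val B f (snd e) = Some a"
  using B_variety unfolding monad_variety_def variety_def satisfies_def by blast

lemma oper_chain_sup_symbol:
  assumes s: "chain_sup (Tobj T (V n)) s \<sigma>" and as: "length as = n" "set as \<subseteq> Field C"
  shows "chain_sup C (\<lambda>k. oper B (s k) as) (oper B \<sigma> as)"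
proof -
  have "\<sigma> \<in> monad_sig x T n" using chain_sup_Field[OF s] by (simp add: monad_sig_def)
  \<comment> \<open>The value of an operation is itself an element, so the carrier is nonempty even
    when \<open>n\<close> is 0.\<close>
  then have "Field C \<noteq> {}" using oper_Field as by blast
  then obtain f where f: "range f \<subseteq> Field C" "map f [0..<n] = as"
    using assignment_exists as by blast
  have "(Trm (sym_trm n \<sigma>), Join (\<lambda>k. Trm (sym_trm n (s k)))) \<in> monad_eqs x T"
    using s unfolding monad_eqs_def chain_sup_def by blast
  \<comment> \<open>Definedness of the formal join says that the values form a chain; its value says
    that their join is the value at \<open>\<sigma>\<close>.\<close>
  from B_satisfies[OF this f(1)]
  have *: "\<And>k. (oper B (s k) as, oper B (s (Suc k)) as) \<in> C"
    "oper B \<sigma> as = join C (\<lambda>k. oper B (s k) as)"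
    by (auto simp: trm_val_sym_trm f(2) split: if_splits)
  then show ?thesis
    using chain_sup_join[OF C_cpo, of "\<lambda>k. oper B (s k) as"] by (simp add: omega_chain_def)
qed

lemma oper_kl:
  assumes \<sigma>: "\<sigma> \<in> monad_sig x T n" and cs: "length cs = n" "set cs \<subseteq> monad_sig x T m"
    and as: "length as = m" "set as \<subseteq> Field C"
  shows "oper B (kl (V n) (V m) (tup cs) \<sigma>) as = oper B \<sigma> (map (\<lambda>c. oper B c as) cs)"
proof -
  have k: "tup cs \<in> x ` {..<n} \<rightarrow>\<^sub>E monad_sig x T m"
    using cs by (auto simp: tup_def inj_x inv_f_f)
  have "set (map (\<lambda>c. oper B c as) cs) \<subseteq> Field C" using cs as oper_Field by auto
  then have "Field C \<noteq> {}" using oper_Field[OF \<sigma>, of "map (\<lambda>c. oper B c as) cs"] cs by auto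
  then obtain f where f: "range f \<subseteq> Field C" "map f [0..<m] = as"
    using assignment_exists as by blast
  have "(Trm (sym_trm m (kl (V n) (V m) (tup cs) \<sigma>)),
       Trm (App \<sigma> (map (\<lambda>i. sym_trm m (tup cs (x i))) [0..<n]))) \<in> monad_eqs x T"
    using \<sigma> k unfolding monad_eqs_def by blast
  from B_satisfies[OF this f(1)]
  have "oper B (kl (V n) (V m) (tup cs) \<sigma>) as
    = oper B \<sigma> (map (\<lambda>i. oper B (tup cs (x i)) as) [0..<n])"
    by (simp add: trm_val_sym_trm f(2) comp_def)
  also have "map (\<lambda>i. oper B (tup cs (x i)) as) [0..<n] = map (\<lambda>c. oper B c as) cs"
    using cs(1) by (auto intro: nth_equalityI)
  finally show ?thesis .
qed

lemma oper_unit: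
  assumes "i < n" "length as = n" "set as \<subseteq> Field C"
  shows "oper B (unit T (V n) (x i)) as = as ! i"
proof -
  have "Field C \<noteq> {}" using assms by force
  then obtain f where f: "range f \<subseteq> Field C" "map f [0..<n] = as"
    using assignment_exists assms by blast
  have "(Trm (sym_trm n (unit T (V n) (x i))), Trm (Var i)) \<in> monad_eqs x T"
    using assms(1) unfolding monad_eqs_def by blast
  from B_satisfies[OF this f(1)]
  have "oper B (unit T (V n) (x i)) as = f i" by (simp add: trm_val_sym_trm f(2))
  then show ?thesis using f(2) assms(1) by auto
qed

text \<open>\<open>Tmor\<close> along a map of variables is a Kleisli extension of units
  (\<open>T_eq_kl\<close>), so equations (2) and (3) together turn it into a reindexing of
  arguments.\<close>

lemma oper_T:
  assumes \<sigma>: "\<sigma> \<in> monad_sig x T n" and j: "j \<in> x ` {..<n} \<rightarrow>\<^sub>E x ` {..<m}"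
    and as: "length as = m" "set as \<subseteq> Field C"
  shows "oper B (Tmor T (V n) (V m) j \<sigma>) as = oper B \<sigma> (map (\<lambda>i. tup as (j (x i))) [0..<n])"
proof -
  have jh: "j \<in> cpo_hom (V n) (V m)" using j by (simp add: Vn_def cpo_hom_Id_on_Id_on)
  define cs where "cs = map (\<lambda>i. unit T (V m) (j (x i))) [0..<n]"
  have jx: "\<exists>l<m. j (x i) = x l" if "i < n" for i using j that by blast
  have cs: "length cs = n" "set cs \<subseteq> monad_sig x T m"
    using cpo_hom_Field[OF unit_hom[OF V_CPO]] PiE_mem[OF j] by (auto simp: cs_def monad_sig_def
        Field_V)
  have "compose (Field (V n)) (unit T (V m)) j = tup cs"
  proof -
    have "map (\<lambda>i. compose (Field (V n)) (unit T (V m)) j (x i)) [0..<n] = cs"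
      by (simp add: cs_def Field_V compose_eq)
    then show ?thesis
      using tup_eta[of "compose (Field (V n)) (unit T (V m)) j" n] by (simp add: Field_V)
  qed
  then have "Tmor T (V n) (V m) j \<sigma> = kl (V n) (V m) (tup cs) \<sigma>"
    using T_eq_kl[OF V_CPO V_CPO jh] \<sigma> by (simp add: monad_sig_def)
  then have "oper B (Tmor T (V n) (V m) j \<sigma>) as = oper B \<sigma> (map (\<lambda>c. oper B c as) cs)"
    using oper_kl[OF \<sigma> cs as] by simp
  also have "map (\<lambda>c. oper B c as) cs = map (\<lambda>i. tup as (j (x i))) [0..<n]"
  proof -
    have "oper B (unit T (V m) (j (x i))) as = tup as (j (x i))" if "i < n" for i
      using jx[OF that] oper_unit[OF _ as] as(1) by auto
    then show ?thesis by (simp add: cs_def)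
  qed
  finally show ?thesis .
qed

text \<open>
  \<open>D X\<close> is the double dual \<open>[[X, C], C]\<close>; it need not be small, but \<open>E X\<close>, the part generated by
  terms, is.
\<close>

definition D :: "'u rel \<Rightarrow> (('u \<Rightarrow> 'u) \<Rightarrow> 'u) rel" where
  "D X = hom_cpo (hom_cpo X C) C"

definition Dmor :: "'u rel \<Rightarrow> 'u rel \<Rightarrow> ('u \<Rightarrow> 'u) \<Rightarrow> (('u \<Rightarrow> 'u) \<Rightarrow> 'u) \<Rightarrow> (('u \<Rightarrow> 'u) \<Rightarrow> 'u)" where
  "Dmor X Y f = (\<lambda>\<Phi>\<in>Field (D X). \<lambda>\<psi>\<in>cpo_hom Y C. \<Phi> (compose (Field X) \<psi> f))"

text \<open>The list \<open>g\<close> stands for a map from \<open>V n\<close> to \<open>X\<close>,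
  so this is the functional that an element of \<open>Tobj T (V n)\<close> and such a map determine.
  With lists the count in \<open>small_evals\<close> is immediate.\<close>

definition eval :: "'u rel \<Rightarrow> 'u \<Rightarrow> 'u list \<Rightarrow> ('u \<Rightarrow> 'u) \<Rightarrow> 'u" where
  "eval X \<sigma> g = (\<lambda>\<phi>\<in>cpo_hom X C. oper B \<sigma> (map \<phi> g))"

definition evals :: "'u rel \<Rightarrow> (('u \<Rightarrow> 'u) \<Rightarrow> 'u) set" where
  "evals X = {eval X \<sigma> g | \<sigma> g. \<sigma> \<in> monad_sig x T (length g) \<and> set g \<subseteq> Field X}"

abbreviation E :: "'u rel \<Rightarrow> (('u \<Rightarrow> 'u) \<Rightarrow> 'u) set" where
  "E X \<equiv> join_hull (D X) (evals X)"

lemma Field_dual: "Field (hom_cpo X C) = cpo_hom X C"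
  by (rule Field_hom_cpo[OF C_PO])

lemma PO_dual: "Partial_order (hom_cpo X C)"
  by (rule Partial_order_hom_cpo[OF C_PO])

lemma Field_D: "Field (D X) = cpo_hom (hom_cpo X C) C"
  unfolding D_def by (rule Field_hom_cpo[OF C_PO])

lemma is_cpo_D: "is_cpo (D X)"
  unfolding D_def by (rule is_cpo_hom_cpo[OF PO_dual C_cpo])

lemma D_chain_sup_iff:
  "chain_sup (D X) c \<Phi> \<longleftrightarrow> (\<forall>k. c k \<in> Field (D X)) \<and> \<Phi> \<in> Field (D X) \<and>
    (\<forall>\<phi>\<in>cpo_hom X C. chain_sup C (\<lambda>k. c k \<phi>) (\<Phi> \<phi>))"
  using chain_sup_hom_cpoI[of c "hom_cpo X C" C \<Phi>] chain_sup_hom_cpoD[OF PO_dual C_cpo, of X c \<Phi>]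
  unfolding Field_D Field_dual D_def by blast

lemma dual_chain_sup:
  assumes "X \<in> CPO \<U>"
  shows "chain_sup (hom_cpo X C) c \<phi> \<longleftrightarrow> (\<forall>k. c k \<in> cpo_hom X C) \<and> \<phi> \<in> cpo_hom X C \<and>
    (\<forall>a\<in>Field X. chain_sup C (\<lambda>k. c k a) (\<phi> a))"
  using chain_sup_hom_cpoI[of c X C \<phi>] chain_sup_hom_cpoD[OF CPO_Partial_order[OF assms] C_cpo,
      of c \<phi>]
  by blast

lemma Dmor_in_D:
  assumes X: "X \<in> CPO \<U>" and Y: "Y \<in> CPO \<U>" and f: "f \<in> cpo_hom X Y" and \<Phi>: "\<Phi> \<in> Field (D X)"
  shows "Dmor X Y f \<Phi> \<in> Field (D Y)"
proof -
  have "(\<lambda>\<psi>\<in>Field (hom_cpo Y C). \<Phi> (compose (Field X) \<psi> f)) \<in> cpo_hom (hom_cpo Y C) C"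
  proof (rule restrict_cpo_hom[OF PO_dual])
    fix c s assume c: "chain_sup (hom_cpo Y C) c s"
    have "chain_sup (hom_cpo X C) (\<lambda>k. compose (Field X) (c k) f) (compose (Field X) s f)"
      using c cpo_hom_Field[OF f] compose_cpo_hom[OF f _ CPO_Partial_order[OF X]]
      by (auto simp: dual_chain_sup[OF X] dual_chain_sup[OF Y] compose_eq)
    then show "chain_sup C (\<lambda>k. \<Phi> (compose (Field X) (c k) f)) (\<Phi> (compose (Field X) s f))"
      by (rule cpo_hom_chain_sup[OF \<Phi>[unfolded Field_D]])
  qed
  then show ?thesis using \<Phi> by (simp add: Dmor_def Field_D Field_dual)
qed

lemma Dmor_apply:
  "\<Phi> \<in> Field (D X) \<Longrightarrow> \<psi> \<in> cpo_hom Y C \<Longrightarrow> Dmor X Y f \<Phi> \<psi> = \<Phi> (compose (Field X) \<psi> f)"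
  by (simp add: Dmor_def)

lemma D_eqI: "\<Phi> \<in> Field (D X) \<Longrightarrow> \<Psi> \<in> Field (D X) \<Longrightarrow> (\<And>\<phi>. \<phi> \<in> cpo_hom X C \<Longrightarrow> \<Phi> \<phi> = \<Psi> \<phi>) \<Longrightarrow> \<Phi> = \<Psi>"
  using cpo_hom_eqI[of \<Phi> "hom_cpo X C" C \<Psi> C] by (simp add: Field_D Field_dual)

lemma D_functor: "cpo_functor \<U> D Dmor"
proof
  fix X Y Z f g c \<Phi>
  assume X: "X \<in> CPO \<U>"
  note PX = CPO_Partial_order[OF X]
  show "is_cpo (D X)" by (rule is_cpo_D)
  show "Dmor X X (cpo_id X) \<Phi> = \<Phi>" if \<Phi>: "\<Phi> \<in> Field (D X)"
  proof (rule D_eqI[OF Dmor_in_D[OF X X cpo_id_hom[OF PX] \<Phi>] \<Phi>])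
    fix \<phi> assume \<phi>: "\<phi> \<in> cpo_hom X C"
    have "compose (Field X) \<phi> (cpo_id X) = \<phi>"
      by (rule cpo_hom_eqI[OF compose_cpo_hom[OF cpo_id_hom[OF PX] \<phi> PX] \<phi>]) (simp add: compose_eq)
    then show "Dmor X X (cpo_id X) \<Phi> \<phi> = \<Phi> \<phi>" using \<Phi> \<phi> by (simp add: Dmor_apply)
  qed
  assume Y: "Y \<in> CPO \<U>"
  show "Dmor X Y f \<in> cpo_hom (D X) (D Y)" if f: "f \<in> cpo_hom X Y"
  proof (rule cpo_homI[OF is_cpo_Partial_order[OF is_cpo_D]])
    show "Dmor X Y f \<in> extensional (Field (D X))" by (simp add: Dmor_def)
    fix c s assume c: "chain_sup (D X) c s"
    then show "chain_sup (D Y) (\<lambda>k. Dmor X Y f (c k)) (Dmor X Y f s)"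
      using Dmor_in_D[OF X Y f] compose_cpo_hom[OF f _ PX, of _ C] by (simp add: D_chain_sup_iff
          Dmor_apply)
  qed
  show "Dmor X Z (compose (Field X) g f) \<Phi> = Dmor Y Z g (Dmor X Y f \<Phi>)"
    if Z: "Z \<in> CPO \<U>" and f: "f \<in> cpo_hom X Y" and g: "g \<in> cpo_hom Y Z" and \<Phi>: "\<Phi> \<in> Field (D X)"
  proof (rule D_eqI)
    note f\<Phi> = Dmor_in_D[OF X Y f \<Phi>]
    show "Dmor X Z (compose (Field X) g f) \<Phi> \<in> Field (D Z)"
      by (rule Dmor_in_D[OF X Z compose_cpo_hom[OF f g PX] \<Phi>])
    show "Dmor Y Z g (Dmor X Y f \<Phi>) \<in> Field (D Z)" by (rule Dmor_in_D[OF Y Z g f\<Phi>])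
    fix \<psi> assume \<psi>: "\<psi> \<in> cpo_hom Z C"
    have "compose (Field X) \<psi> (compose (Field X) g f) = compose (Field X) (compose (Field Y) \<psi> g) f"
      using cpo_hom_Field[OF f] by (auto simp: compose_def)
    then show "Dmor X Z (compose (Field X) g f) \<Phi> \<psi> = Dmor Y Z g (Dmor X Y f \<Phi>) \<psi>"
      using \<Phi> f\<Phi> \<psi> compose_cpo_hom[OF g \<psi> CPO_Partial_order[OF Y]] by (simp add: Dmor_apply)
  qed
  show "chain_sup (D Y) (\<lambda>k. Dmor X Y (c k) \<Phi>) (Dmor X Y f \<Phi>)"
    if c: "chain_sup (hom_cpo X Y) c f" and \<Phi>: "\<Phi> \<in> Field (D X)"
  proof -
    note H = chain_sup_hom_cpoD[OF PX CPO_is_cpo[OF Y] c]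
    have "chain_sup C (\<lambda>k. Dmor X Y (c k) \<Phi> \<psi>) (Dmor X Y f \<Phi> \<psi>)" if \<psi>: "\<psi> \<in> cpo_hom Y C" for \<psi>
    proof -
      \<comment> \<open>Local continuity: since \<open>\<psi>\<close> is continuous the composites
        form a chain in the dual of \<open>X\<close>, and \<open>\<Phi>\<close> preserves its join.
        Hence the restriction of \<open>D X\<close> to continuous functionals.\<close>
      have "chain_sup (hom_cpo X C) (\<lambda>k. compose (Field X) \<psi> (c k)) (compose (Field X) \<psi> f)"
        using compose_cpo_hom[OF H(1) \<psi> PX] compose_cpo_hom[OF H(2) \<psi> PX] cpo_hom_chain_sup[OF \<psi>
            H(3)]
        by (simp add: dual_chain_sup[OF X] compose_eq)
      then have "chain_sup C (\<lambda>k. \<Phi> (compose (Field X) \<psi> (c k))) (\<Phi> (compose (Field X) \<psi> f))"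
        by (rule cpo_hom_chain_sup[OF \<Phi>[unfolded Field_D]])
      then show ?thesis using \<Phi> \<psi> by (simp add: Dmor_apply)
    qed
    then show ?thesis
      using Dmor_in_D[OF X Y H(1) \<Phi>] Dmor_in_D[OF X Y H(2) \<Phi>] by (simp add: D_chain_sup_iff)
  qed
qed

lemma eval_in_D:
  assumes X: "X \<in> CPO \<U>" and \<sigma>: "\<sigma> \<in> monad_sig x T (length g)" and g: "set g \<subseteq> Field X"
  shows "eval X \<sigma> g \<in> Field (D X)"
proof -
  have "(\<lambda>\<phi>\<in>Field (hom_cpo X C). oper B \<sigma> (map \<phi> g)) \<in> cpo_hom (hom_cpo X C) C"
  proof (rule restrict_cpo_hom[OF PO_dual])
    fix c \<phi> assume c: "chain_sup (hom_cpo X C) c \<phi>"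
    show "chain_sup C (\<lambda>k. oper B \<sigma> (map (c k) g)) (oper B \<sigma> (map \<phi> g))"
    proof (rule oper_chain_sup[OF \<sigma>])
      fix i assume i: "i < length g"
      then have "g ! i \<in> Field X" using g by auto
      then show "chain_sup C (\<lambda>k. map (c k) g ! i) (map \<phi> g ! i)"
        using c i by (simp add: dual_chain_sup[OF X])
    qed simp_all
  qed
  then show ?thesis by (simp add: eval_def Field_D Field_dual)
qed

lemma evals_subset: "X \<in> CPO \<U> \<Longrightarrow> evals X \<subseteq> Field (D X)"
  unfolding evals_def using eval_in_D by blast

lemma Dmor_eval:
  assumes X: "X \<in> CPO \<U>" and Y: "Y \<in> CPO \<U>" and f: "f \<in> cpo_hom X Y"
    and \<sigma>: "\<sigma> \<in> monad_sig x T (length g)" and g: "set g \<subseteq> Field X"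
  shows "Dmor X Y f (eval X \<sigma> g) = eval Y \<sigma> (map f g)"
proof (rule D_eqI[OF Dmor_in_D[OF X Y f eval_in_D[OF X \<sigma> g]]])
  have fg: "set (map f g) \<subseteq> Field Y" using cpo_hom_Field[OF f] g by auto
  show "eval Y \<sigma> (map f g) \<in> Field (D Y)" by (rule eval_in_D[OF Y _ fg]) (use \<sigma> in simp)
  fix \<psi> assume \<psi>: "\<psi> \<in> cpo_hom Y C"
  have "map (compose (Field X) \<psi> f) g = map \<psi> (map f g)" using g by (auto simp: compose_eq)
  then show "Dmor X Y f (eval X \<sigma> g) \<psi> = eval Y \<sigma> (map f g) \<psi>"
    using \<psi> compose_cpo_hom[OF f \<psi> CPO_Partial_order[OF X]]
    unfolding Dmor_apply[OF eval_in_D[OF X \<sigma> g] \<psi>] by (simp add: eval_def del: map_map)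
qed

lemma Dmor_evals:
  assumes "X \<in> CPO \<U>" "Y \<in> CPO \<U>" "f \<in> cpo_hom X Y"
  shows "Dmor X Y f ` evals X \<subseteq> evals Y"
proof clarify
  fix \<Phi> assume "\<Phi> \<in> evals X"
  then obtain \<sigma> g where g: "\<Phi> = eval X \<sigma> g" "\<sigma> \<in> monad_sig x T (length g)" "set g \<subseteq> Field X"
    unfolding evals_def by blast
  have "set (map f g) \<subseteq> Field Y" "\<sigma> \<in> monad_sig x T (length (map f g))"
    using cpo_hom_Field[OF assms(3)] g by auto
  then show "Dmor X Y f \<Phi> \<in> evals Y"
    unfolding g(1) Dmor_eval[OF assms g(2,3)] evals_def by blast
qed

lemma E_subset: "X \<in> CPO \<U> \<Longrightarrow> E X \<subseteq> Field (D X)"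
  using join_hull_subset[OF evals_subset] .

lemma E_functor:
  "cpo_functor \<U> (\<lambda>X. Restr (D X) (E X)) (\<lambda>X Y f. restrict (Dmor X Y f) (E X))"
  by (rule cpo_functor_Restr[OF D_functor E_subset join_closed_join_hull])
    (assumption, rule cpo_hom_join_hull[OF cpo_functor.hom[OF D_functor] Dmor_evals])

text \<open>A generating functional is named by a symbol and a list. There are countably many
  arities, so all symbols together form a member of \<open>\<U>\<close>.\<close>

lemma small_evals:
  assumes X: "X \<in> CPO \<U>"
  shows "small \<U> (evals X)"
proof -
  have "(\<Union>n. monad_sig x T n) \<in> \<U>"
  proof -
    have "range (monad_sig x T) \<subseteq> \<U>"
      using T_CPO[OF V_CPO] by (auto simp: monad_sig_def CPO_def)
    then show ?thesis using univ unfolding universe_def by blast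
  qed
  then have "small \<U> ((\<Union>n. monad_sig x T n) \<times> lists (Field X))"
    using X by (intro small_Times[OF univ] small_lists[OF univ] small_in_universe) (simp_all
        add: CPO_def)
  then have "small \<U> ((\<lambda>(\<sigma>, g). eval X \<sigma> g) ` ((\<Union>n. monad_sig x T n) \<times> lists (Field X)))"
    by (rule small_image)
  then show ?thesis
    by (rule small_subset) (force simp: evals_def)
qed

lemma small_E: "X \<in> CPO \<U> \<Longrightarrow> small \<U> (Field (Restr (D X) (E X)))"
  using small_join_hull[OF univ is_cpo_Partial_order[OF is_cpo_D] small_evals]
    Field_Restr[OF is_cpo_Partial_order[OF is_cpo_D] E_subset] by simp

text \<open>Both sides come from presentations of the same element of \<open>T\<close> on
  \<open>Id_on A\<close>, since \<open>T\<close> is a functor. Their agreement is what makes the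
  transformation below independent of choices and natural.\<close>

lemma eval_T:
  assumes A: "Id_on A \<in> CPO \<U>" and \<sigma>: "\<sigma> \<in> monad_sig x T n"
    and j: "j \<in> x ` {..<n} \<rightarrow>\<^sub>E x ` {..<m}" and e: "e \<in> x ` {..<m} \<rightarrow>\<^sub>E A"
  shows "eval (Id_on A) (Tmor T (V n) (V m) j \<sigma>) (map (\<lambda>i. e (x i)) [0..<m])
    = eval (Id_on A) \<sigma> (map (\<lambda>i. e (j (x i))) [0..<n])"
  unfolding eval_def
proof (rule restrict_ext)
  fix \<phi> assume \<phi>: "\<phi> \<in> cpo_hom (Id_on A) C"
  let ?as = "map \<phi> (map (\<lambda>i. e (x i)) [0..<m])"
  have as: "length ?as = m" "set ?as \<subseteq> Field C"
    using cpo_hom_Field[OF \<phi>] PiE_mem[OF e] by (auto simp: Field_Id_on)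
  have "tup ?as (j (x i)) = \<phi> (e (j (x i)))" if "i < n" for i
  proof -
    have "j (x i) \<in> x ` {..<m}" by (rule PiE_mem[OF j]) (use that in simp)
    then obtain l where "l < m" "j (x i) = x l" by blast
    then show ?thesis using as(1) by simp
  qed
  then have eq: "map (\<lambda>i. tup ?as (j (x i))) [0..<n] = map \<phi> (map (\<lambda>i. e (j (x i))) [0..<n])" by
      simp
  show "oper B (Tmor T (V n) (V m) j \<sigma>) ?as = oper B \<sigma> (map \<phi> (map (\<lambda>i. e (j (x i))) [0..<n]))"
    unfolding oper_T[OF \<sigma> j as] eq ..
qed

text \<open>That the values lie in \<open>E X\<close> is forgotten here, since it serves only to
  have a small target. The last clause fixes \<open>\<tau>\<close> on the \<open>V n\<close>, and by
  naturality on all generators.\<close>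

definition dual_extension :: "('u rel \<Rightarrow> 'u \<Rightarrow> ('u \<Rightarrow> 'u) \<Rightarrow> 'u) \<Rightarrow> bool" where
  "dual_extension \<tau> \<longleftrightarrow> (\<forall>X\<in>CPO \<U>. \<tau> X \<in> cpo_hom (Tobj T X) (D X)) \<and>
    (\<forall>X\<in>CPO \<U>. \<forall>Y\<in>CPO \<U>. \<forall>f\<in>cpo_hom X Y. \<forall>t\<in>Field (Tobj T X).
      Dmor X Y f (\<tau> X t) = \<tau> Y (Tmor T X Y f t)) \<and>
    (\<forall>n. \<forall>\<sigma>\<in>monad_sig x T n. \<tau> (V n) \<sigma> = eval (V n) \<sigma> (map x [0..<n]))"

lemma ex_dual_extension: "\<exists>\<tau>. dual_extension \<tau>"
proof -
  have fin: "Id_on A \<in> CPO \<U>" if "finite A" for A :: "'u set" using Id_on_in_CPO[OF univ that] .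
  have "\<exists>n e d. finite A \<longrightarrow> e \<in> x ` {..<n} \<rightarrow>\<^sub>E A \<and> d \<in> A \<rightarrow>\<^sub>E x ` {..<n} \<and>
      (\<forall>a\<in>A. e (d a) = a) \<and> (\<forall>v\<in>x ` {..<n}. d (e v) = v)" for A :: "'u set"
  proof (cases "finite A")
    case True
    then show ?thesis by (rule finite_enumeration) blast
  qed simp
  then obtain N :: "'u set \<Rightarrow> nat" and e d where
    "\<forall>A. finite A \<longrightarrow> e A \<in> x ` {..<N A} \<rightarrow>\<^sub>E A \<and> d A \<in> A \<rightarrow>\<^sub>E x ` {..<N A} \<and>
      (\<forall>a\<in>A. e A (d A a) = a) \<and> (\<forall>v\<in>x ` {..<N A}. d A (e A v) = v)"
    by metis
  then have e: "e A \<in> x ` {..<N A} \<rightarrow>\<^sub>E A" and d: "d A \<in> A \<rightarrow>\<^sub>E x ` {..<N A}"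
    and ed: "a \<in> A \<Longrightarrow> e A (d A a) = a" and de: "v \<in> x ` {..<N A} \<Longrightarrow> d A (e A v) = v"
    if "finite A" for A a v
    using that by blast+
  have eh: "e A \<in> cpo_hom (V (N A)) (Id_on A)" and dh: "d A \<in> cpo_hom (Id_on A) (V (N A))"
    if "finite A" for A
    using e[OF that] d[OF that] by (simp_all add: Vn_def cpo_hom_Id_on_Id_on)
  let ?Td = "\<lambda>A. Tmor T (Id_on A) (V (N A)) (d A)"
  have Td: "?Td A t \<in> monad_sig x T (N A)" if "finite A" "t \<in> Field (Tobj T (Id_on A))" for A t
    using T_Field[OF fin V_CPO dh] that by (simp add: monad_sig_def)
  \<comment> \<open>The element \<open>t\<close> is pulled back to \<open>V (N A)\<close> along
    \<open>d A\<close>, and its variables are sent to \<open>A\<close> by \<open>e A\<close>. The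
    enumeration is an arbitrary choice; \<open>\<sigma>_T\<close> shows that every other
    presentation gives the same functional.\<close>
  define \<sigma> where "\<sigma> A = (\<lambda>t\<in>Field (Tobj T (Id_on A)).
    eval (Id_on A) (?Td A t) (map (\<lambda>i. e A (x i)) [0..<N A]))" for A
  have ex: "set (map (\<lambda>i. e A (x i)) [0..<N A]) \<subseteq> Field (Id_on A)" if "finite A" for A
    using e[OF that] by (auto simp: Field_Id_on)
  have \<sigma>_T: "\<sigma> A (Tmor T (V n) (Id_on A) g s) = eval (Id_on A) s (map (\<lambda>i. g (x i)) [0..<n])"
    if A: "finite A" and g: "g \<in> x ` {..<n} \<rightarrow>\<^sub>E A" and s: "s \<in> monad_sig x T n" for A n g s
  proof -
    have gh: "g \<in> cpo_hom (V n) (Id_on A)" using g by (simp add: Vn_def cpo_hom_Id_on_Id_on)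
    let ?j = "compose (Field (V n)) (d A) g"
    have j: "?j \<in> x ` {..<n} \<rightarrow>\<^sub>E x ` {..<N A}"
      using g d[OF A] by (auto simp: Field_V compose_def)
    have "?Td A (Tmor T (V n) (Id_on A) g s) = Tmor T (V n) (V (N A)) ?j s"
      using T.comp[OF V_CPO fin[OF A] V_CPO gh dh[OF A]] s by (simp add: monad_sig_def)
    moreover have "Tmor T (V n) (Id_on A) g s \<in> Field (Tobj T (Id_on A))"
      using T_Field[OF V_CPO fin[OF A] gh] s by (simp add: monad_sig_def)
    moreover have gj: "map (\<lambda>i. e A (?j (x i))) [0..<n] = map (\<lambda>i. g (x i)) [0..<n]"
      using PiE_mem[OF g] ed[OF A] by (simp add: Field_V compose_eq)
    ultimately show ?thesis using eval_T[OF fin[OF A] s j e[OF A], unfolded gj] by (simp add: \<sigma>_def)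
  qed
  \<comment> \<open>Continuity in \<open>t\<close> is where equation (1) is used, through
    \<open>oper_chain_sup_symbol\<close>.\<close>
  have \<sigma>_hom: "\<sigma> A \<in> cpo_hom (Tobj T (Id_on A)) (Restr (D (Id_on A)) (E (Id_on A)))" if A:
      "finite A" for A
    unfolding \<sigma>_def
  proof (rule restrict_cpo_hom[OF T_PO[OF fin[OF A]]])
    let ?g = "map (\<lambda>i. e A (x i)) [0..<N A]"
    have in_E: "eval (Id_on A) s ?g \<in> evals (Id_on A)" if "s \<in> monad_sig x T (N A)" for s
      unfolding evals_def using that ex[OF A] by fastforce
    fix c t assume c: "chain_sup (Tobj T (Id_on A)) c t"
    note F = chain_sup_Field[OF c]
    have Tc: "chain_sup (Tobj T (V (N A))) (\<lambda>k. ?Td A (c k)) (?Td A t)"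
      by (rule cpo_hom_chain_sup[OF T.hom[OF fin[OF A] V_CPO dh[OF A]] c])
    have "chain_sup (D (Id_on A)) (\<lambda>k. eval (Id_on A) (?Td A (c k)) ?g) (eval (Id_on A) (?Td A
        t) ?g)"
      unfolding D_chain_sup_iff
    proof (intro conjI allI ballI)
      show "eval (Id_on A) (?Td A (c k)) ?g \<in> Field (D (Id_on A))" "eval (Id_on A) (?Td A t) ?g
          \<in> Field (D (Id_on A))" for k
        using in_E Td[OF A] F evals_subset[OF fin[OF A]] by blast+
      fix \<phi> assume \<phi>: "\<phi> \<in> cpo_hom (Id_on A) C"
      then show "chain_sup C (\<lambda>k. eval (Id_on A) (?Td A (c k)) ?g \<phi>) (eval (Id_on A) (?Td A t)
          ?g \<phi>)"
        using oper_chain_sup_symbol[OF Tc, of "map \<phi> ?g"] cpo_hom_Field[OF \<phi>] ex[OF A]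
        by (auto simp: eval_def comp_def)
    qed
    then show "chain_sup (Restr (D (Id_on A)) (E (Id_on A)))
        (\<lambda>k. eval (Id_on A) (?Td A (c k)) ?g) (eval (Id_on A) (?Td A t) ?g)"
      by (rule chain_sup_RestrI) (use in_E Td[OF A] F in \<open>auto intro: join_hull.base\<close>)
  qed
  have \<sigma>_nat: "restrict (Dmor (Id_on A) (Id_on A') f) (E (Id_on A)) (\<sigma> A t)
      = \<sigma> A' (Tmor T (Id_on A) (Id_on A') f t)"
    if A: "finite A" and A': "finite A'" and f: "f \<in> A \<rightarrow>\<^sub>E A'" and t: "t \<in> Field (Tobj T (Id_on A))"
    for A A' f t
  proof -
    note fh = cpo_hom_Id_on_Id_on[OF f]
    have "\<sigma> A t \<in> E (Id_on A)"
      using cpo_hom_into_Restr(2)[OF T_PO[OF fin[OF A]] is_cpo_D E_subset[OF fin[OF A]]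
          join_closed_join_hull \<sigma>_hom[OF A] t] .
    then have "restrict (Dmor (Id_on A) (Id_on A') f) (E (Id_on A)) (\<sigma> A t)
        = eval (Id_on A') (?Td A t) (map f (map (\<lambda>i. e A (x i)) [0..<N A]))"
      using Dmor_eval[OF fin[OF A] fin[OF A'] fh _ ex[OF A]] Td[OF A t] t by (simp add: \<sigma>_def)
    also have "\<dots> = eval (Id_on A') (?Td A t) (map (\<lambda>i. compose (Field (V (N A))) f (e A) (x i))
        [0..<N A])"
    proof -
      have "map f (map (\<lambda>i. e A (x i)) [0..<N A]) = map (\<lambda>i. compose (Field (V (N A))) f (e A)
          (x i)) [0..<N A]"
        by (simp add: Field_V compose_eq)
      then show ?thesis by (rule arg_cong)
    qed
    \<comment> \<open>\<open>f\<close> after \<open>e A\<close> need not be the enumeration chosen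
      for \<open>A'\<close>; \<open>\<sigma>_T\<close> absorbs the difference.\<close>
    also have "\<dots> = \<sigma> A' (Tmor T (V (N A)) (Id_on A') (compose (Field (V (N A))) f (e A)) (?Td A t))"
      by (rule \<sigma>_T[symmetric, OF A' _ Td[OF A t]]) (use PiE_mem[OF e[OF A]] PiE_mem[OF f] in
          \<open>auto simp: Field_V compose_def\<close>)
    also have "\<dots> = \<sigma> A' (Tmor T (Id_on A) (Id_on A') f (Tmor T (V (N A)) (Id_on A) (e A) (?Td A
        t)))"
      using T.comp[OF V_CPO fin[OF A] fin[OF A'] eh[OF A] fh] Td[OF A t] by (simp add:
          monad_sig_def)
    also have "Tmor T (V (N A)) (Id_on A) (e A) (?Td A t) = t"
      by (rule T_enumeration[OF A e[OF A] d[OF A] ed[OF A] t])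
    finally show ?thesis .
  qed
  have "\<exists>\<tau>. extends_along_K \<U> (endo T) (\<lambda>X. Restr (D X) (E X))
      (\<lambda>X Y f. restrict (Dmor X Y f) (E X)) \<sigma> \<tau>"
    by (rule strongly_finitary_extension[OF univ sf_T endo_T E_functor])
      (rule small_E \<sigma>_hom \<sigma>_nat; assumption)+
  then obtain \<tau> where \<tau>: "extends_along_K \<U> (endo T) (\<lambda>X. Restr (D X) (E X))
      (\<lambda>X Y f. restrict (Dmor X Y f) (E X)) \<sigma> \<tau>"
    by blast
  note \<tau>D = cpo_hom_into_Restr[OF T_PO is_cpo_D E_subset join_closed_join_hull
      extends_along_KD(1)[OF \<tau>]]
  show ?thesis
    unfolding dual_extension_def
  proof (intro exI[of _ \<tau>] conjI ballI allI)
    show "\<tau> X \<in> cpo_hom (Tobj T X) (D X)" if "X \<in> CPO \<U>" for X using \<tau>D(1) that by blast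
    show "Dmor X Y f (\<tau> X t) = \<tau> Y (Tmor T X Y f t)"
      if "X \<in> CPO \<U>" "Y \<in> CPO \<U>" "f \<in> cpo_hom X Y" "t \<in> Field (Tobj T X)" for X Y f t
      using extends_along_KD(2)[OF \<tau> that] \<tau>D(2)[OF that(1,1,1,4)] by simp
    fix n s assume s: "s \<in> monad_sig x T n"
    have f: "finite (x ` {..<n})" by simp
    \<comment> \<open>The enumeration chosen for the set of the first \<open>n\<close> variables may
      permute them, so \<open>\<sigma>_T\<close> is applied with the identity as
      presentation.\<close>
    have "\<tau> (V n) s = \<sigma> (x ` {..<n}) s"
      using extends_along_KD(3)[OF \<tau> f] by (simp add: Vn_def)
    also have "\<dots> = \<sigma> (x ` {..<n}) (Tmor T (V n) (V n) (cpo_id (V n)) s)"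
      using T.id[OF V_CPO, of s n] s by (simp add: monad_sig_def)
    also have "\<dots> = eval (V n) s (map (\<lambda>i. cpo_id (V n) (x i)) [0..<n])"
      using \<sigma>_T[OF f _ s, of "cpo_id (V n)"] by (simp add: Vn_def Field_Id_on)
    also have "map (\<lambda>i. cpo_id (V n) (x i)) [0..<n] = map x [0..<n]" by (simp add: Field_V)
    finally show "\<tau> (V n) s = eval (V n) s (map x [0..<n])" .
  qed
qed

text \<open>One transformation is chosen for all \<open>X\<close> and \<open>f\<close>, so that its
  naturality becomes \<open>extend_T\<close>.\<close>

definition extend :: "'u rel \<Rightarrow> ('u \<Rightarrow> 'u) \<Rightarrow> 'u \<Rightarrow> 'u" where
  "extend X f = (\<lambda>t\<in>Field (Tobj T X). (SOME \<tau>. dual_extension \<tau>) X t f)"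

lemma extend_props:
  shows extend_hom: "\<And>X f. X \<in> CPO \<U> \<Longrightarrow> f \<in> cpo_hom X C \<Longrightarrow> extend X f \<in> cpo_hom (Tobj T X) C"
    and extend_T: "\<And>X Y f g t. X \<in> CPO \<U> \<Longrightarrow> Y \<in> CPO \<U> \<Longrightarrow> g \<in> cpo_hom X Y \<Longrightarrow> f \<in> cpo_hom Y C \<Longrightarrow>
      t \<in> Field (Tobj T X) \<Longrightarrow> extend Y f (Tmor T X Y g t) = extend X (compose (Field X) f g) t"
    and extend_V: "\<And>n f \<sigma>. f \<in> cpo_hom (V n) C \<Longrightarrow> \<sigma> \<in> monad_sig x T n \<Longrightarrow>
      extend (V n) f \<sigma> = oper B \<sigma> (map (\<lambda>i. f (x i)) [0..<n])"
proof -
  define \<tau> where "\<tau> = (SOME \<tau>. dual_extension \<tau>)"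
  have ext: "extend X f = (\<lambda>t\<in>Field (Tobj T X). \<tau> X t f)" for X f
    by (simp add: extend_def \<tau>_def)
  have "dual_extension \<tau>" unfolding \<tau>_def by (rule someI_ex[OF ex_dual_extension])
  then have \<tau>: "\<And>X. X \<in> CPO \<U> \<Longrightarrow> \<tau> X \<in> cpo_hom (Tobj T X) (D X)"
    "\<And>X Y f t. X \<in> CPO \<U> \<Longrightarrow> Y \<in> CPO \<U> \<Longrightarrow> f \<in> cpo_hom X Y \<Longrightarrow> t \<in> Field (Tobj T X) \<Longrightarrow>
      Dmor X Y f (\<tau> X t) = \<tau> Y (Tmor T X Y f t)"
    "\<And>n \<sigma>. \<sigma> \<in> monad_sig x T n \<Longrightarrow> \<tau> (V n) \<sigma> = eval (V n) \<sigma> (map x [0..<n])"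
    unfolding dual_extension_def by blast+
  show "extend X f \<in> cpo_hom (Tobj T X) C" if X: "X \<in> CPO \<U>" and f: "f \<in> cpo_hom X C" for X f
    unfolding ext
  proof (rule restrict_cpo_hom[OF T_PO[OF X]])
    fix c s assume "chain_sup (Tobj T X) c s"
    from cpo_hom_chain_sup[OF \<tau>(1)[OF X] this] f
    show "chain_sup C (\<lambda>k. \<tau> X (c k) f) (\<tau> X s f)" by (simp add: D_chain_sup_iff)
  qed
  show "extend Y f (Tmor T X Y g t) = extend X (compose (Field X) f g) t"
    if X: "X \<in> CPO \<U>" and Y: "Y \<in> CPO \<U>" and g: "g \<in> cpo_hom X Y" and f: "f \<in> cpo_hom Y C"
      and t: "t \<in> Field (Tobj T X)" for X Y f g t
    using \<tau>(2)[OF X Y g t, symmetric] T_Field[OF X Y g t] t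
      Dmor_apply[OF cpo_hom_Field[OF \<tau>(1)[OF X] t] f] by (simp add: ext)
  show "extend (V n) f \<sigma> = oper B \<sigma> (map (\<lambda>i. f (x i)) [0..<n])"
    if "f \<in> cpo_hom (V n) C" "\<sigma> \<in> monad_sig x T n" for n f \<sigma>
    using that by (simp add: ext \<tau>(3) eval_def comp_def monad_sig_def[symmetric])
qed

lemma extend_gen:
  assumes X: "X \<in> CPO \<U>" and f: "f \<in> cpo_hom X C" and g: "g \<in> cpo_hom (V n) X" and \<sigma>: "\<sigma> \<in>
      monad_sig x T n"
  shows "extend X f (Tmor T (V n) X g \<sigma>) = oper B \<sigma> (map (\<lambda>i. f (g (x i))) [0..<n])"
proof -
  have "extend X f (Tmor T (V n) X g \<sigma>) = extend (V n) (compose (Field (V n)) f g) \<sigma>"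
    using extend_T[OF V_CPO X g f] \<sigma> by (simp add: monad_sig_def)
  also have "\<dots> = oper B \<sigma> (map (\<lambda>i. compose (Field (V n)) f g (x i)) [0..<n])"
    by (rule extend_V[OF compose_cpo_hom[OF g f CPO_Partial_order[OF V_CPO]] \<sigma>])
  also have "map (\<lambda>i. compose (Field (V n)) f g (x i)) [0..<n] = map (\<lambda>i. f (g (x i))) [0..<n]"
    by (simp add: Field_V compose_eq)
  finally show ?thesis .
qed

text \<open>A point of \<open>X\<close> is a map out of \<open>V 1\<close>, and naturality presents
  \<open>unit T X a\<close> as the image of the unit at \<open>x 0\<close>. There equation (3) gives
  the value.\<close>

lemma extend_unit:
  assumes X: "X \<in> CPO \<U>" and f: "f \<in> cpo_hom X C" and a: "a \<in> Field X"
  shows "extend X f (unit T X a) = f a"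
proof -
  have p: "tup [a] \<in> cpo_hom (V 1) X" using a by (intro tup_hom[OF CPO_Partial_order[OF X]]) auto
  have px: "tup [a] (x 0) = a" by simp
  have u: "unit T (V 1) (x 0) \<in> monad_sig x T 1"
    using cpo_hom_Field[OF unit_hom[OF V_CPO]] by (simp add: monad_sig_def Field_V)
  have "unit T X a = Tmor T (V 1) X (tup [a]) (unit T (V 1) (x 0))"
    using unit_nat[OF V_CPO X p] px by (simp add: Field_V)
  then show ?thesis
    using extend_gen[OF X f p u] oper_unit[of 0 1 "[f a]"] cpo_hom_Field[OF f a] px by simp
qed

lemma oper_chain_sup_coordinate:
  assumes \<sigma>: "\<sigma> \<in> monad_sig x T (Suc (length us + length vs))"
    and us: "set us \<subseteq> Field C" "set vs \<subseteq> Field C" and c: "chain_sup C c a"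
  shows "chain_sup C (\<lambda>k. oper B \<sigma> (us @ c k # vs)) (oper B \<sigma> (us @ a # vs))"
proof (rule oper_chain_sup[OF \<sigma>])
  fix i assume i: "i < Suc (length us + length vs)"
  have "set (us @ a # vs) \<subseteq> Field C" using us chain_sup_Field[OF c] by auto
  then have "(us @ a # vs) ! i \<in> Field C" using i nth_mem[of i "us @ a # vs"] by auto
  then have const: "chain_sup C (\<lambda>_. (us @ a # vs) ! i) ((us @ a # vs) ! i)"
    by (rule chain_sup_const[OF C_PO])
  show "chain_sup C (\<lambda>k. (us @ c k # vs) ! i) ((us @ a # vs) ! i)"
  proof (cases "i = length us")
    case False
    then have "(us @ b # vs) ! i = (us @ a # vs) ! i" for b by (simp add: nth_append nth_Cons')
    then have "(\<lambda>k. (us @ c k # vs) ! i) = (\<lambda>_. (us @ a # vs) ! i)" by blast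
    then show ?thesis using const by simp
  qed (use c in simp)
qed simp_all

text \<open>
  By continuity in each argument it suffices to consider arguments in \<open>gens X\<close>, and finitely many of
  these come from a common \<open>TV\<^sub>m\<close>, where the claim is an equation of the second kind.
\<close>

lemma extend_alg_hom:
  assumes X: "X \<in> CPO \<U>" and f: "f \<in> cpo_hom X C"
  shows "extend X f \<in> alg_hom (monad_sig x T) (free_alg X) B"
proof (rule alg_homI)
  note h = extend_hom[OF X f]
  show "extend X f \<in> cpo_hom (carr (free_alg X)) C" using h by simp
  fix n \<sigma> ts assume \<sigma>: "\<sigma> \<in> monad_sig x T n" and ts: "length ts = n" "set ts \<subseteq> Field (carr
      (free_alg X))"
  \<comment> \<open>The free algebra is itself in the variety, so continuity in a single argument,
    proved for \<open>B\<close>, is available for its operations too.\<close>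
  interpret F: sf_monad_algebra \<U> x T "free_alg X"
    by unfold_locales (rule free_alg_in_variety[OF X])
  show "extend X f (oper (free_alg X) \<sigma> ts) = oper B \<sigma> (map (extend X f) ts)"
  proof (rule gens_list_induct[where n = n and X = X
          and Q = "\<lambda>ts. extend X f (oper (free_alg X) \<sigma> ts) = oper B \<sigma> (map (extend X f) ts)"])
    show "ts \<in> lists (Field (Tobj T X))" "length ts = n" using ts by auto
  next
    fix us vs assume us: "us \<in> lists (Field (Tobj T X))" and vs: "vs \<in> lists (Field (Tobj T X))"
      and n: "Suc (length us + length vs) = n"
    have us': "set us \<subseteq> Field (Tobj T X)" and vs': "set vs \<subseteq> Field (Tobj T X)" using us vs by auto
    have im: "set (map (extend X f) us) \<subseteq> Field C" "set (map (extend X f) vs) \<subseteq> Field C"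
      using us' vs' cpo_hom_Field[OF h] by auto
    show "join_closed (Tobj T X) {t. extend X f (oper (free_alg X) \<sigma> (us @ t # vs))
        = oper B \<sigma> (map (extend X f) (us @ t # vs))}"
    proof (rule join_closed_equalizer[OF C_PO])
      fix c s assume c: "chain_sup (Tobj T X) c s"
      show "chain_sup C (\<lambda>k. extend X f (oper (free_alg X) \<sigma> (us @ c k # vs)))
          (extend X f (oper (free_alg X) \<sigma> (us @ s # vs)))"
        by (rule cpo_hom_chain_sup[OF h, OF F.oper_chain_sup_coordinate[unfolded carr_free_alg]])
          (use \<sigma> n us' vs' c in auto)
      show "chain_sup C (\<lambda>k. oper B \<sigma> (map (extend X f) (us @ c k # vs)))
          (oper B \<sigma> (map (extend X f) (us @ s # vs)))"
        using oper_chain_sup_coordinate[of \<sigma> "map (extend X f) us" "map (extend X f) vs", OF _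
            im cpo_hom_chain_sup[OF h c]]
          \<sigma> n by simp
    qed
  next
    fix ts assume "ts \<in> lists (gens X)" and n: "length ts = n"
    then obtain m g cs where g: "g \<in> cpo_hom (V m) X" and cs: "set cs \<subseteq> monad_sig x T m"
      and ts: "ts = map (Tmor T (V m) X g) cs"
      using gens_common_arity[OF X] by metis
    have cs_hom: "tup cs \<in> cpo_hom (V n) (Tobj T (V m))"
      by (rule tup_hom[OF T_PO[OF V_CPO]]) (use cs n ts in \<open>auto simp: monad_sig_def\<close>)
    let ?as = "map (\<lambda>i. f (g (x i))) [0..<m]"
    have "f (g (x i)) \<in> Field C" if "i < m" for i
      using cpo_hom_Field[OF f cpo_hom_Field[OF g]] that by (simp add: Field_V)
    then have as: "length ?as = m" "set ?as \<subseteq> Field C" by auto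
    have \<sigma>': "kl (V n) (V m) (tup cs) \<sigma> \<in> monad_sig x T m"
      using kl_Field[OF V_CPO V_CPO cs_hom] \<sigma> by (simp add: monad_sig_def)
    have "oper (free_alg X) \<sigma> ts = kl (V n) X (tup ts) \<sigma>" by (rule oper_free_alg[OF n])
    also have "tup ts = compose (Field (V n)) (Tmor T (V m) X g) (tup cs)"
      using compose_tup[of cs "Tmor T (V m) X g"] n by (simp add: ts Field_V)
    also have "kl (V n) X \<dots> \<sigma> = Tmor T (V m) X g (kl (V n) (V m) (tup cs) \<sigma>)"
      using T_kl[OF V_CPO V_CPO X cs_hom g] \<sigma> by (simp add: monad_sig_def)
    also have "extend X f \<dots> = oper B (kl (V n) (V m) (tup cs) \<sigma>) ?as"
      by (rule extend_gen[OF X f g \<sigma>'])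
    also have "\<dots> = oper B \<sigma> (map (\<lambda>c. oper B c ?as) cs)"
      by (rule oper_kl[OF \<sigma> _ cs as]) (use n ts in simp)
    also have "map (\<lambda>c. oper B c ?as) cs = map (extend X f) ts"
      using extend_gen[OF X f g] cs by (auto simp: ts)
    finally show "extend X f (oper (free_alg X) \<sigma> ts) = oper B \<sigma> (map (extend X f) ts)" .
  qed (rule X)
qed

lemma alg_hom_oper:
  "h \<in> alg_hom \<Sigma> A A' \<Longrightarrow> \<sigma> \<in> \<Sigma> n \<Longrightarrow> length as = n \<Longrightarrow> set as \<subseteq> Field (carr A) \<Longrightarrow>
    h (oper A \<sigma> as) = oper A' \<sigma> (map h as)"
  unfolding alg_hom_def by blast

text \<open>By \<open>T_eq_kl\<close> a generator \<open>Tmor T (V n) X g s\<close> is the operation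
  \<open>s\<close> applied to the units at \<open>g (x i)\<close>. Homomorphisms that agree on units
  thus agree on generators, and joins of chains reach the rest.\<close>

lemma alg_hom_unique:
  assumes X: "X \<in> CPO \<U>"
    and u: "u \<in> alg_hom (monad_sig x T) (free_alg X) B" and v: "v \<in> alg_hom (monad_sig x T)
        (free_alg X) B"
    and eq: "\<And>a. a \<in> Field X \<Longrightarrow> u (unit T X a) = v (unit T X a)"
  shows "u = v"
proof -
  have uh: "u \<in> cpo_hom (Tobj T X) C" and vh: "v \<in> cpo_hom (Tobj T X) C"
    using u v by (simp_all add: alg_hom_def)
  show ?thesis
  proof (rule cpo_hom_eqI[OF uh vh])
    fix t assume t: "t \<in> Field (Tobj T X)"
    show "u t = v t"
    proof (rule gens_induct[OF X _ _ t])
      show "join_closed (Tobj T X) {t. u t = v t}"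
        by (rule join_closed_equalizer[OF C_PO cpo_hom_chain_sup[OF uh] cpo_hom_chain_sup[OF vh]])
      fix t assume "t \<in> gens X"
      then obtain n g s where t: "t = Tmor T (V n) X g s" and g: "g \<in> cpo_hom (V n) X"
        and s: "s \<in> Field (Tobj T (V n))"
        unfolding gens_def by blast
      let ?as = "map (\<lambda>i. unit T X (g (x i))) [0..<n]"
      have gx: "g (x i) \<in> Field X" if "i < n" for i
        using cpo_hom_Field[OF g] that by (simp add: Field_V)
      then have as: "length ?as = n" "set ?as \<subseteq> Field (carr (free_alg X))"
        using cpo_hom_Field[OF unit_hom[OF X]] by auto
      have eta: "?as = map (\<lambda>i. compose (Field (V n)) (unit T X) g (x i)) [0..<n]"
        by (simp add: Field_V compose_eq)
      have "tup ?as = compose (Field (V n)) (unit T X) g"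
        unfolding eta by (rule tup_eta) (simp add: Field_V)
      then have t': "t = oper (free_alg X) s ?as"
        using T_eq_kl[OF V_CPO X g s] by (simp add: t oper_free_alg)
      have "map u ?as = map v ?as" using gx eq by simp
      moreover have "s \<in> monad_sig x T n" using s by (simp add: monad_sig_def)
      ultimately show "u t = v t"
        using alg_hom_oper[OF u _ as] alg_hom_oper[OF v _ as] unfolding t' by metis
    qed
  qed
qed

end

lemma alg_hom_compose:
  assumes u: "u \<in> alg_hom \<Sigma> A B" and v: "v \<in> alg_hom \<Sigma> B D" and A: "continuous_alg \<U> \<Sigma> A"
  shows "compose (Field (carr A)) v u \<in> alg_hom \<Sigma> A D"
proof (rule alg_homI)
  have uh: "u \<in> cpo_hom (carr A) (carr B)" and vh: "v \<in> cpo_hom (carr B) (carr D)"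
    using u v by (simp_all add: alg_hom_def)
  have PA: "Partial_order (carr A)"
    using A CPO_Partial_order unfolding continuous_alg_def by blast
  show "compose (Field (carr A)) v u \<in> cpo_hom (carr A) (carr D)" by (rule compose_cpo_hom[OF uh
      vh PA])
  fix n \<sigma> as assume \<sigma>: "\<sigma> \<in> \<Sigma> n" and as: "length as = n" "set as \<subseteq> Field (carr A)"
  have "oper A \<sigma> as \<in> Field (carr A)"
    using A \<sigma> as unfolding continuous_alg_def omega_cont_def Field_cpo_power[OF PA] by blast
  moreover have "set (map u as) \<subseteq> Field (carr B)" using as(2) cpo_hom_Field[OF uh] by auto
  moreover have "map (compose (Field (carr A)) v u) as = map v (map u as)"
    using as(2) by (auto simp: compose_eq)
  moreover have "v (oper B \<sigma> (map u as)) = oper D \<sigma> (map v (map u as))"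
    using v \<sigma> as(1) \<open>set (map u as) \<subseteq> Field (carr B)\<close> unfolding alg_hom_def by (auto simp del:
        map_map)
  moreover have "u (oper A \<sigma> as) = oper B \<sigma> (map u as)"
    using u \<sigma> as unfolding alg_hom_def by blast
  ultimately show "compose (Field (carr A)) v u (oper A \<sigma> as)
      = oper D \<sigma> (map (compose (Field (carr A)) v u) as)"
    by (simp add: compose_eq del: map_map)
qed

section \<open>Comparison with the free-algebra monad\<close>

context sf_monad
begin

abbreviation Sig :: "nat \<Rightarrow> 'u set" where "Sig \<equiv> monad_sig x T"
abbreviation Var_T :: "('u, 'u) alg set" where "Var_T \<equiv> monad_variety \<U> x T"
abbreviation lift :: "('u, 'u) alg \<Rightarrow> 'u rel \<Rightarrow> ('u \<Rightarrow> 'u) \<Rightarrow> 'u \<Rightarrow> 'u" where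
  "lift B \<equiv> sf_monad_algebra.extend \<U> x T B"

lemma algebra: "B \<in> Var_T \<Longrightarrow> sf_monad_algebra \<U> x T B"
  by unfold_locales

lemma Var_T_continuous: "B \<in> Var_T \<Longrightarrow> continuous_alg \<U> Sig B"
  unfolding monad_variety_def variety_def by blast

lemma Var_T_CPO: "B \<in> Var_T \<Longrightarrow> carr B \<in> CPO \<U>"
  using Var_T_continuous unfolding continuous_alg_def by blast

lemma Var_T_PO: "B \<in> Var_T \<Longrightarrow> Partial_order (carr B)"
  using Var_T_CPO CPO_Partial_order by blast

lemmas lift_alg_hom = sf_monad_algebra.extend_alg_hom[OF algebra]
lemmas lift_unit = sf_monad_algebra.extend_unit[OF algebra]
lemmas free_alg_hom_unique = sf_monad_algebra.alg_hom_unique[OF algebra]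

lemma alg_hom_cpo_hom: "h \<in> alg_hom \<Sigma> A A' \<Longrightarrow> h \<in> cpo_hom (carr A) (carr A')"
  by (simp add: alg_hom_def)

lemma alg_hom_comp:
  assumes "A \<in> Var_T" "u \<in> alg_hom Sig A A'" "v \<in> alg_hom Sig A' A''"
  shows "compose (Field (carr A)) v u \<in> alg_hom Sig A A''"
  by (rule alg_hom_compose[OF assms(2,3) Var_T_continuous[OF assms(1)]])

lemma alg_hom_id: "A \<in> Var_T \<Longrightarrow> cpo_id (carr A) \<in> alg_hom Sig A A"
proof (rule alg_homI)
  assume A: "A \<in> Var_T"
  then interpret A: sf_monad_algebra \<U> x T A by (rule algebra)
  show "cpo_id (carr A) \<in> cpo_hom (carr A) (carr A)" by (rule cpo_id_hom[OF Var_T_PO[OF A]])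
  fix n \<sigma> as assume \<sigma>: "\<sigma> \<in> Sig n" and as: "length as = n" "set as \<subseteq> Field (carr A)"
  have "map (cpo_id (carr A)) as = as" using as(2) by (intro map_idI) auto
  then show "cpo_id (carr A) (oper A \<sigma> as) = oper A \<sigma> (map (cpo_id (carr A)) as)"
    using A.oper_Field[OF \<sigma> as] by simp
qed

lemma UF_free_alg: "UF free_alg (Tmor T) = endo T"
  by (simp add: UF_def)

text \<open>The counit is the extension of the identity of the carrier, so the triangle identity at
  an algebra is \<open>lift_unit\<close>. Its naturality and the other triangle compare
  homomorphisms out of a free algebra and need checking on units only.\<close>

lemma free_adjunction_free_alg:
  "free_adjunction \<U> Sig Var_T free_alg (Tmor T) (unit T) (\<lambda>A. lift A (carr A) (cpo_id (carr A)))"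
    (is "free_adjunction _ _ _ _ _ _ ?\<epsilon>")
  unfolding free_adjunction_def UF_free_alg
proof (intro conjI ballI)
  show "enriched_endo \<U> (endo T)" by (rule endo_T)
  show "nat_trans \<U> id_endo (endo T) (unit T)"
    using sfm unfolding strongly_finitary_monad_def enriched_monad_def by blast
next
  fix X assume X: "X \<in> CPO \<U>"
  note TX = T_CPO[OF X] and FX = free_alg_in_variety[OF X]
  show "free_alg X \<in> Var_T" by (rule FX)
  have \<epsilon>: "?\<epsilon> (free_alg X) \<in> alg_hom Sig (free_alg (Tobj T X)) (free_alg X)"
    using lift_alg_hom[OF FX TX] cpo_id_hom[OF T_PO[OF X]] by simp
  have T\<eta>: "Tmor T X (Tobj T X) (unit T X) \<in> alg_hom Sig (free_alg X) (free_alg (Tobj T X))"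
    by (rule T_alg_hom[OF X TX unit_hom[OF X]])
  have "compose (Field (carr (free_alg X))) (?\<epsilon> (free_alg X)) (Tmor T X (Tobj T X) (unit T X))
      = cpo_id (carr (free_alg X))"
  proof (rule free_alg_hom_unique[OF FX X alg_hom_comp[OF FX T\<eta> \<epsilon>] alg_hom_id[OF FX]])
    fix a assume a: "a \<in> Field X"
    have \<eta>a: "unit T X a \<in> Field (Tobj T X)" by (rule cpo_hom_Field[OF unit_hom[OF X] a])
    have "?\<epsilon> (free_alg X) (unit T (Tobj T X) (unit T X a)) = unit T X a"
      using lift_unit[OF FX TX _ \<eta>a, of "cpo_id (Tobj T X)"] cpo_id_hom[OF T_PO[OF X]] \<eta>a by simp
    then show "compose (Field (carr (free_alg X))) (?\<epsilon> (free_alg X)) (Tmor T X (Tobj T X) (unit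
        T X)) (unit T X a)
        = cpo_id (carr (free_alg X)) (unit T X a)"
      using \<eta>a unit_nat[OF X TX unit_hom[OF X] a] by (simp add: compose_eq)
  qed
  then show "compose (Field (carr (free_alg X))) (?\<epsilon> (free_alg X))
      (Tmor T X (carr (free_alg X)) (unit T X)) = cpo_id (carr (free_alg X))" by simp
next
  fix X Y f assume "X \<in> CPO \<U>" "Y \<in> CPO \<U>" "f \<in> cpo_hom X Y"
  then show "Tmor T X Y f \<in> alg_hom Sig (free_alg X) (free_alg Y)" by (rule T_alg_hom)
next
  fix A assume A: "A \<in> Var_T"
  note C = Var_T_CPO[OF A] and i = cpo_id_hom[OF Var_T_PO[OF A]]
  show \<epsilon>A: "?\<epsilon> A \<in> alg_hom Sig (free_alg (carr A)) A" by (rule lift_alg_hom[OF A C i])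
  have \<epsilon>\<eta>: "?\<epsilon> A (unit T (carr A) a) = a" if "a \<in> Field (carr A)" for a
    using lift_unit[OF A C i that] that by simp
  then show "compose (Field (carr A)) (?\<epsilon> A) (unit T (carr A)) = cpo_id (carr A)"
    by (auto simp: compose_def)
  fix A' h assume A': "A' \<in> Var_T" and h: "h \<in> alg_hom Sig A A'"
  note C' = Var_T_CPO[OF A'] and i' = cpo_id_hom[OF Var_T_PO[OF A']]
  note hh = alg_hom_cpo_hom[OF h] and FC = free_alg_in_variety[OF C]
  show "compose (Field (carr (free_alg (carr A)))) h (?\<epsilon> A)
      = compose (Field (carr (free_alg (carr A)))) (?\<epsilon> A') (Tmor T (carr A) (carr A') h)"
  proof (rule free_alg_hom_unique[OF A' C alg_hom_comp[OF FC \<epsilon>A h]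
        alg_hom_comp[OF FC T_alg_hom[OF C C' hh] lift_alg_hom[OF A' C' i']]])
    fix a assume a: "a \<in> Field (carr A)"
    have "?\<epsilon> A' (unit T (carr A') (h a)) = h a"
      using lift_unit[OF A' C' i' cpo_hom_Field[OF hh a]] cpo_hom_Field[OF hh a] by simp
    then show "compose (Field (carr (free_alg (carr A)))) h (?\<epsilon> A) (unit T (carr A) a)
        = compose (Field (carr (free_alg (carr A)))) (?\<epsilon> A') (Tmor T (carr A) (carr A') h) (unit
            T (carr A) a)"
      using \<epsilon>\<eta>[OF a] unit_nat[OF C C' hh a] cpo_hom_Field[OF unit_hom[OF C] a]
      by (simp add: compose_eq)
  qed
qed

text \<open>The adjunction is arbitrary and known only through its laws. Apart from the unit law,
  every equation required of the comparison \<open>\<alpha>\<close> is between homomorphisms out of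
  some \<open>free_alg\<close>, or out of \<open>Fo X\<close> for one of the inverse laws, so it can
  be tested on units.\<close>

lemma isomorphic_to_free_algebra_monad:
  assumes adj: "free_adjunction \<U> Sig Var_T Fo Fm \<eta> \<epsilon>"
  shows "isomorphic_monads \<U> T \<lparr>endo = UF Fo Fm, unit = \<eta>, mult = (\<lambda>X\<in>CPO \<U>. \<epsilon> (Fo X))\<rparr>"
    (is "isomorphic_monads \<U> T ?M")
proof -
  have Fo: "Fo X \<in> Var_T" if "X \<in> CPO \<U>" for X
    using adj that unfolding free_adjunction_def by blast
  have FoC: "carr (Fo X) \<in> CPO \<U>" if "X \<in> CPO \<U>" for X using Var_T_CPO[OF Fo[OF that]] .
  have Fm: "Fm X Y f \<in> alg_hom Sig (Fo X) (Fo Y)"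
    if "X \<in> CPO \<U>" "Y \<in> CPO \<U>" "f \<in> cpo_hom X Y" for X Y f
    using adj that unfolding free_adjunction_def by blast
  have "enriched_endo \<U> (UF Fo Fm)" using adj unfolding free_adjunction_def by blast
  then interpret M: cpo_functor \<U> "\<lambda>X. carr (Fo X)" Fm
    by (simp add: enriched_endo_iff UF_def)
  have nt: "nat_trans \<U> id_endo (UF Fo Fm) \<eta>" using adj unfolding free_adjunction_def by blast
  then have \<eta>: "\<eta> X \<in> cpo_hom X (carr (Fo X))" if "X \<in> CPO \<U>" for X
    using that by (simp add: nat_trans_def id_endo_def UF_def)
  have \<eta>_nat: "Fm X Y f (\<eta> X a) = \<eta> Y (f a)"
    if "X \<in> CPO \<U>" "Y \<in> CPO \<U>" "f \<in> cpo_hom X Y" "a \<in> Field X" for X Y f a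
  proof -
    have "compose (Field X) (Fm X Y f) (\<eta> X) = compose (Field X) (\<eta> Y) f"
      using nt that by (simp add: nat_trans_def id_endo_def UF_def)
    from fun_cong[OF this, of a] show ?thesis using that by (simp add: compose_eq)
  qed
  have \<epsilon>: "\<epsilon> A \<in> alg_hom Sig (Fo (carr A)) A" if "A \<in> Var_T" for A
    using adj that unfolding free_adjunction_def by blast
  have \<epsilon>_nat: "h (\<epsilon> A t) = \<epsilon> A' (Fm (carr A) (carr A') h t)"
    if "A \<in> Var_T" "A' \<in> Var_T" "h \<in> alg_hom Sig A A'" "t \<in> Field (carr (Fo (carr A)))" for A A' h t
  proof -
    have "compose (Field (carr (Fo (carr A)))) h (\<epsilon> A)
        = compose (Field (carr (Fo (carr A)))) (\<epsilon> A') (Fm (carr A) (carr A') h)"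
      using adj that unfolding free_adjunction_def by blast
    from fun_cong[OF this, of t] show ?thesis using that by (simp add: compose_eq)
  qed
  have triangle1: "\<epsilon> (Fo X) (Fm X (carr (Fo X)) (\<eta> X) t) = t"
    if "X \<in> CPO \<U>" "t \<in> Field (carr (Fo X))" for X t
  proof -
    have "compose (Field (carr (Fo X))) (\<epsilon> (Fo X)) (Fm X (carr (Fo X)) (\<eta> X)) = cpo_id (carr (Fo
        X))"
      using adj that unfolding free_adjunction_def by blast
    from fun_cong[OF this, of t] show ?thesis using that by (simp add: compose_eq)
  qed
  have triangle2: "\<epsilon> A (\<eta> (carr A) a) = a" if "A \<in> Var_T" "a \<in> Field (carr A)" for A a
  proof -
    have "compose (Field (carr A)) (\<epsilon> A) (\<eta> (carr A)) = cpo_id (carr A)"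
      using adj that unfolding free_adjunction_def by blast
    from fun_cong[OF this, of a] show ?thesis using that by (simp add: compose_eq)
  qed
  \<comment> \<open>The adjunction determines a homomorphism \<open>w\<close> by its composite with
    \<open>\<eta> X\<close>: naturality of the counit and the first triangle identity express
    \<open>w t\<close> through that composite.\<close>
  have Fo_unique: "u = v"
    if X: "X \<in> CPO \<U>" and A: "A \<in> Var_T" and u: "u \<in> alg_hom Sig (Fo X) A" and v: "v \<in> alg_hom
        Sig (Fo X) A"
      and eq: "\<And>a. a \<in> Field X \<Longrightarrow> u (\<eta> X a) = v (\<eta> X a)" for X A u v
  proof (rule cpo_hom_eqI[OF alg_hom_cpo_hom[OF u] alg_hom_cpo_hom[OF v]])
    fix t assume t: "t \<in> Field (carr (Fo X))"
    have *: "w t = \<epsilon> A (Fm X (carr A) (compose (Field X) w (\<eta> X)) t)" if w: "w \<in> alg_hom Sig (Fo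
        X) A" for w
    proof -
      have "Fm X (carr (Fo X)) (\<eta> X) t \<in> Field (carr (Fo (carr (Fo X))))"
        by (rule cpo_hom_Field[OF M.hom[OF X FoC[OF X] \<eta>[OF X]] t])
      from \<epsilon>_nat[OF Fo[OF X] A w this] triangle1[OF X t]
      show ?thesis
        using M.comp[OF X FoC[OF X] Var_T_CPO[OF A] \<eta>[OF X] alg_hom_cpo_hom[OF w] t] by simp
    qed
    have "compose (Field X) u (\<eta> X) = compose (Field X) v (\<eta> X)"
      unfolding compose_def using eq by (auto intro: restrict_ext)
    then show "u t = v t" using *[OF u] *[OF v] by simp
  qed
  define \<alpha> where "\<alpha> = (\<lambda>X\<in>CPO \<U>. lift (Fo X) X (\<eta> X))"
  have \<alpha>: "\<alpha> X \<in> alg_hom Sig (free_alg X) (Fo X)" if "X \<in> CPO \<U>" for X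
    using lift_alg_hom[OF Fo[OF that] that \<eta>[OF that]] that by (simp add: \<alpha>_def)
  have \<alpha>h: "\<alpha> X \<in> cpo_hom (Tobj T X) (carr (Fo X))" if "X \<in> CPO \<U>" for X
    using alg_hom_cpo_hom[OF \<alpha>[OF that]] by simp
  have \<alpha>\<eta>: "\<alpha> X (unit T X a) = \<eta> X a" if "X \<in> CPO \<U>" "a \<in> Field X" for X a
    using lift_unit[OF Fo[OF that(1)] that(1) \<eta>[OF that(1)] that(2)] that by (simp add: \<alpha>_def)
  have \<eta>F: "unit T X a \<in> Field (Tobj T X)" if "X \<in> CPO \<U>" "a \<in> Field X" for X a
    using cpo_hom_Field[OF unit_hom] that by blast
  have "monad_morphism \<U> T ?M \<alpha>"
    unfolding monad_morphism_def nat_trans_def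
  proof (intro conjI ballI)
    show "\<alpha> \<in> extensional (CPO \<U>)" by (simp add: \<alpha>_def)
  next
    fix X assume X: "X \<in> CPO \<U>"
    show "\<alpha> X \<in> cpo_hom (Tobj T X) (obj (endo ?M) X)" using \<alpha>h[OF X] by (simp add: UF_def)
    show "compose (Field X) (\<alpha> X) (unit T X) = unit ?M X"
      by (rule cpo_hom_eqI[OF compose_cpo_hom[OF unit_hom[OF X] \<alpha>h[OF X] CPO_Partial_order[OF
          X]], of _ "carr (Fo X)"])
        (use \<eta>[OF X] \<alpha>\<eta>[OF X] in \<open>simp_all add: compose_eq\<close>)
    note TX = T_CPO[OF X] and MX = FoC[OF X]
    note FTX = free_alg_in_variety[OF TX]
    have "compose (Field (Tobj T (Tobj T X))) (\<alpha> X) (mult T X)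
      = compose (Field (Tobj T (Tobj T X))) (\<epsilon> (Fo X))
          (compose (Field (Tobj T (Tobj T X))) (\<alpha> (carr (Fo X))) (Tmor T (Tobj T X) (carr (Fo
              X)) (\<alpha> X)))"
    proof (rule free_alg_hom_unique[OF Fo[OF X] TX])
      show "compose (Field (Tobj T (Tobj T X))) (\<alpha> X) (mult T X) \<in> alg_hom Sig (free_alg (Tobj T
          X)) (Fo X)"
        using alg_hom_comp[OF FTX mult_alg_hom[OF X] \<alpha>[OF X]] by simp
      show "compose (Field (Tobj T (Tobj T X))) (\<epsilon> (Fo X))
          (compose (Field (Tobj T (Tobj T X))) (\<alpha> (carr (Fo X))) (Tmor T (Tobj T X) (carr (Fo
              X)) (\<alpha> X)))
          \<in> alg_hom Sig (free_alg (Tobj T X)) (Fo X)"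
        using alg_hom_comp[OF FTX alg_hom_comp[OF FTX T_alg_hom[OF TX MX \<alpha>h[OF X]] \<alpha>[OF MX]]
            \<epsilon>[OF Fo[OF X]]]
        by simp
      \<comment> \<open>The elements of \<open>Tobj T X\<close> are the free generators here; on
        their units both sides reduce to \<open>\<alpha> X t\<close>.\<close>
      fix t assume t: "t \<in> Field (Tobj T X)"
      have "\<epsilon> (Fo X) (\<alpha> (carr (Fo X)) (unit T (carr (Fo X)) (\<alpha> X t))) = \<alpha> X t"
        using \<alpha>\<eta>[OF MX cpo_hom_Field[OF \<alpha>h[OF X] t]] triangle2[OF Fo[OF X] cpo_hom_Field[OF
            \<alpha>h[OF X] t]] by simp
      then show "compose (Field (Tobj T (Tobj T X))) (\<alpha> X) (mult T X) (unit T (Tobj T X) t)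
        = compose (Field (Tobj T (Tobj T X))) (\<epsilon> (Fo X))
          (compose (Field (Tobj T (Tobj T X))) (\<alpha> (carr (Fo X))) (Tmor T (Tobj T X) (carr (Fo
              X)) (\<alpha> X)))
          (unit T (Tobj T X) t)"
        using \<eta>F[OF TX t] monad_laws(1)[OF X t] unit_nat[OF TX MX \<alpha>h[OF X] t] by (simp add:
            compose_eq)
    qed
    then show "compose (Field (Tobj T (Tobj T X))) (\<alpha> X) (mult T X)
      = compose (Field (Tobj T (Tobj T X))) (mult ?M X)
          (compose (Field (Tobj T (Tobj T X))) (\<alpha> (Tobj ?M X)) (Tmor T (Tobj T X) (Tobj ?M X) (\<alpha>
              X)))"
      using X by (simp add: UF_def)
  next
    fix X Y f assume X: "X \<in> CPO \<U>" and Y: "Y \<in> CPO \<U>" and f: "f \<in> cpo_hom X Y"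
    note FX = free_alg_in_variety[OF X]
    have "compose (Field (carr (free_alg X))) (Fm X Y f) (\<alpha> X)
        = compose (Field (carr (free_alg X))) (\<alpha> Y) (Tmor T X Y f)"
    proof (rule free_alg_hom_unique[OF Fo[OF Y] X alg_hom_comp[OF FX \<alpha>[OF X] Fm[OF X Y f]]
          alg_hom_comp[OF FX T_alg_hom[OF X Y f] \<alpha>[OF Y]]])
      fix a assume a: "a \<in> Field X"
      show "compose (Field (carr (free_alg X))) (Fm X Y f) (\<alpha> X) (unit T X a)
        = compose (Field (carr (free_alg X))) (\<alpha> Y) (Tmor T X Y f) (unit T X a)"
        using \<eta>F[OF X a] \<alpha>\<eta>[OF X a] \<eta>_nat[OF X Y f a] unit_nat[OF X Y f a] \<alpha>\<eta>[OF Y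
            cpo_hom_Field[OF f a]]
        by (simp add: compose_eq)
    qed
    then show "compose (Field (Tobj T X)) (mor (endo ?M) X Y f) (\<alpha> X)
        = compose (Field (Tobj T X)) (\<alpha> Y) (Tmor T X Y f)"
      by (simp add: UF_def)
  qed
  moreover have "cpo_iso (Tobj T X) (Tobj ?M X) (\<alpha> X)" if X: "X \<in> CPO \<U>" for X
  proof -
    note TX = T_CPO[OF X] and FX = free_alg_in_variety[OF X] and MX = FoC[OF X]
    \<comment> \<open>\<open>\<beta>\<close> is the transpose of \<open>unit T X\<close> under the
      given adjunction.\<close>
    define \<beta> where "\<beta> = compose (Field (carr (Fo X))) (\<epsilon> (free_alg X)) (Fm X (Tobj T X) (unit T X))"
    have \<beta>: "\<beta> \<in> alg_hom Sig (Fo X) (free_alg X)"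
      unfolding \<beta>_def using alg_hom_comp[OF Fo[OF X] Fm[OF X TX unit_hom[OF X]]] \<epsilon>[OF FX] by simp
    have \<beta>\<eta>: "\<beta> (\<eta> X a) = unit T X a" if a: "a \<in> Field X" for a
      using \<eta>_nat[OF X TX unit_hom[OF X] a] triangle2[OF FX] \<eta>F[OF X a] cpo_hom_Field[OF \<eta>[OF X] a]
      by (simp add: \<beta>_def compose_eq)
    have "compose (Field (carr (free_alg X))) \<beta> (\<alpha> X) = cpo_id (carr (free_alg X))"
      by (rule free_alg_hom_unique[OF FX X alg_hom_comp[OF FX \<alpha>[OF X] \<beta>] alg_hom_id[OF FX]])
        (simp add: compose_eq \<eta>F[OF X] \<alpha>\<eta>[OF X] \<beta>\<eta>)
    moreover have "compose (Field (carr (Fo X))) (\<alpha> X) \<beta> = cpo_id (carr (Fo X))"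
      by (rule Fo_unique[OF X Fo[OF X] alg_hom_comp[OF Fo[OF X] \<beta> \<alpha>[OF X]] alg_hom_id[OF Fo[OF X]]])
        (use cpo_hom_Field[OF \<eta>[OF X]] \<alpha>\<eta>[OF X] \<beta>\<eta> in \<open>simp add: compose_eq\<close>)
    moreover have "\<beta> \<in> cpo_hom (carr (Fo X)) (Tobj T X)" using alg_hom_cpo_hom[OF \<beta>] by simp
    ultimately show ?thesis
      unfolding cpo_iso_def using \<alpha>h[OF X] by (auto simp: UF_def)
  qed
  ultimately show ?thesis unfolding isomorphic_monads_def by blast
qed

end

text \<open>Left adjoints are determined only up to isomorphism, so the second conjunct covers every
  choice; the first keeps it from holding vacuously.\<close>

theorem theorem4p25:
  fixes \<U> :: "'u set set" and x :: "nat \<Rightarrow> 'u" and T :: "'u monad"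
  assumes "universe \<U>"
    and "inj x"
    and "strongly_finitary_monad \<U> T"
  shows "(\<exists>M. free_algebra_monad \<U> (monad_sig x T) (monad_variety \<U> x T) M) \<and>
    (\<forall>M. free_algebra_monad \<U> (monad_sig x T) (monad_variety \<U> x T) M \<longrightarrow>
       isomorphic_monads \<U> T M)"
proof -
  interpret sf_monad \<U> x T by unfold_locales (rule assms)+
  show ?thesis
    unfolding free_algebra_monad_def
    using free_adjunction_free_alg isomorphic_to_free_algebra_monad by blast
qed

end
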